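(* Let $G$ be a finite group and $p$ a fixed prime divisor of $|G|$. Then every self-centralizing non-nilpotent subgroup of $G$ is a TI-subgroup of $G$ or subnormal in $G$ or has $p'$-order if and only if every non-nilpotent subgroup of $G$ is a TI-subgroup of $G$ or subnormal in $G$ or has $p'$-order.
   Context: All groups are finite. A subgroup $H$ of a group $G$ is a TI-subgroup of $G$ if for every $g\in G$, $H^g\cap H=1$ or $H^g\cap H=H$. A subgroup $H$ of $G$ is self-centralizing in $G$ if $C_G(H)\leq H$. A subgroup has $p'$-order if its order is not divisible by $p$. *)

theory Defs
  imports "HOL-Algebra.Algebra"
begin

fun lower_central :: "('a, 'b) monoid_scheme \<Rightarrow> nat \<Rightarrow> 'a set" where
  "lower_central G 0 = carrier G"
| "lower_central G (Suc n) =
     generate G {x \<otimes>\<^bsub>G\<^esub> y \<otimes>\<^bsub>G\<^esub> inv\<^bsub>G\<^esub> x \<otimes>\<^bsub>G\<^esub> inv\<^bsub>G\<^esub> y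
                 | x y. x \<in> lower_central G n \<and> y \<in> carrier G}"

definition nilpotent_group :: "('a, 'b) monoid_scheme \<Rightarrow> bool" where
  "nilpotent_group G \<longleftrightarrow> (\<exists>n. lower_central G n = {\<one>\<^bsub>G\<^esub>})"

inductive subnormal :: "'a set \<Rightarrow> ('a, 'b) monoid_scheme \<Rightarrow> bool" where
  subnormal_top: "subnormal (carrier G) G"
| subnormal_step: "\<lbrakk>subnormal K G; subgroup H G; H \<subseteq> K;
                    H \<lhd> (G\<lparr>carrier := K\<rparr>)\<rbrakk> \<Longrightarrow> subnormal H G"

definition conj_set :: "('a, 'b) monoid_scheme \<Rightarrow> 'a set \<Rightarrow> 'a \<Rightarrow> 'a set" where
  "conj_set G H g = {inv\<^bsub>G\<^esub> g \<otimes>\<^bsub>G\<^esub> h \<otimes>\<^bsub>G\<^esub> g | h. h \<in> H}"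

definition TI_subgroup :: "'a set \<Rightarrow> ('a, 'b) monoid_scheme \<Rightarrow> bool" where
  "TI_subgroup H G \<longleftrightarrow>
     (\<forall>g \<in> carrier G. conj_set G H g \<inter> H = {\<one>\<^bsub>G\<^esub>} \<or> conj_set G H g \<inter> H = H)"

definition centralizer :: "('a, 'b) monoid_scheme \<Rightarrow> 'a set \<Rightarrow> 'a set" where
  "centralizer G H = {g \<in> carrier G. \<forall>h \<in> H. g \<otimes>\<^bsub>G\<^esub> h = h \<otimes>\<^bsub>G\<^esub> g}"

definition self_centralizing :: "'a set \<Rightarrow> ('a, 'b) monoid_scheme \<Rightarrow> bool" where
  "self_centralizing H G \<longleftrightarrow> centralizer G H \<subseteq> H"

end

theory Submission
  imports Defs
begin

text \<open>
  Let \<open>H\<close> be non-nilpotent of order divisible by \<open>p\<close>, not subnormal and not self-centralizing. Take \<open>A\<close>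
  maximal abelian in \<open>C\<^sub>G(H)\<close>. Then \<open>K = HA\<close> is self-centralizing and \<open>H\<close> is normal in \<open>K\<close>, so neither
  \<open>K\<close> nor \<open>N = N\<^sub>G(K)\<close> is subnormal; both are TI, and it follows that \<open>N\<close> is a proper subgroup meeting
  its other conjugates trivially, that is, a Frobenius complement.

  It suffices that \<open>N\<close> normalises some Sylow \<open>r\<close>-subgroup \<open>T \<noteq> 1\<close> with \<open>r\<close> dividing \<open>|G:N|\<close>: then \<open>N\<close> acts
  fixed-point-freely on \<open>Z(T)\<close> and contains no \<open>C\<^sub>q \<times> C\<^sub>q\<close>, which forces \<open>H\<close> to be normal in \<open>N\<close> and hence
  TI. Frobenius' theorem would provide \<open>T\<close>, but character theory can be avoided. If \<open>p\<close> divides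
  \<open>|N\<^sub>G(T)|\<close>, then \<open>N\<^sub>G(T)\<close> is non-nilpotent, self-centralizing and self-normalizing, so it is \<open>G\<close> or
  another Frobenius complement meeting a conjugate of \<open>N\<close>, and counting shows that it contains that
  conjugate. If \<open>p\<close> does not divide \<open>|N\<^sub>G(T)|\<close>, Frattini arguments and transfer produce a perfect
  subgroup \<open>D \<le> N\<close> of order divisible by \<open>p\<close>. All subgroups between \<open>K\<close> and \<open>N\<close> are normal in \<open>N\<close> and
  \<open>K/H\<close> is abelian, so \<open>D \<le> H\<close> and \<open>D\<close> centralises \<open>A\<close>; the hypothesis then makes every proper subgroup
  of \<open>D\<close> of order divisible by \<open>p\<close> nilpotent, which a second transfer refutes.
\<close>

section \<open>Conjugation and normalizers\<close>

text \<open>The hypothesis says nothing about \<open>H\<close> itself, so each use of it first needs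
  a self-centralizing overgroup of some non-nilpotent subgroup. The product of \<open>H\<close> with
  all of \<open>C_G(H)\<close> would be one, but the quotient by \<open>H\<close> could then be
  complicated; with \<open>A\<close> abelian, \<open>A\<close> is central in \<open>K\<close> and
  every subgroup between \<open>H\<close> and \<open>K\<close> is normal in \<open>K\<close>. That
  \<open>K\<close> and \<open>N\<close> are TI does not make \<open>H\<close> TI. Conjugation from
  outside \<open>N\<close> causes no trouble; the obstacle is an element of \<open>N\<close> that
  preserves \<open>HA\<close> but tilts \<open>H\<close> towards \<open>A\<close>, as a direct
  factor can be moved to a diagonal. With cyclic q-subgroups only, there is no room for such a tilt.
  What is asked of a Frobenius kernel is a single nontrivial r-group invariant under
  \<open>N\<close>, and one prime \<open>r\<close> is enough to control all primes \<open>q\<close>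
  dividing \<open>|N|\<close>. That \<open>A\<close> is nontrivial is what refutes \<open>D\<close>:
  for a non-nilpotent \<open>M < D\<close> of order divisible by \<open>p\<close>, the product of
  \<open>M\<close> and \<open>C_G(M)\<close> contains \<open>A\<close>, which \<open>D\<close>
  centralises, so being TI it is normalised by \<open>D\<close>.\<close>

locale fin_group = group G for G (structure) +
  assumes fin [simp]: "finite (carrier G)"

context group
begin

lemma l_cancel_inv [simp]:
  "x \<in> carrier G \<Longrightarrow> y \<in> carrier G \<Longrightarrow> inv x \<otimes> (x \<otimes> y) = y"
  "x \<in> carrier G \<Longrightarrow> y \<in> carrier G \<Longrightarrow> x \<otimes> (inv x \<otimes> y) = y"
  by (simp_all flip: m_assoc)

lemmas group_word_simps = m_assoc inv_mult_group

definition cnj :: "'a \<Rightarrow> 'a \<Rightarrow> 'a" where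
  "cnj x g = inv g \<otimes> x \<otimes> g"

text \<open>Defined by equality and for arbitrary subsets; in a finite group either inclusion
  suffices, see \<open>nrmI\<close> and \<open>nrmI'\<close>.\<close>

definition nrm :: "'a set \<Rightarrow> 'a set" where
  "nrm W = {g \<in> carrier G. conj_set G W g = W}"

lemma cnj_closed [simp]: "x \<in> carrier G \<Longrightarrow> g \<in> carrier G \<Longrightarrow> cnj x g \<in> carrier G"
  by (simp add: cnj_def)

lemma cnj_mult: "x \<in> carrier G \<Longrightarrow> y \<in> carrier G \<Longrightarrow> g \<in> carrier G
    \<Longrightarrow> cnj (x \<otimes> y) g = cnj x g \<otimes> cnj y g"
  by (simp add: cnj_def group_word_simps)

lemma cnj_inv: "x \<in> carrier G \<Longrightarrow> g \<in> carrier G \<Longrightarrow> cnj (inv x) g = inv (cnj x g)"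
  by (simp add: cnj_def group_word_simps)

lemma cnj_one [simp]: "g \<in> carrier G \<Longrightarrow> cnj \<one> g = \<one>"
  by (simp add: cnj_def)

lemma cnj_by_one [simp]: "x \<in> carrier G \<Longrightarrow> cnj x \<one> = x"
  by (simp add: cnj_def)

lemma cnj_cnj: "x \<in> carrier G \<Longrightarrow> g \<in> carrier G \<Longrightarrow> h \<in> carrier G
    \<Longrightarrow> cnj (cnj x g) h = cnj x (g \<otimes> h)"
  by (simp add: cnj_def group_word_simps)

lemma cnj_cancel [simp]: "x \<in> carrier G \<Longrightarrow> g \<in> carrier G \<Longrightarrow> cnj (cnj x g) (inv g) = x"
    "x \<in> carrier G \<Longrightarrow> g \<in> carrier G \<Longrightarrow> cnj (cnj x (inv g)) g = x"
  by (simp_all add: cnj_cnj)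

lemma cnj_eq_iff: "x \<in> carrier G \<Longrightarrow> g \<in> carrier G \<Longrightarrow> cnj x g = x \<longleftrightarrow> g \<otimes> x = x \<otimes> g"
proof -
  assume a: "x \<in> carrier G" "g \<in> carrier G"
  have "cnj x g = x \<longleftrightarrow> x = inv g \<otimes> (x \<otimes> g)"
    unfolding cnj_def using a by (auto simp: m_assoc)
  also have "\<dots> \<longleftrightarrow> x \<otimes> g = g \<otimes> x" using a by (intro inv_solve_left) auto
  finally show ?thesis by (simp add: eq_commute)
qed

lemma cnj_inj: "g \<in> carrier G \<Longrightarrow> inj_on (\<lambda>x. cnj x g) (carrier G)"
  by (rule inj_on_inverseI[of _ "\<lambda>y. cnj y (inv g)"]) simp

lemma cnj_pow: "x \<in> carrier G \<Longrightarrow> g \<in> carrier G \<Longrightarrow> cnj (x [^] (n::nat)) g = cnj x g [^] n"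
  by (induction n) (simp_all add: cnj_mult)

lemma cnj_eq_one_iff: "x \<in> carrier G \<Longrightarrow> g \<in> carrier G \<Longrightarrow> cnj x g = \<one> \<longleftrightarrow> x = \<one>"
  by (auto dest: arg_cong[where f = "\<lambda>y. cnj y (inv g)"])

lemma conj_set_image: "conj_set G H g = (\<lambda>x. cnj x g) ` H"
  by (auto simp: conj_set_def cnj_def)

lemma conj_set_subset [simp]: "H \<subseteq> carrier G \<Longrightarrow> g \<in> carrier G \<Longrightarrow> conj_set G H g \<subseteq> carrier G"
  by (auto simp: conj_set_image)

lemma conj_set_mono: "H \<subseteq> K \<Longrightarrow> conj_set G H g \<subseteq> conj_set G K g"
  by (auto simp: conj_set_image)

lemma conj_set_one [simp]: "H \<subseteq> carrier G \<Longrightarrow> conj_set G H \<one> = H"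
  by (force simp: conj_set_image image_def)

lemma conj_set_mult: "H \<subseteq> carrier G \<Longrightarrow> g \<in> carrier G \<Longrightarrow> h \<in> carrier G
    \<Longrightarrow> conj_set G (conj_set G H g) h = conj_set G H (g \<otimes> h)"
  unfolding conj_set_image image_image by (intro image_cong refl cnj_cnj) auto

lemma conj_set_cancel [simp]:
  "H \<subseteq> carrier G \<Longrightarrow> g \<in> carrier G \<Longrightarrow> conj_set G (conj_set G H g) (inv g) = H"
  "H \<subseteq> carrier G \<Longrightarrow> g \<in> carrier G \<Longrightarrow> conj_set G (conj_set G H (inv g)) g = H"
  by (simp_all add: conj_set_mult)

lemma card_conj_set [simp]: "H \<subseteq> carrier G \<Longrightarrow> g \<in> carrier G \<Longrightarrow> card (conj_set G H g) = card H"
  unfolding conj_set_image by (intro card_image inj_on_subset[OF cnj_inj])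

lemma cnj_mem_iff: "H \<subseteq> carrier G \<Longrightarrow> g \<in> carrier G \<Longrightarrow> x \<in> carrier G
    \<Longrightarrow> x \<in> conj_set G H g \<longleftrightarrow> cnj x (inv g) \<in> H"
  by (force simp: conj_set_image image_iff subset_iff intro: bexI[of _ "cnj x (inv g)"])

lemma conj_set_Int: "H \<subseteq> carrier G \<Longrightarrow> K \<subseteq> carrier G \<Longrightarrow> g \<in> carrier G
    \<Longrightarrow> conj_set G (H \<inter> K) g = conj_set G H g \<inter> conj_set G K g"
  unfolding conj_set_image by (rule inj_on_image_Int[OF cnj_inj])

lemma conj_set_subset_iff: "H \<subseteq> carrier G \<Longrightarrow> K \<subseteq> carrier G \<Longrightarrow> g \<in> carrier G
    \<Longrightarrow> conj_set G H g \<subseteq> K \<longleftrightarrow> H \<subseteq> conj_set G K (inv g)"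
  using conj_set_mono[of "conj_set G H g" K "inv g"] conj_set_mono[of H "conj_set G K (inv g)" g]
  by auto

lemma subgroup_conj_set [intro]:
  assumes "subgroup H G" "g \<in> carrier G" shows "subgroup (conj_set G H g) G"
proof -
  interpret H: subgroup H G by fact
  show ?thesis
  proof (intro subgroupI)
    show "conj_set G H g \<subseteq> carrier G" using assms(2) H.subset by simp
    show "conj_set G H g \<noteq> {}" unfolding conj_set_image using H.one_closed by blast
    show "inv a \<in> conj_set G H g" if "a \<in> conj_set G H g" for a
      using that assms(2) by (auto simp: conj_set_image cnj_inv[symmetric])
    show "a \<otimes> b \<in> conj_set G H g" if "a \<in> conj_set G H g" "b \<in> conj_set G H g" for a b
      using that assms(2) by (auto simp: conj_set_image cnj_mult[symmetric])
  qed
qed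

lemma conj_set_self: "subgroup H G \<Longrightarrow> h \<in> H \<Longrightarrow> conj_set G H h = H"
proof -
  assume H: "subgroup H G" and h: "h \<in> H"
  interpret H: subgroup H G by fact
  have 1: "conj_set G H h \<subseteq> H" if "h \<in> H" for h
    using that by (auto simp: conj_set_image cnj_def)
  have "H \<subseteq> conj_set G H h"
    using 1[of "inv h"] h conj_set_subset_iff[of H H "inv h"] H.subset by auto
  then show ?thesis using 1[OF h] by simp
qed

lemma conj_set_trivial_iff: "H \<subseteq> carrier G \<Longrightarrow> g \<in> carrier G \<Longrightarrow> conj_set G H g = {\<one>} \<longleftrightarrow> H = {\<one>}"
proof
  assume a: "H \<subseteq> carrier G" "g \<in> carrier G" "conj_set G H g = {\<one>}"
  have "H = conj_set G {\<one>} (inv g)" using a by (metis conj_set_cancel(1))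
  then show "H = {\<one>}" using a by (simp add: conj_set_image)
qed (simp add: conj_set_image)

lemma nrm_subset [simp]: "nrm W \<subseteq> carrier G"
  by (auto simp: nrm_def)

lemma nrm_conj: "g \<in> nrm W \<Longrightarrow> conj_set G W g = W"
  by (simp add: nrm_def)

lemma nrm_cnj: "g \<in> nrm W \<Longrightarrow> x \<in> W \<Longrightarrow> cnj x g \<in> W"
  using nrm_conj[of g W] by (auto simp: conj_set_image)

lemma subgroup_nrm [simp]: "W \<subseteq> carrier G \<Longrightarrow> subgroup (nrm W) G"
proof (intro subgroupI)
  assume W: "W \<subseteq> carrier G"
  show "inv a \<in> nrm W" if "a \<in> nrm W" for a
    using that W conj_set_cancel(1)[of W a] by (auto simp: nrm_def)
  show "a \<otimes> b \<in> nrm W" if "a \<in> nrm W" "b \<in> nrm W" for a b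
    using that W conj_set_mult[of W a b] by (auto simp: nrm_def)
  show "nrm W \<noteq> {}" if "W \<subseteq> carrier G" using that by (auto simp: nrm_def)
qed simp

lemma subgroup_le_nrm: "subgroup H G \<Longrightarrow> H \<subseteq> nrm H"
  by (auto simp: nrm_def conj_set_self subgroup.mem_carrier)

lemma nrm_Int: "W \<subseteq> carrier G \<Longrightarrow> Y \<subseteq> carrier G \<Longrightarrow> nrm W \<inter> nrm Y \<subseteq> nrm (W \<inter> Y)"
  by (auto simp: nrm_def conj_set_Int)

lemma nrm_conj_set: "W \<subseteq> carrier G \<Longrightarrow> g \<in> carrier G \<Longrightarrow> nrm (conj_set G W g) = conj_set G (nrm W) g"
proof -
  have *: "conj_set G (nrm W) g \<subseteq> nrm (conj_set G W g)" if "W \<subseteq> carrier G" "g \<in> carrier G" for W g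
  proof
    fix y assume "y \<in> conj_set G (nrm W) g"
    then obtain a where a: "a \<in> nrm W" "y = cnj a g" by (auto simp: conj_set_image)
    then have ac: "a \<in> carrier G" "conj_set G W a = W" by (auto simp: nrm_def)
    have "conj_set G (conj_set G W g) y = conj_set G W (a \<otimes> g)"
      using that ac a by (simp add: conj_set_mult cnj_def group_word_simps)
    also have "\<dots> = conj_set G W g" using that ac by (simp flip: conj_set_mult)
    finally show "y \<in> nrm (conj_set G W g)" using that ac a by (simp add: nrm_def)
  qed
  assume a: "W \<subseteq> carrier G" "g \<in> carrier G"
  have "conj_set G (nrm (conj_set G W g)) (inv g) \<subseteq> nrm W"
    using *[of "conj_set G W g" "inv g"] a by simp
  then have "nrm (conj_set G W g) \<subseteq> conj_set G (nrm W) g"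
    using conj_set_subset_iff[of "nrm (conj_set G W g)" "nrm W" "inv g"] a by simp
  with *[OF a] show ?thesis by blast
qed

lemma nrm_triv: "W = {\<one>} \<Longrightarrow> nrm W = carrier G"
  by (auto simp: nrm_def conj_set_image)

text \<open>Translates normality in a substructure, as it occurs in \<open>subnormal\<close>, into
  an inclusion of subsets of \<open>G\<close>, so that all arguments can stay inside one ambient
  group.\<close>

lemma normal_iff_nrm:
  assumes "subgroup H G" "subgroup K G" "H \<subseteq> K"
  shows "H \<lhd> (G\<lparr>carrier := K\<rparr>) \<longleftrightarrow> K \<subseteq> nrm H"
proof -
  interpret K: subgroup K G by fact
  interpret KG: group "G\<lparr>carrier := K\<rparr>" by (rule subgroup_imp_group[OF assms(2)])
  have sub: "subgroup H (G\<lparr>carrier := K\<rparr>)" using assms by (simp add: subgroup_incl)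
  have iv: "inv\<^bsub>G\<lparr>carrier := K\<rparr>\<^esub> x = inv x" if "x \<in> K" for x
    using that assms(2) by (simp add: m_inv_consistent)
  have "H \<lhd> (G\<lparr>carrier := K\<rparr>) \<longleftrightarrow> (\<forall>x\<in>K. \<forall>h\<in>H. x \<otimes> h \<otimes> inv x \<in> H)"
    using KG.normal_inv_iff[of H] sub iv by simp
  also have "\<dots> \<longleftrightarrow> (\<forall>x\<in>K. conj_set G H (inv x) \<subseteq> H)"
    by (auto simp: conj_set_image cnj_def image_subset_iff)
  also have "\<dots> \<longleftrightarrow> (\<forall>x\<in>K. conj_set G H x = H)"
  proof (intro iffI ballI)
    fix x assume a: "\<forall>x\<in>K. conj_set G H (inv x) \<subseteq> H" "x \<in> K"
    have hs: "H \<subseteq> carrier G" using assms subgroup.subset by blast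
    have "conj_set G H x \<subseteq> H" using a(1)[rule_format, of "inv x"] a(2) by simp
    moreover have "H \<subseteq> conj_set G H x"
      using a(1)[rule_format, of x] a(2) hs conj_set_subset_iff[of H H "inv x"] by auto
    ultimately show "conj_set G H x = H" by blast
  qed simp
  also have "\<dots> \<longleftrightarrow> K \<subseteq> nrm H" using K.subset by (auto simp: nrm_def)
  finally show ?thesis .
qed

section \<open>Products of subgroups and centralizers\<close>

lemma subgroup_set_mult:
  assumes "subgroup A G" "subgroup B G" "B \<subseteq> nrm A"
  shows "subgroup (A <#> B) G" "A \<subseteq> A <#> B" "B \<subseteq> A <#> B"
proof -
  interpret A: subgroup A G by fact
  interpret B: subgroup B G by fact
  have c: "b \<otimes> a \<otimes> inv b \<in> A" if "a \<in> A" "b \<in> B" for a b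
    using nrm_cnj[of "inv b" A a] that assms(3) by (auto simp: cnj_def)
  show "A \<subseteq> A <#> B" "B \<subseteq> A <#> B"
    using A.one_closed B.one_closed
    by (force simp: set_mult_def intro: r_one[symmetric] l_one[symmetric])+
  show "subgroup (A <#> B) G"
  proof (intro subgroupI)
    show "A <#> B \<subseteq> carrier G" by (auto simp: set_mult_def)
    show "A <#> B \<noteq> {}" using A.one_closed B.one_closed unfolding set_mult_def by blast
  next
    fix x assume "x \<in> A <#> B"
    then obtain a b where ab: "a \<in> A" "b \<in> B" "x = a \<otimes> b" by (auto simp: set_mult_def)
    have "inv x = (inv b \<otimes> inv a \<otimes> inv (inv b)) \<otimes> inv b"
      using ab by (simp add: group_word_simps)
    moreover have "inv b \<otimes> inv a \<otimes> inv (inv b) \<in> A" using ab by (intro c) auto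
    ultimately show "inv x \<in> A <#> B" using ab by (force simp: set_mult_def)
  next
    fix x y assume "x \<in> A <#> B" "y \<in> A <#> B"
    then obtain a b a' b' where ab: "a \<in> A" "b \<in> B" "x = a \<otimes> b" "a' \<in> A" "b' \<in> B" "y = a' \<otimes> b'"
      by (auto simp: set_mult_def)
    have "x \<otimes> y = (a \<otimes> (b \<otimes> a' \<otimes> inv b)) \<otimes> (b \<otimes> b')"
      using ab by (simp add: group_word_simps)
    moreover have "a \<otimes> (b \<otimes> a' \<otimes> inv b) \<in> A" using ab c by auto
    ultimately show "x \<otimes> y \<in> A <#> B" using ab B.m_closed by (force simp: set_mult_def)
  qed
qed

lemma set_mult_least:
  assumes "subgroup C G" "A \<subseteq> C" "B \<subseteq> C" shows "A <#> B \<subseteq> C"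
  using assms by (auto simp: set_mult_def intro: subgroup.m_closed)

lemma subgroup_centralizer [simp]: "W \<subseteq> carrier G \<Longrightarrow> subgroup (centralizer G W) G"
proof (intro subgroupI)
  assume W: "W \<subseteq> carrier G"
  show "inv a \<in> centralizer G W" if "a \<in> centralizer G W" for a
  proof -
    have "inv a \<otimes> h = h \<otimes> inv a" if "h \<in> W" for h
      using \<open>a \<in> _\<close> that W unfolding centralizer_def
      by (smt (verit, best) cnj_def cnj_eq_iff inv_closed inv_inv mem_Collect_eq subset_iff m_assoc r_inv r_one l_cancel_inv)
    then show ?thesis using that by (simp add: centralizer_def)
  qed
  show "centralizer G W \<noteq> {}" using W by (auto simp: centralizer_def subset_iff intro!: exI[of _ \<one>])
  show "a \<otimes> b \<in> centralizer G W" if "a \<in> centralizer G W" "b \<in> centralizer G W" for a b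
    using that W unfolding centralizer_def by (auto simp: subset_iff) (metis m_assoc)
qed (auto simp: centralizer_def)

lemma centralizer_subset [simp]: "centralizer G W \<subseteq> carrier G"
  by (auto simp: centralizer_def)

lemma centralizer_anti: "W \<subseteq> Y \<Longrightarrow> centralizer G Y \<subseteq> centralizer G W"
  by (auto simp: centralizer_def)

lemma centralizer_cnj: "W \<subseteq> carrier G \<Longrightarrow> c \<in> centralizer G W \<Longrightarrow> x \<in> W \<Longrightarrow> cnj x c = x"
  by (simp add: centralizer_def cnj_eq_iff subset_iff)

lemma centralizer_le_nrm: "W \<subseteq> carrier G \<Longrightarrow> centralizer G W \<subseteq> nrm W"
proof
  fix c assume a: "W \<subseteq> carrier G" "c \<in> centralizer G W"
  then have "(\<lambda>x. cnj x c) ` W = (\<lambda>x. x) ` W" by (intro image_cong) (simp_all add: centralizer_cnj)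
  then show "c \<in> nrm W" using a by (auto simp: nrm_def conj_set_image centralizer_def)
qed

lemma centralizer_sym: "W \<subseteq> carrier G \<Longrightarrow> Y \<subseteq> centralizer G W \<Longrightarrow> W \<subseteq> centralizer G Y"
  by (force simp: centralizer_def)

text \<open>A commutator of \<open>a \<in> A\<close> and \<open>b \<in> B\<close> lies in both subgroups.\<close>

lemma normal_disjoint_commute:
  assumes "subgroup A G" "subgroup B G" "A \<subseteq> nrm B" "B \<subseteq> nrm A" "A \<inter> B = {\<one>}"
  shows "B \<subseteq> centralizer G A"
proof
  fix b assume b: "b \<in> B"
  interpret A: subgroup A G by fact
  interpret B: subgroup B G by fact
  have "b \<otimes> a = a \<otimes> b" if a: "a \<in> A" for a
  proof -
    have "inv a \<otimes> cnj a b \<in> A" using a b assms(4) nrm_cnj[of b A a] by auto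
    moreover have "inv a \<otimes> cnj a b = cnj (inv b) a \<otimes> b" using a b by (simp add: cnj_def group_word_simps)
    moreover have "cnj (inv b) a \<otimes> b \<in> B" using a b assms(3) nrm_cnj[of a B "inv b"] by auto
    ultimately have "inv a \<otimes> cnj a b = \<one>" using assms(5) by auto
    then have "cnj a b = a" using a b
      by (metis A.mem_carrier B.mem_carrier cnj_closed inv_closed inv_equality inv_inv)
    then show ?thesis using a b by (simp add: cnj_eq_iff)
  qed
  then show "b \<in> centralizer G A" using b by (simp add: centralizer_def)
qed

lemma centralizer_nrm: "W \<subseteq> carrier G \<Longrightarrow> nrm W \<subseteq> nrm (centralizer G W)"
proof
  fix g assume W: "W \<subseteq> carrier G" and g: "g \<in> nrm W"
  have *: "conj_set G (centralizer G W) g \<subseteq> centralizer G W" if g: "g \<in> nrm W" for g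
  proof
    fix y assume "y \<in> conj_set G (centralizer G W) g"
    then obtain c where c: "c \<in> centralizer G W" "y = cnj c g" by (auto simp: conj_set_image)
    have gc: "g \<in> carrier G" "c \<in> carrier G" using g c nrm_subset centralizer_subset by blast+
    have "y \<otimes> x = x \<otimes> y" if x: "x \<in> W" for x
    proof -
      obtain x' where x': "x' \<in> W" "x = cnj x' g" using g x by (auto simp: nrm_def conj_set_image)
      then show ?thesis using c gc W by (auto simp: centralizer_def subset_iff simp flip: cnj_mult)
    qed
    then show "y \<in> centralizer G W" using c gc by (simp add: centralizer_def)
  qed
  have gc: "g \<in> carrier G" and ig: "inv g \<in> nrm W"
    using g W subgroup.m_inv_closed[OF subgroup_nrm] nrm_subset by blast+
  have "centralizer G W \<subseteq> conj_set G (centralizer G W) g"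
    using *[OF ig] conj_set_subset_iff[of "centralizer G W" "centralizer G W" "inv g"] gc by simp
  then show "g \<in> nrm (centralizer G W)" using *[OF g] gc by (auto simp: nrm_def)
qed

end

section \<open>Orders and indices in finite groups\<close>

context fin_group
begin

lemma finite_sub [simp]: "W \<subseteq> carrier G \<Longrightarrow> finite W"
  using fin finite_subset by blast

lemma finite_subgroup: "subgroup H G \<Longrightarrow> finite H"
  by (meson finite_sub subgroup.subset)

lemma nrmI: "W \<subseteq> carrier G \<Longrightarrow> g \<in> carrier G \<Longrightarrow> conj_set G W g \<subseteq> W \<Longrightarrow> g \<in> nrm W"
  by (simp add: nrm_def card_subset_eq)

lemma nrmI': "W \<subseteq> carrier G \<Longrightarrow> g \<in> carrier G \<Longrightarrow> W \<subseteq> conj_set G W g \<Longrightarrow> g \<in> nrm W"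
  using card_subset_eq[of "conj_set G W g" W] by (simp add: nrm_def)

lemma card_subgroup_pos [simp]: "subgroup H G \<Longrightarrow> card H > 0"
  using finite_subgroup subgroup.one_closed by (auto simp: card_gt_0_iff)

lemma card_rcosets_rel:
  assumes "subgroup H G" "subgroup K G" "H \<subseteq> K"
  shows "card ((\<lambda>x. H #> x) ` K) * card H = card K"
proof -
  interpret KG: group "G\<lparr>carrier := K\<rparr>" by (rule subgroup_imp_group[OF assms(2)])
  have sub: "subgroup H (G\<lparr>carrier := K\<rparr>)" using assms by (simp add: subgroup_incl)
  have "rcosets\<^bsub>G\<lparr>carrier := K\<rparr>\<^esub> H = (\<lambda>x. H #> x) ` K"
    by (auto simp: RCOSETS_def)
  then show ?thesis using KG.lagrange[OF sub] by (simp add: order_def)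
qed

lemma card_dvd: "subgroup H G \<Longrightarrow> subgroup K G \<Longrightarrow> H \<subseteq> K \<Longrightarrow> card H dvd card K"
  using card_rcosets_rel by (metis dvd_triv_right)

lemma card_rcosets_eq_div:
  assumes "subgroup H G" "subgroup K G" "H \<subseteq> K"
  shows "card ((\<lambda>x. H #> x) ` K) = card K div card H"
  using card_rcosets_rel[OF assms] card_subgroup_pos[OF assms(1)]
  by (metis nonzero_mult_div_cancel_right less_numeral_extra(3))

text \<open>Every fibre of the multiplication map from \<open>A\<close> x \<open>B\<close> is a copy
  of the intersection: the pairs over \<open>ab\<close> are the \<open>(ac, inv c b)\<close> with
  \<open>c\<close> in both subgroups.\<close>

lemma card_set_mult:
  assumes "subgroup A G" "subgroup B G"
  shows "card (A <#> B) * card (A \<inter> B) = card A * card B"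
proof -
  interpret A: subgroup A G by fact
  interpret B: subgroup B G by fact
  have fA: "finite A" "finite B" using assms finite_subgroup by auto
  let ?f = "\<lambda>(a,b). a \<otimes> b"
  have im: "?f ` (A \<times> B) = A <#> B" by (auto simp: set_mult_def)
  have fib: "card {z \<in> A \<times> B. ?f z = y} = card (A \<inter> B)" if "y \<in> A <#> B" for y
  proof -
    obtain a b where ab: "a \<in> A" "b \<in> B" "y = a \<otimes> b"
      using \<open>y \<in> A <#> B\<close> unfolding set_mult_def by blast
    have "bij_betw (\<lambda>c. (a \<otimes> c, inv c \<otimes> b)) (A \<inter> B) {z \<in> A \<times> B. ?f z = y}"
    proof (rule bij_betwI[where g = "\<lambda>(a',b'). inv a \<otimes> a'"])
      show "(\<lambda>c. (a \<otimes> c, inv c \<otimes> b)) \<in> A \<inter> B \<rightarrow> {z \<in> A \<times> B. ?f z = y}"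
        using ab by (auto simp: m_assoc)
      have "inv a \<otimes> a' \<in> B" if "a' \<in> A" "b' \<in> B" "a' \<otimes> b' = a \<otimes> b" for a' b'
      proof -
        have "inv a \<otimes> a' = b \<otimes> inv b'" using that ab
          by (metis A.mem_carrier B.mem_carrier inv_closed inv_solve_left inv_solve_right m_assoc m_closed)
        then show ?thesis using that ab by simp
      qed
      then show "(\<lambda>(a',b'). inv a \<otimes> a') \<in> {z \<in> A \<times> B. ?f z = y} \<rightarrow> A \<inter> B"
        using ab by auto
      show "(case (a \<otimes> c, inv c \<otimes> b) of (a', b') \<Rightarrow> inv a \<otimes> a') = c" if "c \<in> A \<inter> B" for c
        using that ab by simp
      show "(a \<otimes> (case z of (a', b') \<Rightarrow> inv a \<otimes> a'), inv (case z of (a', b') \<Rightarrow> inv a \<otimes> a') \<otimes> b) = z"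
        if z: "z \<in> {z \<in> A \<times> B. ?f z = y}" for z
      proof -
        obtain a' b' where z': "z = (a',b')" "a' \<in> A" "b' \<in> B" "a' \<otimes> b' = a \<otimes> b" using z ab by auto
        then have "inv (inv a \<otimes> a') \<otimes> b = inv a' \<otimes> (a' \<otimes> b')" using ab by (simp add: group_word_simps)
        also have "\<dots> = b'" using z' by (intro l_cancel_inv) auto
        finally show ?thesis using z' ab by simp
      qed
    qed
    then show ?thesis by (simp add: bij_betw_same_card)
  qed
  have "card (A \<times> B) = (\<Sum>y\<in>?f ` (A \<times> B). card {z \<in> A \<times> B. ?f z = y})"
    unfolding card_eq_sum using fA by (intro sum.image_gen) auto
  then show ?thesis using fib im by (simp add: card_cartesian_product)
qed

lemma subgroup_subset: "subgroup H G \<Longrightarrow> H \<subseteq> carrier G"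
  by (rule subgroup.subset)

lemma subgroup_mem: "subgroup H G \<Longrightarrow> x \<in> H \<Longrightarrow> x \<in> carrier G"
  using subgroup.subset by blast

lemma subgroup_nontrivial: "subgroup H G \<Longrightarrow> H \<noteq> {\<one>} \<longleftrightarrow> card H \<noteq> 1"
  using subgroup.one_closed by (auto simp: card_1_singleton_iff)

lemma subgroup_nat_pow_closed: "subgroup H G \<Longrightarrow> x \<in> H \<Longrightarrow> x [^] (n::nat) \<in> H"
  by (induction n) (auto intro: subgroup.m_closed subgroup.one_closed)

lemma index_mult:
  assumes "subgroup S G" "subgroup J G" "subgroup L G" "S \<subseteq> J" "J \<subseteq> L"
  shows "card L div card S = (card L div card J) * (card J div card S)"
proof -
  obtain a b where "card J = card S * a" "card L = card J * b"
    using card_dvd[OF assms(1,2,4)] card_dvd[OF assms(2,3,5)] unfolding dvd_def by blast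
  then show ?thesis using card_subgroup_pos[OF assms(1)] card_subgroup_pos[OF assms(2)] by simp
qed

lemma index_set_mult:
  assumes "subgroup B G" "subgroup M G" "subgroup J G" "J = B <#> M" "B \<subseteq> J"
  shows "card M = (card J div card B) * card (B \<inter> M)"
proof -
  obtain m where m: "card J = card B * m" using card_dvd[OF assms(1,3,5)] by (auto elim: dvdE)
  have "card B * (m * card (B \<inter> M)) = card B * card M"
    using card_set_mult[OF assms(1,2)] m assms(4) by (simp add: mult.assoc)
  then show ?thesis using m card_subgroup_pos[OF assms(1)] by simp
qed

section \<open>Sylow subgroups\<close>

text \<open>Orbit sizes divide \<open>r ^ k\<close>, so every orbit that is not a fixed point has
  size divisible by \<open>r\<close>. The right action is a bare function constrained only on
  \<open>E\<close> and \<open>Q\<close>, which lets cosets and conjugation be plugged in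
  directly.\<close>

lemma pgroup_fixed_points:
  assumes r: "Factorial_Ring.prime (r::nat)" and Q: "subgroup Q G" "card Q = r ^ k" and E: "finite E"
    and cl: "\<And>e g. e \<in> E \<Longrightarrow> g \<in> Q \<Longrightarrow> act e g \<in> E"
    and one: "\<And>e. e \<in> E \<Longrightarrow> act e \<one> = e"
    and mult: "\<And>e g h. e \<in> E \<Longrightarrow> g \<in> Q \<Longrightarrow> h \<in> Q \<Longrightarrow> act (act e g) h = act e (g \<otimes> h)"
  shows "card E mod r = card {e \<in> E. \<forall>g\<in>Q. act e g = e} mod r"
proof -
  interpret Q: subgroup Q G by fact
  define orb where "orb e = act e ` Q" for e
  define F where "F = {e \<in> E. \<forall>g\<in>Q. act e g = e}"
  have fQ: "finite Q" using Q(1) finite_subgroup by blast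
  have inv1: "act (act e g) (inv g) = e" "act (act e (inv g)) g = e" if "e \<in> E" "g \<in> Q" for e g
    using that by (auto simp: mult one)
  have orb_eq: "orb f = orb e" if eE: "e \<in> E" and f: "f \<in> orb e" for e f
  proof -
    obtain g where g: "g \<in> Q" "f = act e g" using f by (auto simp: orb_def)
    have "orb f \<subseteq> orb e" using g eE by (auto simp: orb_def mult)
    moreover have "orb e \<subseteq> orb f"
    proof
      fix y assume "y \<in> orb e"
      then obtain h where h: "h \<in> Q" "y = act e h" by (auto simp: orb_def)
      have "y = act f (inv g \<otimes> h)" using g h eE by (simp add: mult flip: m_assoc)
      then show "y \<in> orb f" using g h by (auto simp: orb_def)
    qed
    ultimately show ?thesis by blast
  qed
  have self: "e \<in> orb e" if "e \<in> E" for e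
    using image_eqI[of e "act e" \<one> Q] one[OF that] by (simp add: orb_def)
  have dv: "card (orb e) dvd r ^ k" if e: "e \<in> E" for e
  proof -
    have "card {g \<in> Q. act e g = y} = card {g \<in> Q. act e g = e}" if y: "y \<in> orb e" for y
    proof -
      obtain h where h: "h \<in> Q" "y = act e h" using y by (auto simp: orb_def)
      have "bij_betw (\<lambda>g. g \<otimes> h) {g \<in> Q. act e g = e} {g \<in> Q. act e g = y}"
      proof (rule bij_betwI[where g = "\<lambda>g. g \<otimes> inv h"])
        show "(\<lambda>g. g \<otimes> h) \<in> {g \<in> Q. act e g = e} \<rightarrow> {g \<in> Q. act e g = y}"
          using h e by (auto simp flip: mult)
        show "(\<lambda>g. g \<otimes> inv h) \<in> {g \<in> Q. act e g = y} \<rightarrow> {g \<in> Q. act e g = e}"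
          using h e inv1 by (auto simp flip: mult)
      qed (use h in \<open>auto simp: m_assoc\<close>)
      then show ?thesis by (simp add: bij_betw_same_card)
    qed
    moreover have "card Q = (\<Sum>y\<in>act e ` Q. card {g \<in> Q. act e g = y})"
      unfolding card_eq_sum using fQ by (intro sum.image_gen) auto
    ultimately show ?thesis using Q(2) by (simp add: orb_def)
  qed
  have "r dvd card (\<Union> (orb ` (E - F)))"
  proof (rule dvd_partition)
    have "\<Union> (orb ` (E - F)) \<subseteq> E" using cl by (auto simp: orb_def)
    then show "finite (\<Union> (orb ` (E - F)))" using E finite_subset by blast
    show "\<forall>c\<in>orb ` (E - F). r dvd card c"
    proof safe
      fix e assume e: "e \<in> E" "e \<notin> F"
      obtain j where j: "card (orb e) = r ^ j" using dv[OF e(1)] r divides_primepow_nat by blast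
      have "j \<noteq> 0"
      proof
        assume "j = 0"
        then obtain y where "orb e = {y}" using j by (auto simp: card_1_singleton_iff)
        then have "e \<in> F" using self[OF e(1)] e by (auto simp: orb_def F_def)
        then show False using e by simp
      qed
      then show "r dvd card (orb e)" using j by simp
    qed
    show "\<forall>c1\<in>orb ` (E - F). \<forall>c2\<in>orb ` (E - F). c1 \<noteq> c2 \<longrightarrow> c1 \<inter> c2 = {}"
      using orb_eq by blast
  qed
  moreover have "\<Union> (orb ` (E - F)) = E - F"
  proof
    show "E - F \<subseteq> \<Union> (orb ` (E - F))" using self by blast
    show "\<Union> (orb ` (E - F)) \<subseteq> E - F"
    proof safe
      fix e f assume a: "e \<in> E" "e \<notin> F" "f \<in> orb e"
      show "f \<in> E" using a cl by (auto simp: orb_def)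
      assume "f \<in> F"
      then have "orb f = {f}" using Q.one_closed self[of f] by (auto simp: orb_def F_def)
      then have "e = f" using orb_eq[OF a(1,3)] self[OF a(1)] by auto
      then show False using a \<open>f \<in> F\<close> by simp
    qed
  qed
  ultimately have d: "r dvd card (E - F)" by simp
  have "F \<subseteq> E" by (auto simp: F_def)
  then have "card E = card (E - F) + card F"
    using E by (metis card_Diff_subset card_mono finite_subset le_add_diff_inverse2)
  then show ?thesis using d unfolding F_def[symmetric] by (auto elim!: dvdE)
qed

text \<open>The coset \<open>Hx\<close> is fixed by right multiplication with \<open>Q\<close>
  exactly when conjugation by \<open>inv x\<close> takes \<open>Q\<close> into \<open>H\<close>. The
  consequences below differ only in whether the number of fixed cosets is nonzero or divisible by
  \<open>r\<close>.\<close>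

lemma coset_fixed_points:
  assumes r: "Factorial_Ring.prime (r::nat)" and Q: "subgroup Q G" "card Q = r ^ k"
    and H: "subgroup H G" and K: "subgroup K G" and sub: "H \<subseteq> K" "Q \<subseteq> K"
  defines "F \<equiv> {c \<in> (\<lambda>x. H #> x) ` K. \<forall>g\<in>Q. c #> g = c}"
  shows "(card K div card H) mod r = card F mod r"
    and "\<And>c. c \<in> F \<Longrightarrow> \<exists>x\<in>K. c = H #> x \<and> conj_set G Q (inv x) \<subseteq> H"
proof -
  interpret Q: subgroup Q G by fact
  interpret H: subgroup H G by fact
  interpret K: subgroup K G by fact
  have Hc: "H \<subseteq> carrier G" by (rule H.subset)
  have fK: "finite K" using K finite_subgroup by blast
  have ass: "H #> x #> y = H #> (x \<otimes> y)" if "x \<in> carrier G" "y \<in> carrier G" for x y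
    by (simp add: coset_mult_assoc[OF Hc that])
  have "card ((\<lambda>x. H #> x) ` K) mod r = card F mod r"
    unfolding F_def
  proof (rule pgroup_fixed_points[OF r Q])
    show "c #> g \<in> (\<lambda>x. H #> x) ` K" if "c \<in> (\<lambda>x. H #> x) ` K" "g \<in> Q" for c g
      using that sub by (auto simp: ass subset_iff)
    show "c #> \<one> = c" if "c \<in> (\<lambda>x. H #> x) ` K" for c using that by (auto simp: ass)
    show "c #> g #> h = c #> (g \<otimes> h)" if "c \<in> (\<lambda>x. H #> x) ` K" "g \<in> Q" "h \<in> Q" for c g h
      using that by (auto simp: ass m_assoc)
  qed (use fK in simp)
  then show "(card K div card H) mod r = card F mod r"
    using card_rcosets_eq_div[OF H K sub(1)] by simp
  fix c assume "c \<in> F"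
  then obtain x where x: "x \<in> K" "c = H #> x" "\<And>g. g \<in> Q \<Longrightarrow> H #> x #> g = H #> x"
    by (auto simp: F_def)
  have "cnj g (inv x) \<in> H" if "g \<in> Q" for g
  proof -
    have "x \<otimes> g \<in> H #> x" using x(3)[OF that] that x(1) rcos_self[OF _ H, of "x \<otimes> g"] by (auto simp: ass)
    then show ?thesis using that x(1) by (simp add: H.rcos_module cnj_def)
  qed
  then show "\<exists>x\<in>K. c = H #> x \<and> conj_set G Q (inv x) \<subseteq> H" using x by (auto simp: conj_set_image)
qed

text \<open>An index prime to \<open>r\<close> leaves at least one fixed coset. For \<open>H\<close>
  a Sylow subgroup this is Sylow's conjugacy theorem; it is applied to Frobenius complements as
  well.\<close>

lemma pgroup_conj_into:
  assumes r: "Factorial_Ring.prime (r::nat)" and Q: "subgroup Q G" "card Q = r ^ k"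
    and H: "subgroup H G" and K: "subgroup K G" and sub: "H \<subseteq> K" "Q \<subseteq> K"
    and nd: "\<not> r dvd card K div card H"
  shows "\<exists>x\<in>K. conj_set G Q x \<subseteq> H"
proof -
  define F where "F = {c \<in> (\<lambda>x. H #> x) ` K. \<forall>g\<in>Q. c #> g = c}"
  have "card F mod r \<noteq> 0"
    using coset_fixed_points(1)[OF r Q H K sub] nd by (simp add: dvd_eq_mod_eq_0 F_def)
  then obtain c where "c \<in> F" by fastforce
  then obtain x where "x \<in> K" "conj_set G Q (inv x) \<subseteq> H"
    using coset_fixed_points(2)[OF r Q H K sub] unfolding F_def by blast
  then show ?thesis using subgroup.m_inv_closed[OF K] by blast
qed

text \<open>The coset \<open>H\<close> itself is fixed by \<open>Q\<close>, and \<open>r\<close>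
  divides the number of fixed cosets, so there is a second one; its representative lies outside
  \<open>H\<close>.\<close>

lemma pgroup_conj_into_other:
  assumes r: "Factorial_Ring.prime (r::nat)" and Q: "subgroup Q G" "card Q = r ^ k"
    and H: "subgroup H G" and K: "subgroup K G" and sub: "H \<subseteq> K" "Q \<subseteq> H"
    and nd: "r dvd card K div card H"
  shows "\<exists>x\<in>K - H. conj_set G Q x \<subseteq> H"
proof -
  interpret H: subgroup H G by fact
  interpret K: subgroup K G by fact
  have QK: "Q \<subseteq> K" using sub by blast
  define F where "F = {c \<in> (\<lambda>x. H #> x) ` K. \<forall>g\<in>Q. c #> g = c}"
  have "r dvd card F" using coset_fixed_points(1)[OF r Q H K sub(1) QK] nd by (simp add: dvd_eq_mod_eq_0 F_def)
  moreover have "H \<in> F"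
  proof -
    have "H #> \<one> = H" by (simp add: coset_mult_one H.subset)
    moreover have "H #> g = H" if "g \<in> Q" for g
      using that sub H by (intro coset_join2) auto
    ultimately show ?thesis using image_eqI[of H "(#>) H" \<one> K] by (simp add: F_def)
  qed
  moreover have "F \<noteq> {H}" using \<open>r dvd card F\<close> r by auto
  ultimately obtain c where c: "c \<in> F" "c \<noteq> H" by blast
  then obtain x where x: "x \<in> K" "c = H #> x" "conj_set G Q (inv x) \<subseteq> H"
    using coset_fixed_points(2)[OF r Q H K sub(1) QK, folded F_def, OF c(1)] by auto
  have "x \<notin> H" using c x H coset_join2 by auto
  then have "inv x \<notin> H" using x(1) H.m_inv_closed[of "inv x"] by auto
  then show ?thesis using x by blast
qed

text \<open>Relative to a subgroup \<open>K\<close> of the ambient group. The exponent may be 0, so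
  a Sylow subgroup exists for every prime and is trivial when \<open>r\<close> does not divide
  \<open>|K|\<close>.\<close>

definition sylow_in :: "nat \<Rightarrow> 'a set \<Rightarrow> 'a set \<Rightarrow> bool" where
  "sylow_in r S K \<longleftrightarrow> subgroup S G \<and> S \<subseteq> K \<and> (\<exists>k. card S = r ^ k) \<and> \<not> r dvd card K div card S"

lemma subgroup_prime_power_exists:
  assumes "Factorial_Ring.prime (r::nat)" "subgroup K G" "r ^ k dvd card K"
  shows "\<exists>S. subgroup S G \<and> S \<subseteq> K \<and> card S = r ^ k"
proof -
  interpret KG: group "G\<lparr>carrier := K\<rparr>" by (rule subgroup_imp_group[OF assms(2)])
  obtain m where "card K = r ^ k * m" using assms(3) by blast
  then have "\<exists>S. subgroup S (G\<lparr>carrier := K\<rparr>) \<and> card S = r ^ k"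
    using assms finite_subgroup by (intro sylow_thm[of r _ k m]) (auto simp: order_def KG.is_group)
  then show ?thesis using incl_subgroup[OF assms(2)] subgroup.subset by fastforce
qed

lemma sylow_in_exists:
  assumes r: "Factorial_Ring.prime (r::nat)" and K: "subgroup K G"
  shows "\<exists>S. sylow_in r S K"
proof -
  obtain S where S: "subgroup S G" "S \<subseteq> K" "card S = r ^ multiplicity r (card K)"
    using subgroup_prime_power_exists[OF assms multiplicity_dvd] by blast
  have "card K \<noteq> 0" "\<not> is_unit r" using K card_subgroup_pos r not_prime_unit by (auto simp: less_not_refl2)
  then have "\<not> r dvd card K div r ^ multiplicity r (card K)"
    by (intro multiplicity_decompose) auto
  then show ?thesis using S by (auto simp: sylow_in_def)
qed

lemma sylow_card:
  assumes r: "Factorial_Ring.prime (r::nat)" and K: "subgroup K G" and S: "sylow_in r S K"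
  shows "card S = r ^ multiplicity r (card K)"
proof -
  obtain k where k: "card S = r ^ k" using S by (auto simp: sylow_in_def)
  have d: "card K = r ^ k * (card K div r ^ k)"
    using S K card_dvd[of S K] k by (auto simp: sylow_in_def)
  have "multiplicity r (card K) = k"
  proof (rule multiplicity_eqI)
    show "r ^ k dvd card K" using d by (metis dvd_triv_left)
    show "\<not> r ^ Suc k dvd card K"
    proof
      assume "r ^ Suc k dvd card K"
      then have "r ^ k * r dvd r ^ k * (card K div r ^ k)" using d by (simp add: mult.commute)
      then have "r dvd card K div r ^ k" using r by simp
      then show False using S k by (auto simp: sylow_in_def)
    qed
  qed
  then show ?thesis using k by simp
qed

lemma sylow_in_intermediate:
  assumes "sylow_in r S K" "subgroup K G" "subgroup L G" "S \<subseteq> L" "L \<subseteq> K"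
  shows "sylow_in r S L"
proof -
  have S: "subgroup S G" using assms by (auto simp: sylow_in_def)
  obtain a b where ab: "card L = card S * a" "card K = card L * b"
    using card_dvd[OF S assms(3,4)] card_dvd[OF assms(3,2,5)] unfolding dvd_def by blast
  then have "card K div card S = (card L div card S) * b"
    using card_subgroup_pos[OF S] by simp
  then show ?thesis using assms by (auto simp: sylow_in_def)
qed

lemma sylow_nontrivial: "sylow_in r S K \<Longrightarrow> r dvd card K \<Longrightarrow> card S \<noteq> 1"
  unfolding sylow_in_def by (metis div_by_1)

lemma sylow_conj_into:
  assumes "Factorial_Ring.prime (r::nat)" "subgroup K G" "sylow_in r S K"
    "subgroup Q G" "card Q = r ^ k" "Q \<subseteq> K"
  shows "\<exists>x\<in>K. conj_set G Q x \<subseteq> S"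
  using pgroup_conj_into[of r Q k S K] assms by (auto simp: sylow_in_def)

lemma normal_sylow_contains:
  assumes "Factorial_Ring.prime (r::nat)" "subgroup K G" "sylow_in r S K" "K \<subseteq> nrm S"
    "subgroup Q G" "card Q = r ^ k" "Q \<subseteq> K"
  shows "Q \<subseteq> S"
proof -
  obtain x where x: "x \<in> K" "conj_set G Q x \<subseteq> S" using sylow_conj_into[OF assms(1-3,5-7)] by blast
  have c: "x \<in> carrier G" "S \<subseteq> carrier G" "Q \<subseteq> carrier G"
    using assms x subgroup_mem subgroup_subset unfolding sylow_in_def by blast+
  have "inv x \<in> nrm S" using assms x subgroup.m_inv_closed[OF assms(2)] by blast
  then show ?thesis using x c conj_set_subset_iff[of Q S x] by (simp add: nrm_def)
qed

lemma p_group_le_normal: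
  assumes "Factorial_Ring.prime (q::nat)" "subgroup Q G" "card Q = q ^ k" "subgroup J G" "carrier G \<subseteq> nrm J"
    "\<not> q dvd card (carrier G) div card J"
  shows "Q \<subseteq> J"
proof -
  obtain x where x: "x \<in> carrier G" "conj_set G Q x \<subseteq> J"
    using pgroup_conj_into[OF assms(1-4) subgroup_self] subgroup_subset[OF assms(4)] subgroup_subset[OF assms(2)] assms(6) by blast
  have "inv x \<in> nrm J" using x assms(5) by blast
  then have "conj_set G J (inv x) = J" by (rule nrm_conj)
  then show ?thesis using x conj_set_subset_iff[OF subgroup_subset[OF assms(2)] subgroup_subset[OF assms(4)] x(1)] by simp
qed

lemma sylow_in_conj:
  assumes "sylow_in r S K" "subgroup K G" "g \<in> carrier G"
  shows "sylow_in r (conj_set G S g) (conj_set G K g)"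
  using assms subgroup.subset[of S G] subgroup.subset[of K G]
  by (auto simp: sylow_in_def conj_set_mono)

text \<open>The Frattini argument: the conjugate of \<open>S\<close> by \<open>g\<close> is again
  Sylow in \<open>J\<close>, so some element of \<open>J\<close> moves it back to
  \<open>S\<close>.\<close>

lemma sylow_frattini:
  assumes "Factorial_Ring.prime (r::nat)" "subgroup J G" "sylow_in r S J" "g \<in> nrm J"
  shows "\<exists>n\<in>nrm S. \<exists>j\<in>J. g = n \<otimes> j"
proof -
  interpret J: subgroup J G by fact
  have g: "g \<in> carrier G" "conj_set G J g = J" using assms by (auto simp: nrm_def)
  have S: "subgroup S G" "S \<subseteq> J" and Sc: "S \<subseteq> carrier G" using assms J.subset by (auto simp: sylow_in_def)
  obtain k where k: "card S = r ^ k" using assms by (auto simp: sylow_in_def)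
  have "conj_set G S g \<subseteq> J" using g conj_set_mono[OF S(2), of g] by simp
  then obtain x where x: "x \<in> J" "conj_set G (conj_set G S g) x \<subseteq> S"
    using sylow_conj_into[OF assms(1-3), of "conj_set G S g" k] S g k Sc by auto
  have "g \<otimes> x \<in> nrm S" using x g Sc by (intro nrmI) (auto simp: conj_set_mult)
  moreover have "g = (g \<otimes> x) \<otimes> inv x" using g x by (simp add: m_assoc)
  ultimately show ?thesis using x by blast
qed

text \<open>\<open>S\<close> is the only Sylow \<open>r\<close>-subgroup of its normalizer in
  \<open>K\<close>, so whatever preserves that normalizer preserves \<open>S\<close>.\<close>

lemma nrm_nrm_sylow:
  assumes "Factorial_Ring.prime (r::nat)" "subgroup K G" "sylow_in r S K"
    "g \<in> nrm (nrm S \<inter> K)" "g \<in> carrier G"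
  shows "g \<in> nrm S"
proof -
  have S: "subgroup S G" "S \<subseteq> K" and Sc: "S \<subseteq> carrier G" and Kc: "K \<subseteq> carrier G"
    using assms subgroup.subset by (auto simp: sylow_in_def)
  obtain k where k: "card S = r ^ k" using assms by (auto simp: sylow_in_def)
  have L: "subgroup (nrm S \<inter> K) G" using subgroups_Inter_pair[of "nrm S" K] Sc assms(2) by simp
  have SL: "S \<subseteq> nrm S \<inter> K" using S subgroup_le_nrm by blast
  have syl: "sylow_in r S (nrm S \<inter> K)"
    by (rule sylow_in_intermediate[OF assms(3,2) L SL]) simp
  have "conj_set G S g \<subseteq> nrm S \<inter> K"
    using conj_set_mono[OF SL, of g] assms(4) by (simp add: nrm_def)
  then have "conj_set G S g \<subseteq> S"
    using normal_sylow_contains[OF assms(1) L syl, of "conj_set G S g" k] S assms(5) k Sc by auto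
  then show ?thesis using nrmI Sc assms(5) by blast
qed

lemma pgroup_normalizer_grows:
  assumes "Factorial_Ring.prime (r::nat)" "subgroup S G" "card S = r ^ k" "subgroup H G" "H \<subset> S"
  shows "\<exists>x\<in>S - H. x \<in> nrm H"
proof -
  interpret S: subgroup S G by fact
  obtain m where m: "card S = card H * m" using card_dvd[OF assms(4,2)] assms(5) by (auto elim: dvdE)
  have fS: "finite S" using assms finite_subgroup by blast
  have "card H < card S" using assms(5) fS by (simp add: psubset_card_mono)
  then have "m \<noteq> 1" using m by auto
  moreover have "m dvd r ^ k" "card H dvd r ^ k" using m assms(3) by auto
  ultimately have "r dvd m" and "\<exists>j. card H = r ^ j"
    using assms(1) divides_primepow_nat by (metis dvd_refl dvd_power gr0I power_0, blast)
  moreover have "card S div card H = m" using m card_subgroup_pos[OF assms(4)] by simp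
  ultimately obtain x j where x: "x \<in> S - H" "conj_set G H x \<subseteq> H"
    using pgroup_conj_into_other[OF assms(1,4) _ assms(4,2)] assms(5) by blast
  then show ?thesis using nrmI[of H x] subgroup_subset[OF assms(4)] by auto
qed

lemma pgroup_center_nontrivial:
  assumes r: "Factorial_Ring.prime (r::nat)" and T: "subgroup T G" "card T = r ^ k" "T \<noteq> {\<one>}"
  shows "T \<inter> centralizer G T \<noteq> {\<one>}"
proof -
  interpret T: subgroup T G by fact
  have fT: "finite T" using T finite_subgroup by blast
  have "card T mod r = card {t \<in> T. \<forall>g\<in>T. cnj t g = t} mod r"
    by (rule pgroup_fixed_points[OF r T(1,2)]) (use fT in \<open>auto simp: cnj_def group_word_simps\<close>)
  moreover have "{t \<in> T. \<forall>g\<in>T. cnj t g = t} = T \<inter> centralizer G T"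
    by (auto simp: centralizer_def cnj_eq_iff)
  moreover have "k \<noteq> 0" using T subgroup_nontrivial[OF T(1)] by auto
  moreover have "card T mod r = 0" using T(2) \<open>k \<noteq> 0\<close> by simp
  ultimately have "r dvd card (T \<inter> centralizer G T)" by (simp add: dvd_eq_mod_eq_0)
  then show ?thesis using r by auto
qed

section \<open>Nilpotent subgroups\<close>

abbreviation nil :: "'a set \<Rightarrow> bool" where
  "nil H \<equiv> nilpotent_group (G\<lparr>carrier := H\<rparr>)"

abbreviation lc :: "'a set \<Rightarrow> nat \<Rightarrow> 'a set" where
  "lc H \<equiv> lower_central (G\<lparr>carrier := H\<rparr>)"

text \<open>Inverses and generated subgroups of the substructure are formally different from those
  of \<open>G\<close>; this brings the lower central series of \<open>H\<close> back to the
  operations of \<open>G\<close>.\<close>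

lemma lc_Suc:
  assumes H: "subgroup H G"
  shows "lc H n \<subseteq> H"
    and "lc H (Suc n) = generate G {x \<otimes> y \<otimes> inv x \<otimes> inv y | x y. x \<in> lc H n \<and> y \<in> H}"
proof -
  interpret H: subgroup H G by fact
  have *: "lc H (Suc n) = generate G {x \<otimes> y \<otimes> inv x \<otimes> inv y | x y. x \<in> lc H n \<and> y \<in> H}"
     (is "_ = generate G ?S") if "lc H n \<subseteq> H" for n
  proof -
    have "{x \<otimes>\<^bsub>G\<lparr>carrier := H\<rparr>\<^esub> y \<otimes>\<^bsub>G\<lparr>carrier := H\<rparr>\<^esub> inv\<^bsub>G\<lparr>carrier := H\<rparr>\<^esub> x \<otimes>\<^bsub>G\<lparr>carrier := H\<rparr>\<^esub> inv\<^bsub>G\<lparr>carrier := H\<rparr>\<^esub> y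
                 | x y. x \<in> lc H n \<and> y \<in> carrier (G\<lparr>carrier := H\<rparr>)} = ?S"
      using that H by (auto simp: m_inv_consistent subset_iff) (metis m_inv_consistent)+
    then have "lc H (Suc n) = generate (G\<lparr>carrier := H\<rparr>) ?S" by simp
    also have "\<dots> = generate G ?S" using that H by (intro generate_consistent) auto
    finally show ?thesis .
  qed
  show 1: "lc H n \<subseteq> H" for n
  proof (induction n)
    case (Suc n)
    show ?case unfolding *[OF Suc] using Suc H by (intro generate_subgroup_incl) auto
  qed simp
  show "lc H (Suc n) = generate G {x \<otimes> y \<otimes> inv x \<otimes> inv y | x y. x \<in> lc H n \<and> y \<in> H}"
    by (rule *[OF 1])
qed

lemma nil_mono:
  assumes "subgroup H G" "subgroup K G" "H \<subseteq> K" "nil K"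
  shows "nil H"
proof -
  have le: "lc H n \<subseteq> lc K n" for n
  proof (induction n)
    case (Suc n)
    then show ?case unfolding lc_Suc(2)[OF assms(1)] lc_Suc(2)[OF assms(2)]
      using assms(3) by (intro mono_generate) blast
  qed (use assms in simp)
  obtain n where "lc K n = {\<one>}" using assms(4) by (auto simp: nilpotent_group_def)
  moreover have "\<one> \<in> lc H n"
    by (cases n) (auto simp: subgroup.one_closed[OF assms(1)] lc_Suc(2)[OF assms(1)] generate.one simp del: lower_central.simps(2))
  ultimately have "lc H n = {\<one>}" using le[of n] by auto
  then show ?thesis by (auto simp: nilpotent_group_def)
qed

lemma nil_trivial: "nil {\<one>}"
  unfolding nilpotent_group_def by (rule exI[of _ 0]) simp

text \<open>Take a term of the lower central series that is not inside \<open>H\<close> while the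
  next one is. For \<open>y\<close> in it and \<open>h\<close> in \<open>H\<close>, the commutator
  of \<open>y\<close> and \<open>h\<close> lies in \<open>H\<close>, so \<open>y\<close> normalises
  \<open>H\<close>.\<close>

lemma nil_normalizer_grows:
  assumes K: "subgroup K G" "nil K" and H: "subgroup H G" "H \<subset> K"
  shows "\<exists>x\<in>K - H. x \<in> nrm H"
proof -
  interpret K: subgroup K G by fact
  interpret H: subgroup H G by fact
  obtain n where n: "lc K n = {\<one>}" using assms(2) by (auto simp: nilpotent_group_def)
  have "\<exists>i. \<not> lc K i \<subseteq> H \<and> lc K (Suc i) \<subseteq> H"
  proof (rule ccontr)
    assume "\<not> ?thesis"
    then have "\<not> lc K i \<subseteq> H" for i using H(2) by (induction i) auto
    then show False using n H.one_closed by force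
  qed
  then obtain i y where i: "lc K (Suc i) \<subseteq> H" and y: "y \<in> lc K i" "y \<notin> H" by blast
  have yK: "y \<in> K" using y lc_Suc(1)[OF K(1)] by blast
  have "cnj h (inv y) \<in> H" if h: "h \<in> H" for h
  proof -
    have "y \<otimes> h \<otimes> inv y \<otimes> inv h \<in> lc K (Suc i)"
      unfolding lc_Suc(2)[OF K(1)] using h H(2) y by (intro generate.incl) auto
    then have "(y \<otimes> h \<otimes> inv y \<otimes> inv h) \<otimes> h \<in> H" using i h by blast
    moreover have "(y \<otimes> h \<otimes> inv y \<otimes> inv h) \<otimes> h = cnj h (inv y)"
      using yK h by (simp add: cnj_def group_word_simps)
    ultimately show ?thesis by simp
  qed
  then have "conj_set G H (inv y) \<subseteq> H" unfolding conj_set_image by (rule image_subsetI)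
  then have "inv y \<in> nrm H" using yK H.subset by (intro nrmI) simp_all
  moreover have "inv y \<in> K - H" using yK y(2) H.m_inv_closed[of "inv y"] by auto
  ultimately show ?thesis by blast
qed

text \<open>The normalizer of \<open>S\<close> in \<open>K\<close> is its own normalizer in
  \<open>K\<close> by \<open>nrm_nrm_sylow\<close>; in a nilpotent group no proper subgroup
  is.\<close>

lemma nil_sylow_normal:
  assumes r: "Factorial_Ring.prime (r::nat)" and K: "subgroup K G" "nil K" and S: "sylow_in r S K"
  shows "K \<subseteq> nrm S"
proof (rule ccontr)
  assume n: "\<not> ?thesis"
  have Sc: "S \<subseteq> carrier G" using S by (auto simp: sylow_in_def subgroup.subset)
  have L: "subgroup (nrm S \<inter> K) G" using subgroups_Inter_pair[of "nrm S" K] Sc K(1) by simp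
  have "nrm S \<inter> K \<subset> K" using n by blast
  then obtain x where "x \<in> K - (nrm S \<inter> K)" "x \<in> nrm (nrm S \<inter> K)"
    using nil_normalizer_grows[OF K L] by blast
  then show False using nrm_nrm_sylow[OF r K(1) S, of x] subgroup.mem_carrier[OF K(1)] by blast
qed

section \<open>Perfect subgroups\<close>

lemma commutator_in_derived:
  "x \<in> H \<Longrightarrow> y \<in> H \<Longrightarrow> x \<otimes> y \<otimes> inv x \<otimes> inv y \<in> derived G H"
  unfolding derived_def by (intro generate.incl) auto

lemma derived_leI:
  assumes "subgroup B G" "\<And>x y. x \<in> H \<Longrightarrow> y \<in> H \<Longrightarrow> x \<otimes> y \<otimes> inv x \<otimes> inv y \<in> B"
  shows "derived G H \<subseteq> B"
  unfolding derived_def by (rule generate_subgroup_incl) (use assms in auto)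

lemma derived_nrm: "subgroup H G \<Longrightarrow> nrm H \<subseteq> nrm (derived G H)"
proof
  fix g assume H: "subgroup H G" and g: "g \<in> nrm H"
  interpret H: subgroup H G by fact
  have gc: "g \<in> carrier G" "inv g \<in> carrier G" using g nrm_subset by blast+
  have D: "subgroup (derived G H) G" by (simp add: derived_is_subgroup H.subset)
  have "derived G H \<subseteq> conj_set G (derived G H) (inv g)"
  proof (rule derived_leI)
    show "subgroup (conj_set G (derived G H) (inv g)) G" using D gc by blast
    fix x y assume xy: "x \<in> H" "y \<in> H"
    have "cnj (x \<otimes> y \<otimes> inv x \<otimes> inv y) g = cnj x g \<otimes> cnj y g \<otimes> inv (cnj x g) \<otimes> inv (cnj y g)"
      using xy gc by (simp add: cnj_mult cnj_inv)
    moreover have "\<dots> \<in> derived G H" using xy g nrm_cnj by (intro commutator_in_derived) auto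
    ultimately show "x \<otimes> y \<otimes> inv x \<otimes> inv y \<in> conj_set G (derived G H) (inv g)"
      using xy gc subgroup_subset[OF D] by (simp add: cnj_mem_iff)
  qed
  then have "conj_set G (derived G H) g \<subseteq> derived G H"
    using conj_set_subset_iff[of "derived G H" "derived G H" g] gc subgroup_subset[OF D] by simp
  then show "g \<in> nrm (derived G H)" using gc subgroup_subset[OF D] by (intro nrmI)
qed

definition perfect :: "'a set \<Rightarrow> bool" where
  "perfect D \<longleftrightarrow> subgroup D G \<and> derived G D = D"

lemma perfect_leI:
  assumes "perfect D" "subgroup B G" "\<And>x y. x \<in> D \<Longrightarrow> y \<in> D \<Longrightarrow> x \<otimes> y \<otimes> inv x \<otimes> inv y \<in> B"
  shows "D \<subseteq> B"
  using derived_leI[OF assms(2), of D] assms(1,3) by (auto simp: perfect_def)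

text \<open>All subgroups of \<open>Y/B\<close> are normal, so inner automorphisms act on every cyclic subgroup of
  \<open>Y/B\<close> by powers and hence commute with each other: commutators are central in \<open>Y/B\<close>.\<close>

lemma perfect_le_of_dedekind_quotient:
  assumes D: "perfect D" "D \<subseteq> Y" and Y: "subgroup Y G" and B: "subgroup B G" "B \<subseteq> Y"
    and nrm: "\<And>Z. subgroup Z G \<Longrightarrow> B \<subseteq> Z \<Longrightarrow> Z \<subseteq> Y \<Longrightarrow> Y \<subseteq> nrm Z"
  shows "D \<subseteq> B"
proof -
  interpret Y: subgroup Y G by fact
  interpret B: subgroup B G by fact
  have BY: "Y \<subseteq> nrm B" using nrm[OF B(1) _ B(2)] by simp
  have normal: "B \<lhd> (G\<lparr>carrier := Y\<rparr>)" using normal_iff_nrm[OF B(1) Y B(2)] BY by simp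
  interpret N: normal B "G\<lparr>carrier := Y\<rparr>" by fact
  define Q where "Q = G\<lparr>carrier := Y\<rparr> Mod B"
  interpret Q: group Q unfolding Q_def by (rule N.factorgroup_is_group)
  define q where "q y = B #> y" for y
  have q_hom: "q \<in> hom (G\<lparr>carrier := Y\<rparr>) Q"
    using N.r_coset_hom_Mod unfolding Q_def q_def[abs_def] by simp
  interpret q: group_hom "G\<lparr>carrier := Y\<rparr>" Q q
    by (intro group_hom.intro group_hom_axioms.intro q_hom Q.is_group subgroup_imp_group Y)
  have q_mult: "q (x \<otimes> y) = q x \<otimes>\<^bsub>Q\<^esub> q y" if "x \<in> Y" "y \<in> Y" for x y
    using q.hom_mult that by simp
  have q_cl [simp]: "q x \<in> carrier Q" if "x \<in> Y" for x using q.hom_closed that by simp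
  have q_inv: "q (inv x) = inv\<^bsub>Q\<^esub> q x" if "x \<in> Y" for x
    using q.hom_inv[of x] that Y by (simp add: m_inv_consistent)
  have q_one: "q x = \<one>\<^bsub>Q\<^esub> \<longleftrightarrow> x \<in> B" if "x \<in> Y" for x
  proof -
    have "B #> x = B \<longleftrightarrow> x \<in> B" using that B(1) coset_join1[of B x] coset_join2[of x B] B.subset by auto
    then show ?thesis by (simp add: q_def Q_def)
  qed
  have q_onto: "\<exists>y\<in>Y. u = q y" if "u \<in> carrier Q" for u
    using that by (auto simp: Q_def q_def FactGroup_def RCOSETS_def)
  have sub: "subgroup {x \<in> Y. q x \<in> U} G" if U: "subgroup U Q" for U
  proof (rule subgroupI)
    show "{x \<in> Y. q x \<in> U} \<noteq> {}"
      using q_one[of \<one>] subgroup.one_closed[OF U] by (auto intro!: exI[of _ \<one>])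
  qed (use subgroup.m_inv_closed[OF U] subgroup.m_closed[OF U] in \<open>auto simp: q_mult q_inv\<close>)
  have cyc: "\<exists>k::int. q (a \<otimes> y \<otimes> inv a) = q y [^]\<^bsub>Q\<^esub> k" if ay: "a \<in> Y" "y \<in> Y" for a y
  proof -
    let ?U = "generate Q {q y}"
    have U: "subgroup ?U Q" using ay by (intro Q.generate_is_subgroup) simp
    let ?Z = "{x \<in> Y. q x \<in> ?U}"
    have "B \<subseteq> ?Z" using B(2) q_one subgroup.one_closed[OF U] by force
    then have "Y \<subseteq> nrm ?Z" by (intro nrm sub U) auto
    then have "inv a \<in> nrm ?Z" using ay by blast
    moreover have "y \<in> ?Z" using ay by (simp add: generate.incl)
    ultimately have "cnj y (inv a) \<in> ?Z" by (rule nrm_cnj)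
    then have "q (a \<otimes> y \<otimes> inv a) \<in> ?U" using ay by (simp add: cnj_def)
    then show ?thesis using Q.generate_pow[of "q y"] ay by auto
  qed
  \<comment> \<open>\<open>E\<close> is the preimage of the centre of \<open>Y/B\<close>.
    Perfectness of \<open>D\<close> is used twice: commutators of elements of \<open>D\<close> lie
    in \<open>E\<close>, so \<open>D <= E\<close>; then they even lie in \<open>B\<close>.\<close>
  define E where "E = {x \<in> Y. \<forall>y\<in>Y. q x \<otimes>\<^bsub>Q\<^esub> q y = q y \<otimes>\<^bsub>Q\<^esub> q x}"
  have E: "subgroup E G"
  proof (rule subgroupI)
    have "\<one> \<in> E" using q_one[of \<one>] by (auto simp: E_def)
    then show "E \<noteq> {}" by blast
    show "inv x \<in> E" if x: "x \<in> E" for x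
    proof -
      have xY: "x \<in> Y" using x by (simp add: E_def)
      have "inv\<^bsub>Q\<^esub> q x \<otimes>\<^bsub>Q\<^esub> q y = q y \<otimes>\<^bsub>Q\<^esub> inv\<^bsub>Q\<^esub> q x" if y: "y \<in> Y" for y
      proof -
        have "inv\<^bsub>Q\<^esub> q x \<otimes>\<^bsub>Q\<^esub> q y = inv\<^bsub>Q\<^esub> q x \<otimes>\<^bsub>Q\<^esub> ((q y \<otimes>\<^bsub>Q\<^esub> q x) \<otimes>\<^bsub>Q\<^esub> inv\<^bsub>Q\<^esub> q x)"
          using xY y by (simp add: Q.m_assoc)
        also have "q y \<otimes>\<^bsub>Q\<^esub> q x = q x \<otimes>\<^bsub>Q\<^esub> q y" using x y by (simp add: E_def)
        finally show ?thesis using xY y by (simp add: Q.m_assoc)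
      qed
      then show ?thesis using xY by (simp add: E_def q_inv)
    qed
    show "x \<otimes> y \<in> E" if xy: "x \<in> E" "y \<in> E" for x y
    proof -
      have Y: "x \<in> Y" "y \<in> Y" using xy by (simp_all add: E_def)
      have "(q x \<otimes>\<^bsub>Q\<^esub> q y) \<otimes>\<^bsub>Q\<^esub> q z = q z \<otimes>\<^bsub>Q\<^esub> (q x \<otimes>\<^bsub>Q\<^esub> q y)" if z: "z \<in> Y" for z
      proof -
        have "(q x \<otimes>\<^bsub>Q\<^esub> q y) \<otimes>\<^bsub>Q\<^esub> q z = q x \<otimes>\<^bsub>Q\<^esub> (q y \<otimes>\<^bsub>Q\<^esub> q z)" using Y z by (simp add: Q.m_assoc)
        also have "q y \<otimes>\<^bsub>Q\<^esub> q z = q z \<otimes>\<^bsub>Q\<^esub> q y" using xy z by (simp add: E_def)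
        also have "q x \<otimes>\<^bsub>Q\<^esub> \<dots> = (q x \<otimes>\<^bsub>Q\<^esub> q z) \<otimes>\<^bsub>Q\<^esub> q y" using Y z by (simp add: Q.m_assoc)
        also have "q x \<otimes>\<^bsub>Q\<^esub> q z = q z \<otimes>\<^bsub>Q\<^esub> q x" using xy z by (simp add: E_def)
        finally show ?thesis using Y z by (simp add: Q.m_assoc)
      qed
      then show ?thesis using Y by (simp add: E_def q_mult)
    qed
  qed (auto simp: E_def)
  have conj_pow: "u \<otimes>\<^bsub>Q\<^esub> (v [^]\<^bsub>Q\<^esub> k) \<otimes>\<^bsub>Q\<^esub> inv\<^bsub>Q\<^esub> u = (u \<otimes>\<^bsub>Q\<^esub> v \<otimes>\<^bsub>Q\<^esub> inv\<^bsub>Q\<^esub> u) [^]\<^bsub>Q\<^esub> k"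
    if uv: "u \<in> carrier Q" "v \<in> carrier Q" for u v and k :: int
  proof -
    have "(\<lambda>v. u \<otimes>\<^bsub>Q\<^esub> v \<otimes>\<^bsub>Q\<^esub> inv\<^bsub>Q\<^esub> u) \<in> hom Q Q"
      using uv by (auto simp: hom_def Q.m_assoc)
    then interpret c: group_hom Q Q "\<lambda>v. u \<otimes>\<^bsub>Q\<^esub> v \<otimes>\<^bsub>Q\<^esub> inv\<^bsub>Q\<^esub> u"
      by (intro group_hom.intro group_hom_axioms.intro Q.is_group)
    show ?thesis using c.hom_int_pow[of v k] uv by simp
  qed
  have "D \<subseteq> E"
  proof (rule perfect_leI[OF D(1) E])
    fix a b assume "a \<in> D" "b \<in> D"
    then have ab: "a \<in> Y" "b \<in> Y" using D by auto
    have "q (a \<otimes> b \<otimes> inv a \<otimes> inv b) \<otimes>\<^bsub>Q\<^esub> q y = q y \<otimes>\<^bsub>Q\<^esub> q (a \<otimes> b \<otimes> inv a \<otimes> inv b)" if y: "y \<in> Y" for y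
    proof -
      have comp: "\<exists>i::int. u \<otimes>\<^bsub>Q\<^esub> q y \<otimes>\<^bsub>Q\<^esub> inv\<^bsub>Q\<^esub> u = q y [^]\<^bsub>Q\<^esub> i" if "\<exists>a\<in>Y. u = q a" for u
        using that cyc[OF _ y] y by (auto simp: q_mult q_inv)
      define u where "u = inv\<^bsub>Q\<^esub> q a"
      define w where "w = inv\<^bsub>Q\<^esub> q b"
      have uw: "u \<in> carrier Q" "w \<in> carrier Q" using ab by (auto simp: u_def w_def)
      obtain i :: int where i: "u \<otimes>\<^bsub>Q\<^esub> q y \<otimes>\<^bsub>Q\<^esub> inv\<^bsub>Q\<^esub> u = q y [^]\<^bsub>Q\<^esub> i"
        using comp[OF q_onto[OF uw(1)]] by (rule exE)
      obtain j :: int where j: "w \<otimes>\<^bsub>Q\<^esub> q y \<otimes>\<^bsub>Q\<^esub> inv\<^bsub>Q\<^esub> w = q y [^]\<^bsub>Q\<^esub> j"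
        using comp[OF q_onto[OF uw(2)]] by (rule exE)
      note ij = i j
      have "u \<otimes>\<^bsub>Q\<^esub> (w \<otimes>\<^bsub>Q\<^esub> q y \<otimes>\<^bsub>Q\<^esub> inv\<^bsub>Q\<^esub> w) \<otimes>\<^bsub>Q\<^esub> inv\<^bsub>Q\<^esub> u = w \<otimes>\<^bsub>Q\<^esub> (u \<otimes>\<^bsub>Q\<^esub> q y \<otimes>\<^bsub>Q\<^esub> inv\<^bsub>Q\<^esub> u) \<otimes>\<^bsub>Q\<^esub> inv\<^bsub>Q\<^esub> w"
        using y uw unfolding ij by (simp add: conj_pow ij Q.int_pow_pow mult.commute)
      then have e: "(u \<otimes>\<^bsub>Q\<^esub> w) \<otimes>\<^bsub>Q\<^esub> q y \<otimes>\<^bsub>Q\<^esub> inv\<^bsub>Q\<^esub> (u \<otimes>\<^bsub>Q\<^esub> w) = (w \<otimes>\<^bsub>Q\<^esub> u) \<otimes>\<^bsub>Q\<^esub> q y \<otimes>\<^bsub>Q\<^esub> inv\<^bsub>Q\<^esub> (w \<otimes>\<^bsub>Q\<^esub> u)"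
        using y uw by (simp add: Q.group_word_simps)
      define z where "z = inv\<^bsub>Q\<^esub> (w \<otimes>\<^bsub>Q\<^esub> u) \<otimes>\<^bsub>Q\<^esub> (u \<otimes>\<^bsub>Q\<^esub> w)"
      have zc: "z \<in> carrier Q" using uw by (simp add: z_def)
      have "z \<otimes>\<^bsub>Q\<^esub> q y \<otimes>\<^bsub>Q\<^esub> inv\<^bsub>Q\<^esub> z = inv\<^bsub>Q\<^esub> (w \<otimes>\<^bsub>Q\<^esub> u) \<otimes>\<^bsub>Q\<^esub> ((u \<otimes>\<^bsub>Q\<^esub> w) \<otimes>\<^bsub>Q\<^esub> q y \<otimes>\<^bsub>Q\<^esub> inv\<^bsub>Q\<^esub> (u \<otimes>\<^bsub>Q\<^esub> w)) \<otimes>\<^bsub>Q\<^esub> (w \<otimes>\<^bsub>Q\<^esub> u)"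
        using y uw by (simp add: z_def Q.group_word_simps)
      also have "\<dots> = q y" unfolding e using y uw by (simp add: Q.group_word_simps)
      finally have zy: "z \<otimes>\<^bsub>Q\<^esub> q y \<otimes>\<^bsub>Q\<^esub> inv\<^bsub>Q\<^esub> z = q y" .
      have "z \<otimes>\<^bsub>Q\<^esub> q y = (z \<otimes>\<^bsub>Q\<^esub> q y \<otimes>\<^bsub>Q\<^esub> inv\<^bsub>Q\<^esub> z) \<otimes>\<^bsub>Q\<^esub> z" using y zc by (simp add: Q.m_assoc)
      then have "z \<otimes>\<^bsub>Q\<^esub> q y = q y \<otimes>\<^bsub>Q\<^esub> z" unfolding zy .
      moreover have "q (a \<otimes> b \<otimes> inv a \<otimes> inv b) = z"
        using ab by (simp add: z_def u_def w_def q_mult q_inv Q.group_word_simps)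
      ultimately show ?thesis by simp
    qed
    then show "a \<otimes> b \<otimes> inv a \<otimes> inv b \<in> E" using ab by (auto simp: E_def)
  qed
  show "D \<subseteq> B"
  proof (rule perfect_leI[OF D(1) B(1)])
    fix a b assume ab': "a \<in> D" "b \<in> D"
    then have ab: "a \<in> Y" "b \<in> Y" "a \<in> E" using D \<open>D \<subseteq> E\<close> by auto
    then have "q a \<otimes>\<^bsub>Q\<^esub> q b = q b \<otimes>\<^bsub>Q\<^esub> q a" by (simp add: E_def)
    then have "q (a \<otimes> b \<otimes> inv a \<otimes> inv b) = \<one>\<^bsub>Q\<^esub>"
      using ab by (simp add: q_mult q_inv) (simp add: Q.m_assoc)
    then show "a \<otimes> b \<otimes> inv a \<otimes> inv b \<in> B" using ab q_one by simp
  qed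
qed

lemma exists_maximal_subgroup:
  assumes "subgroup B G" "B \<subset> D" "subgroup D G"
  shows "\<exists>M. subgroup M G \<and> B \<subseteq> M \<and> M \<subset> D \<and>
    (\<forall>Z. subgroup Z G \<longrightarrow> M \<subseteq> Z \<longrightarrow> Z \<subseteq> D \<longrightarrow> Z = M \<or> Z = D)"
proof -
  let ?P = "\<lambda>M. subgroup M G \<and> B \<subseteq> M \<and> M \<subset> D"
  have fD: "finite D" using assms finite_subgroup by blast
  then have bd: "\<forall>M. ?P M \<longrightarrow> card M < card D" by (auto intro: psubset_card_mono)
  have "\<exists>M. ?P M \<and> (\<forall>Z. ?P Z \<longrightarrow> card Z \<le> card M)"
    by (rule ex_has_greatest_nat[OF _ bd, of B]) (use assms in blast)
  then obtain M where M: "?P M" "\<And>Z. ?P Z \<Longrightarrow> card Z \<le> card M" by metis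
  have "Z = M \<or> Z = D" if "subgroup Z G" "M \<subseteq> Z" "Z \<subseteq> D" for Z
  proof (rule ccontr)
    assume n: "\<not> (Z = M \<or> Z = D)"
    then have "card Z \<le> card M" using M that by (intro M(2)) auto
    then have "M = Z" using that fD finite_subset[of Z D] by (intro card_seteq) auto
    then show False using n by simp
  qed
  then show ?thesis using M(1) by blast
qed

text \<open>If \<open>M\<close> were normal, the only subgroups above it in \<open>D\<close>,
  \<open>M\<close> and \<open>D\<close>, would both be normal, so \<open>D/M\<close> would be a
  Dedekind quotient.\<close>

lemma perfect_maximal_not_normal:
  assumes "perfect D" "subgroup M G" "M \<subset> D"
    and "\<And>Z. subgroup Z G \<Longrightarrow> M \<subseteq> Z \<Longrightarrow> Z \<subseteq> D \<Longrightarrow> Z = M \<or> Z = D"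
  shows "\<not> D \<subseteq> nrm M"
proof
  assume n: "D \<subseteq> nrm M"
  have D: "subgroup D G" using assms(1) by (simp add: perfect_def)
  have "D \<subseteq> M"
  proof (rule perfect_le_of_dedekind_quotient[OF assms(1) _ D assms(2)])
    show "D \<subseteq> nrm Z" if "subgroup Z G" "M \<subseteq> Z" "Z \<subseteq> D" for Z
      using assms(4)[OF that] n subgroup_le_nrm[OF D] by auto
  qed (use assms in auto)
  then show False using assms(3) by blast
qed

text \<open>A perfect group has no nontrivial quotient of prime power order: a maximal subgroup above the
  kernel would be normal.\<close>

lemma perfect_no_pgroup_quotient:
  assumes r: "Factorial_Ring.prime (r::nat)" and D: "perfect D" and B: "subgroup B G" "B \<subseteq> D" "D \<subseteq> nrm B"
    and ind: "card D = card B * r ^ k"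
  shows "B = D"
proof (rule ccontr)
  assume "B \<noteq> D"
  then have BD: "B \<subset> D" using B by blast
  have Dg: "subgroup D G" using D by (simp add: perfect_def)
  obtain M where M: "subgroup M G" "B \<subseteq> M" "M \<subset> D"
    "\<And>Z. subgroup Z G \<Longrightarrow> M \<subseteq> Z \<Longrightarrow> Z \<subseteq> D \<Longrightarrow> Z = M \<or> Z = D"
    using exists_maximal_subgroup[OF B(1) BD Dg] by blast
  obtain S where S: "sylow_in r S M" using sylow_in_exists[OF r M(1)] by blast
  then have Sg: "subgroup S G" "S \<subseteq> M" by (auto simp: sylow_in_def)
  obtain j where j: "card S = r ^ j" using S by (auto simp: sylow_in_def)
  obtain m where m: "card D = card M * m" using card_dvd[OF M(1) Dg] M(3) by (auto elim: dvdE)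
  obtain b where b: "card M = card B * b" using card_dvd[OF B(1) M(1,2)] by (auto elim: dvdE)
  have pos: "card B > 0" "card M > 0" using B M by auto
  have bm: "r ^ k = b * m" using ind m b pos by simp
  have "card M < card D" using M(3) finite_subgroup[OF Dg] by (simp add: psubset_card_mono)
  then have "m \<noteq> 1" using m by auto
  then have "r dvd m" using bm r divides_primepow_nat[OF r, of m k] by (metis dvd_power dvd_triv_right gr0I power_0)
  moreover have "card D div card M = m" using m pos by simp
  \<comment> \<open>This \<open>x\<close> will normalise \<open>M\<close>, contradicting maximality:
    it conjugates \<open>S\<close> into \<open>M\<close>, it normalises \<open>B\<close>, and
    \<open>M = B <#> S\<close>.\<close>
  ultimately obtain x where x: "x \<in> D - M" "conj_set G S x \<subseteq> M"
    using pgroup_conj_into_other[OF r Sg(1) j M(1) Dg _ Sg(2)] M(3) by blast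
  have SB: "S \<subseteq> nrm B" using Sg M(3) B by blast
  have BS: "subgroup (B <#> S) G" "B \<subseteq> B <#> S" "S \<subseteq> B <#> S" by (rule subgroup_set_mult[OF B(1) Sg(1) SB])+
  have BSM: "B <#> S \<subseteq> M" by (rule set_mult_least[OF M(1,2) Sg(2)])
  \<comment> \<open>The index \<open>|M:BS|\<close> divides \<open>|D:B|\<close>, a power of
    \<open>r\<close>, and also \<open>|M:S|\<close>, which is prime to \<open>r\<close>.\<close>
  have "card M dvd card (B <#> S)"
  proof -
    obtain c where c: "card (B <#> S) = card B * c" using card_dvd[OF B(1) BS(1,2)] by (auto elim: dvdE)
    obtain d where d: "card M = card (B <#> S) * d" using card_dvd[OF BS(1) M(1) BSM] by (auto elim: dvdE)
    have "b = c * d" using b c d pos by simp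
    then have "d dvd r ^ k" using bm by simp
    obtain e where e: "card (B <#> S) = card S * e" using card_dvd[OF Sg(1) BS(1,3)] by (auto elim: dvdE)
    then have "card M div card S = e * d" using d card_subgroup_pos[OF Sg(1)] by simp
    then have "\<not> r dvd d" using S by (auto simp: sylow_in_def)
    then have "d = 1" using \<open>d dvd r ^ k\<close> divides_primepow_nat[OF r, of d k] by (metis dvd_power gr0I power_0)
    then show ?thesis using d by simp
  qed
  then have "M = B <#> S" using BSM card_subgroup_pos[OF BS(1)] finite_subgroup[OF M(1)]
    by (intro card_seteq[symmetric]) (auto dest: dvd_imp_le)
  moreover have "conj_set G (B <#> S) x \<subseteq> M"
  proof
    fix y assume "y \<in> conj_set G (B <#> S) x"
    then obtain b s where bs: "b \<in> B" "s \<in> S" "y = cnj (b \<otimes> s) x" by (auto simp: conj_set_image set_mult_def)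
    have "x \<in> carrier G" "b \<in> carrier G" "s \<in> carrier G" using x bs Dg B Sg subgroup_mem by blast+
    then have "y = cnj b x \<otimes> cnj s x" using bs by (simp add: cnj_mult)
    moreover have "cnj b x \<in> M" using x bs B M(2) nrm_cnj[of x B b] by blast
    moreover have "cnj s x \<in> M" using x bs by (auto simp: conj_set_image)
    ultimately show "y \<in> M" using subgroup.m_closed[OF M(1)] by simp
  qed
  ultimately have "x \<in> nrm M" using x subgroup_subset[OF M(1)] subgroup_mem[OF Dg] by (intro nrmI) auto
  moreover have "M \<subseteq> nrm M" by (rule subgroup_le_nrm[OF M(1)])
  ultimately have "nrm M \<inter> D = D"
    using M(4)[of "nrm M \<inter> D"] subgroups_Inter_pair[of "nrm M" D] Dg subgroup_subset[OF M(1)] M(3) x by auto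
  then have "D \<subseteq> nrm M" by blast
  then show False using perfect_maximal_not_normal[OF D M(1,3,4)] by blast
qed

end

section \<open>Transfer\<close>

text \<open>The product splits over the cycles of \<open>\<sigma>\<close>, which are removed one at
  a time. The hypothesis is asked for every return time \<open>k\<close> of \<open>x\<close>, so
  that a user need not know the cycle lengths.\<close>

lemma (in comm_monoid) finprod_permutation_cycles:
  assumes "finite E" "\<sigma> \<in> E \<rightarrow> E" "inj_on \<sigma> E" "f \<in> E \<rightarrow> carrier G" "a \<in> carrier G"
    and cyc: "\<And>x k. x \<in> E \<Longrightarrow> k > 0 \<Longrightarrow> (\<sigma> ^^ k) x = x \<Longrightarrow> (\<Otimes>i\<in>{..<k}. f ((\<sigma> ^^ i) x)) = a [^] k"
  shows "finprod G f E = a [^] card E"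
  using assms
proof (induction E rule: finite_psubset_induct)
  case (psubset E)
  show ?case
  proof (cases "E = {}")
    case False
    then obtain x where x: "x \<in> E" by blast
    have it: "(\<sigma> ^^ i) y \<in> E" if "y \<in> E" for i y
      using that psubset.prems(1) by (induction i) auto
    have inj: "inj_on (\<sigma> ^^ i) E" for i
    proof (induction i)
      case (Suc i)
      have "inj_on (\<sigma> \<circ> (\<sigma> ^^ i)) E"
        by (rule comp_inj_on[OF Suc inj_on_subset[OF psubset.prems(2)]]) (use it in auto)
      then show ?case by (simp add: comp_def)
    qed simp
    have diff: "(\<sigma> ^^ (j - i)) x = x" if ij: "i < j" "(\<sigma> ^^ i) x = (\<sigma> ^^ j) x" for i j
    proof -
      have "(\<sigma> ^^ i) ((\<sigma> ^^ (j - i)) x) = (\<sigma> ^^ j) x"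
        using ij(1) by (metis comp_apply funpow_add le_add_diff_inverse less_imp_le)
      then show ?thesis using inj_onD[OF inj, of i "(\<sigma> ^^ (j - i)) x" x] it x ij(2) by simp
    qed
    have "\<not> inj_on (\<lambda>i. (\<sigma> ^^ i) x) {..card E}"
    proof
      assume "inj_on (\<lambda>i. (\<sigma> ^^ i) x) {..card E}"
      then have "card {..card E} \<le> card E"
        using psubset.hyps it x by (intro card_inj_on_le) auto
      then show False by simp
    qed
    then obtain i j where "i < j" "(\<sigma> ^^ i) x = (\<sigma> ^^ j) x"
      unfolding inj_on_def by (metis linorder_neqE_nat)
    then have ex: "\<exists>k. k > 0 \<and> (\<sigma> ^^ k) x = x" using diff by (intro exI[of _ "j - i"]) auto
    define k where "k = (LEAST k. k > 0 \<and> (\<sigma> ^^ k) x = x)"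
    have k: "k > 0" "(\<sigma> ^^ k) x = x" and least: "\<And>l. l > 0 \<Longrightarrow> (\<sigma> ^^ l) x = x \<Longrightarrow> k \<le> l"
      using LeastI_ex[OF ex] unfolding k_def by (auto intro: Least_le)
    define Q where "Q = (\<lambda>i. (\<sigma> ^^ i) x) ` {..<k}"
    have injk: "inj_on (\<lambda>i. (\<sigma> ^^ i) x) {..<k}"
    proof (rule linorder_inj_onI)
      fix i j assume ij: "i < j" "i \<in> {..<k}" "j \<in> {..<k}"
      show "(\<sigma> ^^ i) x \<noteq> (\<sigma> ^^ j) x"
      proof
        assume "(\<sigma> ^^ i) x = (\<sigma> ^^ j) x"
        then have "k \<le> j - i" using ij diff by (intro least) auto
        then show False using ij by auto
      qed
    qed auto
    have QE: "Q \<subseteq> E" using it x by (auto simp: Q_def)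
    have xQ: "x \<in> Q" using k unfolding Q_def by (intro image_eqI[of _ _ 0]) auto
    \<comment> \<open>A point mapped into the cycle belongs to it; hence \<open>\<sigma>\<close>
      restricts to the complement and induction applies.\<close>
    have pre: "y \<in> Q" if y: "y \<in> E" "\<sigma> y \<in> Q" for y
    proof -
      obtain i where i: "i < k" "\<sigma> y = (\<sigma> ^^ i) x" using y by (auto simp: Q_def)
      show ?thesis
      proof (cases i)
        case 0
        have "\<sigma> y = \<sigma> ((\<sigma> ^^ (k - 1)) x)" using 0 i k by (cases k) auto
        then have "y = (\<sigma> ^^ (k - 1)) x" using inj_onD[OF psubset.prems(2)] y it x by blast
        then show ?thesis using k by (auto simp: Q_def)
      next
        case (Suc l)
        then have "y = (\<sigma> ^^ l) x" using inj_onD[OF psubset.prems(2), of y "(\<sigma> ^^ l) x"] y it x i by simp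
        then show ?thesis using Suc i by (auto simp: Q_def)
      qed
    qed
    have "finprod G f Q = (\<Otimes>i\<in>{..<k}. f ((\<sigma> ^^ i) x))"
      unfolding Q_def using psubset.prems(3) it x by (intro finprod_reindex[OF _ injk]) auto
    also have "\<dots> = a [^] k" by (rule psubset.prems(5)[OF x k])
    finally have fQ: "finprod G f Q = a [^] k" .
    have fE: "finprod G f (E - Q) = a [^] card (E - Q)"
    proof (rule psubset.IH)
      show "E - Q \<subset> E" using x xQ by blast
      show "\<sigma> \<in> E - Q \<rightarrow> E - Q" using psubset.prems(1) pre by blast
      show "inj_on \<sigma> (E - Q)" using psubset.prems(2) by (rule inj_on_subset) blast
      show "f \<in> E - Q \<rightarrow> carrier G" using psubset.prems(3) by blast
    qed (use psubset.prems in auto)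
    have "finprod G f (Q \<union> (E - Q)) = finprod G f Q \<otimes> finprod G f (E - Q)"
      using psubset.hyps psubset.prems(3) QE by (intro finprod_Un_disjoint) (auto intro: finite_subset)
    moreover have "card E = card Q + card (E - Q)"
      using psubset.hyps QE by (metis card_Diff_subset card_mono finite_subset le_add_diff_inverse)
    moreover have "card Q = k" unfolding Q_def using card_image[OF injk] by simp
    moreover have "Q \<union> (E - Q) = E" using QE by blast
    ultimately show ?thesis using fQ fE psubset.prems(4) by (simp add: nat_pow_mult)
  qed simp
qed

context fin_group
begin

text \<open>The transfer from \<open>J\<close> into \<open>D/D'\<close> is evaluated along the cycles of \<open>h \<in> D\<close> on the cosets of
  \<open>D\<close>; fusion control makes it the power map \<open>h \<mapsto> h ^ |J:D|\<close>, which is injective as \<open>D\<close> is a Hall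
  subgroup.\<close>

lemma perfect_hall_subgroup:
  assumes J: "perfect J" and D: "subgroup D G" "D \<subseteq> J"
    and hall: "coprime (card D) (card J div card D)"
    and fus: "\<And>x g. x \<in> D \<Longrightarrow> g \<in> J \<Longrightarrow> cnj x g \<in> D \<Longrightarrow> x \<otimes> inv (cnj x g) \<in> derived G D"
  shows "perfect D"
proof -
  have Jg: "subgroup J G" using J by (simp add: perfect_def)
  interpret J: subgroup J G by (rule Jg)
  interpret D: subgroup D G by fact
  define D' where "D' = derived G D"
  have D': "subgroup D' G" "D' \<subseteq> D"
    unfolding D'_def by (auto simp: derived_is_subgroup D.subset intro: derived_incl[THEN subsetD, OF _ D(1)])
  interpret DG: group "G\<lparr>carrier := D\<rparr>" by (rule subgroup_imp_group[OF D(1)])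
  define A where "A = G\<lparr>carrier := D\<rparr> Mod D'"
  have dc: "derived (G\<lparr>carrier := D\<rparr>) (carrier (G\<lparr>carrier := D\<rparr>)) = D'"
    using derived_consistent[OF subset_refl D(1)] by (simp add: D'_def)
  interpret A: comm_group A
    using DG.derived_quot_is_comm_group unfolding dc A_def .
  have "D' \<lhd> G\<lparr>carrier := D\<rparr>" using DG.derived_self_is_normal unfolding dc .
  then interpret N: normal D' "G\<lparr>carrier := D\<rparr>" .
  define \<phi> where "\<phi> = (\<lambda>d. D' #> d)"
  have hom: "\<phi> \<in> hom (G\<lparr>carrier := D\<rparr>) A"
    using N.r_coset_hom_Mod unfolding A_def \<phi>_def by simp
  interpret \<phi>: group_hom "G\<lparr>carrier := D\<rparr>" A \<phi>
    by (intro group_hom.intro group_hom_axioms.intro hom A.is_group DG.is_group)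
  have \<phi>_mult: "\<phi> (x \<otimes> y) = \<phi> x \<otimes>\<^bsub>A\<^esub> \<phi> y" if "x \<in> D" "y \<in> D" for x y
    using \<phi>.hom_mult that by simp
  have \<phi>_cl [simp]: "\<phi> x \<in> carrier A" if "x \<in> D" for x using \<phi>.hom_closed that by simp
  have \<phi>_pow: "\<phi> (x [^] n) = \<phi> x [^]\<^bsub>A\<^esub> n" if "x \<in> D" for x and n :: nat
    using \<phi>.hom_nat_pow[of x n] that by (simp add: nat_pow_consistent[of _ _ D])
  have \<phi>_one [simp]: "\<phi> \<one> = \<one>\<^bsub>A\<^esub>" using \<phi>.hom_one by simp
  have \<phi>_ker: "\<phi> x = \<one>\<^bsub>A\<^esub> \<longleftrightarrow> x \<in> D'" if "x \<in> D" for x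
    using that D' coset_join1[of D' x] coset_join2[of x D'] subgroup_subset[OF D'(1)]
    by (auto simp: \<phi>_def A_def)
  have \<phi>_fus: "\<phi> (cnj x g) = \<phi> x" if "x \<in> D" "g \<in> J" "cnj x g \<in> D" for x g
  proof -
    have "\<phi> (x \<otimes> inv (cnj x g)) = \<one>\<^bsub>A\<^esub>" using fus[OF that] that by (simp add: \<phi>_ker D'_def)
    moreover have "\<phi> x = \<phi> (x \<otimes> inv (cnj x g)) \<otimes>\<^bsub>A\<^esub> \<phi> (cnj x g)"
      using that by (simp add: \<phi>_mult[symmetric] m_assoc)
    ultimately show ?thesis using that by simp
  qed
  define E where "E = (\<lambda>x. D #> x) ` J"
  have fE: "finite E" using Jg finite_subgroup by (simp add: E_def)
  have cardE: "card E = card J div card D" unfolding E_def by (rule card_rcosets_eq_div[OF D(1) Jg D(2)])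
  define t where "t c = (SOME x. x \<in> J \<and> c = D #> x)" for c
  have t: "t c \<in> J" "D #> t c = c" if c: "c \<in> E" for c
  proof -
    have "\<exists>x. x \<in> J \<and> c = D #> x" using c by (auto simp: E_def)
    then have "t c \<in> J \<and> c = D #> t c" unfolding t_def by (rule someI_ex)
    then show "t c \<in> J" "D #> t c = c" by auto
  qed
  have ass: "D #> x #> y = D #> (x \<otimes> y)" if "x \<in> J" "y \<in> J" for x y
    using that by (simp add: coset_mult_assoc[OF D.subset])
  have Ecl [simp]: "c #> g \<in> E" if "c \<in> E" "g \<in> J" for c g
    using that by (auto simp: E_def ass)
  have Emult: "c #> g #> h = c #> (g \<otimes> h)" if "c \<in> E" "g \<in> J" "h \<in> J" for c g h
    using that by (auto simp: E_def ass m_assoc)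
  have Eone: "c #> \<one> = c" if "c \<in> E" for c
    using that by (auto simp: E_def ass)
  \<comment> \<open>With \<open>t\<close> a transversal of the cosets, \<open>f g c\<close> is the
    element of \<open>D\<close> that corrects \<open>t c\<close> multiplied by \<open>g\<close> to
    the chosen representative of its coset. It satisfies the cocycle identity \<open>f_mult\<close>,
    which makes the product \<open>V\<close> of its images a homomorphism into the abelian group
    \<open>A\<close>.\<close>
  define f where "f g c = t c \<otimes> g \<otimes> inv (t (c #> g))" for g c
  have fD: "f g c \<in> D" if "c \<in> E" "g \<in> J" for c g
  proof -
    have "D #> (t c \<otimes> g) = c #> g" using t[OF that(1)] that by (simp flip: ass)
    then have "D #> (t c \<otimes> g) = D #> t (c #> g)" using t(2)[of "c #> g"] that by simp
    then have "t c \<otimes> g \<in> D #> t (c #> g)" using rcos_self[of "t c \<otimes> g" D] t that D(1) by auto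
    moreover have "t (c #> g) \<in> carrier G" "t c \<otimes> g \<in> carrier G" using t(1) that by auto
    ultimately show ?thesis unfolding f_def using D.rcos_module[OF is_group] by blast
  qed
  have f_mult: "f (g \<otimes> h) c = f g c \<otimes> f h (c #> g)" if "c \<in> E" "g \<in> J" "h \<in> J" for c g h
    using that t by (simp add: f_def Emult[symmetric] group_word_simps)
  define V where "V g = (\<Otimes>\<^bsub>A\<^esub>c\<in>E. \<phi> (f g c))" for g
  have V_cl [simp]: "V g \<in> carrier A" if "g \<in> J" for g
    unfolding V_def using that fD by (intro A.finprod_closed) auto
  have bij: "inj_on (\<lambda>c. c #> g) E" "(\<lambda>c. c #> g) ` E = E" if "g \<in> J" for g
  proof -
    have 1: "c #> g #> inv g = c" "c #> inv g #> g = c" if "c \<in> E" for c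
      using that \<open>g \<in> J\<close> by (simp_all add: Emult Eone)
    show "inj_on (\<lambda>c. c #> g) E" by (rule inj_on_inverseI[of _ "\<lambda>c. c #> inv g"]) (rule 1)
    show "(\<lambda>c. c #> g) ` E = E"
    proof
      show "E \<subseteq> (\<lambda>c. c #> g) ` E"
      proof
        fix c assume "c \<in> E"
        then show "c \<in> (\<lambda>c. c #> g) ` E" using 1(2)[of c] \<open>g \<in> J\<close> by (intro image_eqI[of _ _ "c #> inv g"]) auto
      qed
    qed (use that in auto)
  qed
  have V_mult: "V (g \<otimes> h) = V g \<otimes>\<^bsub>A\<^esub> V h" if gh: "g \<in> J" "h \<in> J" for g h
  proof -
    have "V (g \<otimes> h) = (\<Otimes>\<^bsub>A\<^esub>c\<in>E. \<phi> (f g c) \<otimes>\<^bsub>A\<^esub> \<phi> (f h (c #> g)))"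
      unfolding V_def using gh fD by (intro A.finprod_cong') (auto simp: f_mult \<phi>_mult)
    also have "\<dots> = V g \<otimes>\<^bsub>A\<^esub> (\<Otimes>\<^bsub>A\<^esub>c\<in>E. \<phi> (f h (c #> g)))"
      unfolding V_def using gh fD by (intro A.finprod_multf) auto
    also have "(\<Otimes>\<^bsub>A\<^esub>c\<in>E. \<phi> (f h (c #> g))) = (\<Otimes>\<^bsub>A\<^esub>c\<in>(\<lambda>c. c #> g) ` E. \<phi> (f h c))"
      using gh fD bij(1)[OF gh(1)] by (intro A.finprod_reindex[symmetric]) auto
    also have "\<dots> = V h" unfolding bij(2)[OF gh(1)] V_def ..
    finally show ?thesis .
  qed
  have V_one: "V \<one> = \<one>\<^bsub>A\<^esub>"
    unfolding V_def using t by (intro A.finprod_one_eqI) (simp add: f_def Eone)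
  have V_inv: "V (inv g) = inv\<^bsub>A\<^esub> V g" if "g \<in> J" for g
    using V_mult[of "inv g" g] that V_one by (intro A.inv_equality[symmetric]) auto
  \<comment> \<open>A homomorphism from the perfect group \<open>J\<close> to an abelian group is
    trivial.\<close>
  have "J \<subseteq> {g \<in> J. V g = \<one>\<^bsub>A\<^esub>}"
  proof (rule perfect_leI[OF J])
    show "subgroup {g \<in> J. V g = \<one>\<^bsub>A\<^esub>} G"
    proof (rule subgroupI)
      have "\<one> \<in> {g \<in> J. V g = \<one>\<^bsub>A\<^esub>}" using V_one by simp
      then show "{g \<in> J. V g = \<one>\<^bsub>A\<^esub>} \<noteq> {}" by blast
    qed (auto simp: V_inv V_mult)
    fix x y assume xy: "x \<in> J" "y \<in> J"
    have "V (x \<otimes> y \<otimes> inv x \<otimes> inv y) = V x \<otimes>\<^bsub>A\<^esub> V y \<otimes>\<^bsub>A\<^esub> inv\<^bsub>A\<^esub> V x \<otimes>\<^bsub>A\<^esub> inv\<^bsub>A\<^esub> V y"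
      using xy by (simp add: V_mult V_inv)
    also have "V x \<otimes>\<^bsub>A\<^esub> V y = V y \<otimes>\<^bsub>A\<^esub> V x" using xy by (simp add: A.m_comm)
    also have "V y \<otimes>\<^bsub>A\<^esub> V x \<otimes>\<^bsub>A\<^esub> inv\<^bsub>A\<^esub> V x \<otimes>\<^bsub>A\<^esub> inv\<^bsub>A\<^esub> V y = \<one>\<^bsub>A\<^esub>"
      using xy by (simp add: A.m_assoc)
    finally show "x \<otimes> y \<otimes> inv x \<otimes> inv y \<in> {g \<in> J. V g = \<one>\<^bsub>A\<^esub>}" using xy by simp
  qed
  then have V_triv: "V g = \<one>\<^bsub>A\<^esub>" if "g \<in> J" for g using that by blast
  \<comment> \<open>If \<open>h [^] k\<close> fixes the coset \<open>c\<close>, the factors along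
    the first \<open>k\<close> steps telescope to \<open>f (h [^] k) c\<close>. This is the
    conjugate of \<open>h [^] k\<close> by \<open>inv (t c)\<close>; both lie in \<open>D\<close>,
    so fusion control identifies their images in \<open>A\<close>.\<close>
  have V_eval: "V h = \<phi> h [^]\<^bsub>A\<^esub> card E" if h: "h \<in> D" for h
    unfolding V_def
  proof (rule A.finprod_permutation_cycles[OF fE])
    have hJ: "h \<in> J" using h D by blast
    show "(\<lambda>c. c #> h) \<in> E \<rightarrow> E" using hJ by auto
    show "inj_on (\<lambda>c. c #> h) E" by (rule bij(1)[OF hJ])
    show "(\<lambda>c. \<phi> (f h c)) \<in> E \<rightarrow> carrier A" using fD hJ by auto
    show "\<phi> h \<in> carrier A" using h by simp
    fix c k assume c: "c \<in> E" and k: "((\<lambda>c. c #> h) ^^ k) c = c"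
    have hk: "h [^] n \<in> D" "h [^] n \<in> J" for n :: nat
      using subgroup_nat_pow_closed[OF D(1) h] D(2) by auto
    have it: "((\<lambda>c. c #> h) ^^ n) c = c #> h [^] n" for n
      using c hJ hk by (induction n) (auto simp: Eone Emult)
    have tel: "(\<Otimes>\<^bsub>A\<^esub>i\<in>{..<n}. \<phi> (f h (c #> h [^] i))) = \<phi> (f (h [^] n) c)" for n :: nat
    proof (induction n)
      case 0
      then show ?case using c t by (simp add: f_def Eone)
    next
      case (Suc n)
      have "(\<Otimes>\<^bsub>A\<^esub>i\<in>{..<Suc n}. \<phi> (f h (c #> h [^] i)))
          = \<phi> (f h (c #> h [^] n)) \<otimes>\<^bsub>A\<^esub> (\<Otimes>\<^bsub>A\<^esub>i\<in>{..<n}. \<phi> (f h (c #> h [^] i)))"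
        unfolding lessThan_Suc using c hJ hk fD by (intro A.finprod_insert) auto
      also have "\<dots> = \<phi> (f (h [^] n) c) \<otimes>\<^bsub>A\<^esub> \<phi> (f h (c #> h [^] n))"
        unfolding Suc using c hJ hk fD by (intro A.m_comm) auto
      also have "\<dots> = \<phi> (f (h [^] Suc n) c)"
        using c hJ hk fD f_mult[of c "h [^] n" h] by (simp add: \<phi>_mult)
      finally show ?case .
    qed
    have "(\<Otimes>\<^bsub>A\<^esub>i\<in>{..<k}. \<phi> (f h (((\<lambda>c. c #> h) ^^ i) c))) = \<phi> (f (h [^] k) c)"
      unfolding it by (rule tel)
    also have "f (h [^] k) c = cnj (h [^] k) (inv (t c))"
      using k hJ t[OF c] by (simp add: it f_def cnj_def)
    also have "\<phi> \<dots> = \<phi> (h [^] k)"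
      using fD[OF c hk(2), of k] hk t[OF c] calculation k
      by (intro \<phi>_fus) (auto simp: it f_def cnj_def)
    also have "\<dots> = \<phi> h [^]\<^bsub>A\<^esub> k" using h by (rule \<phi>_pow)
    finally show "(\<Otimes>\<^bsub>A\<^esub>i\<in>{..<k}. \<phi> (f h (((\<lambda>c. c #> h) ^^ i) c))) = \<phi> h [^]\<^bsub>A\<^esub> k" .
  qed
  have "h \<in> D'" if h: "h \<in> D" for h
  proof -
    have "\<phi> h [^]\<^bsub>A\<^esub> card E = \<one>\<^bsub>A\<^esub>" using V_eval[OF h] V_triv h D by auto
    then have 1: "A.ord (\<phi> h) dvd card J div card D" using h by (simp add: A.pow_eq_id cardE)
    have "h [^] card D = \<one>"
      using DG.pow_order_eq_1[of h] h by (simp add: order_def nat_pow_consistent[of _ _ D])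
    then have "\<phi> h [^]\<^bsub>A\<^esub> card D = \<one>\<^bsub>A\<^esub>" using \<phi>_pow[OF h, of "card D"] by simp
    then have 2: "A.ord (\<phi> h) dvd card D" using h by (simp add: A.pow_eq_id)
    have "A.ord (\<phi> h) = 1" using hall 1 2 coprime_common_divisor_nat by blast
    then have "\<phi> h = \<one>\<^bsub>A\<^esub>" using h A.ord_eq_1[of "\<phi> h"] by simp
    then show ?thesis using h by (simp add: \<phi>_ker)
  qed
  then show ?thesis using D' D by (auto simp: perfect_def D'_def)
qed

end

lemma prime_power_of_unique_prime_divisor:
  fixes m p :: nat
  assumes "Factorial_Ring.prime p" "m > 0" "\<And>q. Factorial_Ring.prime q \<Longrightarrow> q dvd m \<Longrightarrow> q = p"
  shows "\<exists>j. m = p ^ j"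
proof -
  have u: "\<not> is_unit p" "m \<noteq> 0" using assms not_prime_unit by auto
  obtain c where c: "m = p ^ multiplicity p m * c" "\<not> p dvd c"
    using multiplicity_decompose'[OF u(2,1)] by metis
  have "c = 1"
  proof (rule ccontr)
    assume "c \<noteq> 1"
    then obtain q where q: "Factorial_Ring.prime q" "q dvd c" using prime_factor_nat by blast
    then have "q dvd m" using c(1) by (metis dvd_mult)
    then show False using assms(3)[OF q(1)] q c(2) by simp
  qed
  then show ?thesis using c(1) by (metis mult.right_neutral)
qed

context fin_group
begin

section \<open>Detecting subgroups by their Sylow subgroups\<close>

lemma index_prime_power:
  assumes p: "Factorial_Ring.prime (p::nat)" and C: "subgroup C G" "C \<subseteq> D" and D: "subgroup D G"
    and sy: "\<And>q. Factorial_Ring.prime q \<Longrightarrow> q \<noteq> p \<Longrightarrow> \<exists>Q. sylow_in q Q D \<and> Q \<subseteq> C"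
  shows "\<exists>j. card D = card C * p ^ j"
proof -
  obtain m where m: "card D = card C * m" using card_dvd[OF C(1) D C(2)] by (auto elim: dvdE)
  then have "m > 0" using card_subgroup_pos[OF D] by (cases m) auto
  moreover have "q = p" if q: "Factorial_Ring.prime q" "q dvd m" for q
  proof (rule ccontr)
    assume "q \<noteq> p"
    then obtain Q where Q: "sylow_in q Q D" "Q \<subseteq> C" using sy q by blast
    then have Qg: "subgroup Q G" by (simp add: sylow_in_def)
    obtain b where "card C = card Q * b" using card_dvd[OF Qg C(1) Q(2)] by (auto elim: dvdE)
    then have "card D div card Q = b * m" using m card_subgroup_pos[OF Qg] by simp
    then show False using Q q by (auto simp: sylow_in_def)
  qed
  ultimately show ?thesis using prime_power_of_unique_prime_divisor[OF p, of m] m by blast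
qed

lemma eq_of_all_sylows:
  assumes C: "subgroup C G" "C \<subseteq> D" and D: "subgroup D G"
    and sy: "\<And>q. Factorial_Ring.prime (q::nat) \<Longrightarrow> \<exists>Q. sylow_in q Q D \<and> Q \<subseteq> C"
  shows "C = D"
proof -
  \<comment> \<open>The prime 2 is an arbitrary choice: the odd Sylow subgroups leave a power of 2
    as the index, and the Sylow 2-subgroup removes that.\<close>
  obtain j where j: "card D = card C * 2 ^ j"
    using index_prime_power[OF two_is_prime_nat C D] sy by blast
  obtain Q where Q: "sylow_in 2 Q D" "Q \<subseteq> C" using sy[OF two_is_prime_nat] by blast
  then have Qg: "subgroup Q G" by (simp add: sylow_in_def)
  obtain b where "card C = card Q * b" using card_dvd[OF Qg C(1) Q(2)] by (auto elim: dvdE)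
  then have "card D div card Q = b * 2 ^ j" using j card_subgroup_pos[OF Qg] by simp
  then have "j = 0" using Q by (cases j) (auto simp: sylow_in_def)
  then show ?thesis using j C finite_subgroup[OF D] by (intro card_subset_eq) auto
qed

lemma coprime_order_Int:
  assumes "Factorial_Ring.prime (p::nat)" "Factorial_Ring.prime (q::nat)" "p \<noteq> q"
    "subgroup U G" "card U = p ^ k" "subgroup Q G" "card Q = q ^ j"
  shows "U \<inter> Q = {\<one>}"
proof -
  have I: "subgroup (U \<inter> Q) G" using assms subgroups_Inter_pair by blast
  have "card (U \<inter> Q) dvd p ^ k" "card (U \<inter> Q) dvd q ^ j"
    using card_dvd[OF I assms(4)] card_dvd[OF I assms(6)] assms by auto
  moreover have "coprime (p ^ k) (q ^ j)" using assms primes_coprime by auto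
  ultimately have "card (U \<inter> Q) = 1" using coprime_common_divisor_nat by blast
  then show ?thesis using subgroup_nontrivial[OF I] by blast
qed

lemma perfect_pgroup_trivial:
  assumes "Factorial_Ring.prime (p::nat)" "perfect D" "card D = p ^ k"
  shows "D = {\<one>}"
proof -
  have D: "subgroup D G" using assms by (simp add: perfect_def)
  show ?thesis
    using perfect_no_pgroup_quotient[OF assms(1,2), of "{\<one>}" k] assms(3) subgroup.one_closed[OF D]
      triv_subgroup subgroup_subset[OF D] nrm_triv[of "{\<one>}"] by auto
qed

text \<open>If all proper subgroups of order divisible by \<open>p\<close> were nilpotent, then fusion in a Sylow
  \<open>p\<close>-subgroup \<open>S\<close> would be controlled by \<open>S\<close> itself, so transfer would make \<open>S\<close> perfect.\<close>

lemma perfect_has_nonnilpotent_subgroup: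
  assumes p: "Factorial_Ring.prime (p::nat)" and D: "perfect D" and pd: "p dvd card D"
  shows "\<exists>Z. subgroup Z G \<and> Z \<subset> D \<and> p dvd card Z \<and> \<not> nil Z"
proof (rule ccontr)
  assume "\<not> ?thesis"
  then have nil: "nil Z" if "subgroup Z G" "Z \<subset> D" "p dvd card Z" for Z
    using that by blast
  have Dg: "subgroup D G" using D by (simp add: perfect_def)
  interpret D: subgroup D G by (rule Dg)
  have Dc: "D \<subseteq> carrier G" by (rule D.subset)
  have not_pgroup: "card D \<noteq> p ^ k" for k
  proof
    assume "card D = p ^ k"
    then have "D = {\<one>}" by (rule perfect_pgroup_trivial[OF p D])
    then show False using pd p by simp
  qed
  \<comment> \<open>Normal p-subgroups \<open>U\<close> of \<open>D\<close> are central. For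
    \<open>q\<close> other than \<open>p\<close>, the product of \<open>U\<close> with a Sylow
    q-subgroup \<open>Q\<close> is proper, since \<open>D/U\<close> cannot be a nontrivial q-group
    nor \<open>D\<close> a p-group. So it is nilpotent and \<open>Q\<close> centralises
    \<open>U\<close>. The centralizer of \<open>U\<close> in \<open>D\<close> then has p-power index
    and is normal, so it is all of \<open>D\<close>.\<close>
  have central: "U \<subseteq> centralizer G D" if U: "subgroup U G" "U \<subseteq> D" "D \<subseteq> nrm U" "card U = p ^ k" for U k
  proof (cases "U = {\<one>}")
    case True
    then show ?thesis using Dc by (auto simp: centralizer_def)
  next
    case False
    then have "k \<noteq> 0" using U subgroup_nontrivial[OF U(1)] by auto
    then have pU: "p dvd card U" using U by simp
    define C where "C = centralizer G U \<inter> D"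
    have Uc: "U \<subseteq> carrier G" using U(1) by (rule subgroup_subset)
    have C: "subgroup C G" "C \<subseteq> D" unfolding C_def using subgroups_Inter_pair[OF _ Dg] Uc by auto
    have "\<exists>Q. sylow_in q Q D \<and> Q \<subseteq> C" if q: "Factorial_Ring.prime q" "q \<noteq> p" for q
    proof -
      obtain Q where Q: "sylow_in q Q D" using sylow_in_exists[OF q(1) Dg] by blast
      then have Qg: "subgroup Q G" "Q \<subseteq> D" by (auto simp: sylow_in_def)
      obtain j where j: "card Q = q ^ j" using Q by (auto simp: sylow_in_def)
      have QU: "Q \<subseteq> nrm U" using Qg U by blast
      have L: "subgroup (U <#> Q) G" "U \<subseteq> U <#> Q" "Q \<subseteq> U <#> Q" by (rule subgroup_set_mult[OF U(1) Qg(1) QU])+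
      have LD: "U <#> Q \<subseteq> D" by (rule set_mult_least[OF Dg U(2) Qg(2)])
      have int: "U \<inter> Q = {\<one>}" using coprime_order_Int[OF p q(1) _ U(1,4) Qg(1) j] q by blast
      have "U <#> Q \<noteq> D"
      proof
        assume "U <#> Q = D"
        then have "card D = card U * q ^ j" using card_set_mult[OF U(1) Qg(1)] int j by simp
        then have "U = D" by (rule perfect_no_pgroup_quotient[OF q(1) D U(1-3)])
        then show False using U not_pgroup by blast
      qed
      then have "nil (U <#> Q)" using LD pU card_dvd[OF U(1) L(1,2)] dvd_trans by (intro nil L(1)) auto
      moreover have "sylow_in q Q (U <#> Q)" by (rule sylow_in_intermediate[OF Q Dg L(1,3) LD])
      ultimately have "U <#> Q \<subseteq> nrm Q" using nil_sylow_normal[OF q(1) L(1)] by blast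
      then have "Q \<subseteq> centralizer G U"
        using L QU int by (intro normal_disjoint_commute U(1) Qg(1)) auto
      then show ?thesis using Q Qg by (auto simp: C_def)
    qed
    then obtain j where j: "card D = card C * p ^ j" using index_prime_power[OF p C Dg] by blast
    have "D \<subseteq> nrm C"
      using centralizer_nrm[OF Uc] subgroup_le_nrm[OF Dg] U(3) nrm_Int[of "centralizer G U" D] Dc
      unfolding C_def by auto
    then have "C = D" using perfect_no_pgroup_quotient[OF p D C _ j] by blast
    then have "D \<subseteq> centralizer G U" by (auto simp: C_def)
    then show ?thesis by (rule centralizer_sym[OF Uc])
  qed
  \<comment> \<open>Downward induction on the size of the intersection \<open>U\<close>. A
    noncentral \<open>U\<close> is not normal in \<open>D\<close>, so its normalizer
    \<open>L\<close> in \<open>D\<close> is nilpotent with a single Sylow p-subgroup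
    \<open>V\<close>; a Sylow subgroup \<open>S3\<close> of \<open>D\<close> containing
    \<open>V\<close> links \<open>S1\<close> and \<open>S2\<close>.\<close>
  have sylow_eq: "S1 = S2" if "sylow_in p S1 D" "sylow_in p S2 D" "\<not> S1 \<inter> S2 \<subseteq> centralizer G D" for S1 S2
    using that
  proof (induction "card D - card (S1 \<inter> S2)" arbitrary: S1 S2 rule: less_induct)
    case less
    show ?case
    proof (rule ccontr)
      assume ne: "S1 \<noteq> S2"
      define U where "U = S1 \<inter> S2"
      have S: "subgroup S1 G" "S1 \<subseteq> D" "subgroup S2 G" "S2 \<subseteq> D" using less.prems by (auto simp: sylow_in_def)
      obtain k where k: "card S1 = p ^ k" using less.prems by (auto simp: sylow_in_def)
      have k2: "card S2 = p ^ k" using sylow_card[OF p Dg less.prems(1)] sylow_card[OF p Dg less.prems(2)] k by simp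
      have fS: "finite S1" "finite S2" using S finite_subgroup by auto
      have U: "subgroup U G" "U \<subseteq> D" using S subgroups_Inter_pair by (auto simp: U_def)
      have "U \<subset> S1" "U \<subset> S2"
        using ne k k2 fS card_subset_eq[of S1 S2] card_subset_eq[of S2 S1] by (auto simp: U_def)
      obtain i where i: "card U = p ^ i"
        using card_dvd[OF U(1) S(1)] k divides_primepow_nat[OF p] by (auto simp: U_def)
      have Uc: "U \<subseteq> carrier G" using U Dc by blast
      have "\<not> D \<subseteq> nrm U" using central[OF U _ i] less.prems(3) by (auto simp: U_def)
      define L where "L = nrm U \<inter> D"
      have L: "subgroup L G" "L \<subset> D"
        using subgroups_Inter_pair[OF subgroup_nrm Dg] Uc \<open>\<not> D \<subseteq> nrm U\<close> by (auto simp: L_def)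
      have UL: "U \<subseteq> L" using U subgroup_le_nrm by (auto simp: L_def)
      have "{\<one>} \<subseteq> centralizer G D" using Dc by (auto simp: centralizer_def)
      then have "U \<noteq> {\<one>}" using less.prems(3) unfolding U_def by metis
      then have "p dvd card U" using i subgroup_nontrivial[OF U(1)] by (cases i) auto
      then have "nil L" using L card_dvd[OF U(1) L(1) UL] dvd_trans by (intro nil) auto
      obtain V where V: "sylow_in p V L" using sylow_in_exists[OF p L(1)] by blast
      have Vn: "L \<subseteq> nrm V" by (rule nil_sylow_normal[OF p L(1) \<open>nil L\<close> V])
      have Vg: "subgroup V G" "V \<subseteq> L" using V by (auto simp: sylow_in_def)
      obtain v where v: "card V = p ^ v" using V by (auto simp: sylow_in_def)
      obtain S where S': "sylow_in p S D" using sylow_in_exists[OF p Dg] by blast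
      obtain x where x: "x \<in> D" "conj_set G V x \<subseteq> S"
        using sylow_conj_into[OF p Dg S' Vg(1) v] Vg L by blast
      define S3 where "S3 = conj_set G S (inv x)"
      have Sc: "S \<subseteq> carrier G" using S' Dc by (auto simp: sylow_in_def)
      have "conj_set G D (inv x) = D" using conj_set_self[OF Dg] x by simp
      then have S3: "sylow_in p S3 D" using sylow_in_conj[OF S' Dg, of "inv x"] x by (simp add: S3_def)
      have VS3: "V \<subseteq> S3"
        using x conj_set_subset_iff[of V S x] Sc subgroup_subset[OF Vg(1)] by (simp add: S3_def)
      \<comment> \<open>Normalizers grow in the p-group \<open>Si\<close>, so its intersection with
        \<open>L\<close> is larger than \<open>U\<close>. That intersection lies in
        \<open>V\<close>, hence in \<open>S3\<close>, and the induction hypothesis applies to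
        \<open>Si\<close> and \<open>S3\<close>.\<close>
      have eq: "Si = S3" if Si: "sylow_in p Si D" "U \<subset> Si" for Si
      proof -
        have Sig: "subgroup Si G" "Si \<subseteq> D" using Si by (auto simp: sylow_in_def)
        obtain s where s: "card Si = p ^ s" using Si by (auto simp: sylow_in_def)
        obtain y where y: "y \<in> Si - U" "y \<in> nrm U" using pgroup_normalizer_grows[OF p Sig(1) s U(1) Si(2)] by blast
        define W where "W = Si \<inter> L"
        have W: "subgroup W G" using Sig L subgroups_Inter_pair by (simp add: W_def)
        obtain w where w: "card W = p ^ w"
          using card_dvd[OF W Sig(1)] s divides_primepow_nat[OF p] by (auto simp: W_def)
        have "W \<subseteq> V" by (rule normal_sylow_contains[OF p L(1) V Vn W w]) (simp add: W_def)
        then have WS: "W \<subseteq> Si \<inter> S3" using VS3 by (auto simp: W_def)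
        have "U \<subset> W" using y Si UL Sig by (auto simp: W_def L_def)
        then have "U \<subset> Si \<inter> S3" using WS by blast
        moreover have "finite (Si \<inter> S3)" using Sig finite_subgroup by blast
        ultimately have "card U < card (Si \<inter> S3)" by (simp add: psubset_card_mono)
        moreover have "card (Si \<inter> S3) \<le> card D" using Sig finite_subgroup[OF Dg] by (intro card_mono) auto
        moreover have "\<not> Si \<inter> S3 \<subseteq> centralizer G D"
          using less.prems(3) \<open>U \<subset> Si \<inter> S3\<close> by (auto simp: U_def)
        ultimately show ?thesis using less.hyps[of Si S3] Si(1) S3 by (auto simp: U_def)
      qed
      show False using eq[OF less.prems(1) \<open>U \<subset> S1\<close>] eq[OF less.prems(2) \<open>U \<subset> S2\<close>] ne by simp
    qed
  qed
  obtain S where S: "sylow_in p S D" using sylow_in_exists[OF p Dg] by blast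
  then have Sg: "subgroup S G" "S \<subseteq> D" by (auto simp: sylow_in_def)
  interpret S: subgroup S G by (rule Sg(1))
  obtain k where k: "card S = p ^ k" using S by (auto simp: sylow_in_def)
  have nd: "\<not> p dvd card D div card S" using S by (simp add: sylow_in_def)
  have "card S \<noteq> 1" using nd pd by auto
  have pS: "p dvd card S" using k \<open>card S \<noteq> 1\<close> by (cases k) auto
  have Sc: "S \<subseteq> carrier G" by (rule S.subset)
  have "perfect S"
  proof (rule perfect_hall_subgroup[OF D Sg])
    show "coprime (card S) (card D div card S)"
      using prime_imp_coprime[OF p nd] unfolding k by simp
    fix s g assume s: "s \<in> S" and g: "g \<in> D" and sg: "cnj s g \<in> S"
    have sc: "s \<in> carrier G" "g \<in> carrier G" "s \<in> D" using s g Sg by auto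
    have one: "\<one> \<in> derived G S" by (meson Sc derived_is_subgroup subgroup.one_closed)
    show "s \<otimes> inv (cnj s g) \<in> derived G S"
    \<comment> \<open>A central \<open>s\<close> is not moved at all. Otherwise \<open>S\<close> and
      its conjugate by \<open>g\<close> share the noncentral element \<open>cnj s g\<close>, so they
      coincide and \<open>g\<close> normalises \<open>S\<close>.\<close>
    proof (cases "s \<in> centralizer G D")
      case True
      then have "cnj s g = s" using g sc by (simp add: cnj_eq_iff centralizer_def)
      then show ?thesis using sc one by simp
    next
      case False
      have "cnj s g \<notin> centralizer G D"
      proof
        assume "cnj s g \<in> centralizer G D"
        then have "cnj (cnj s g) (inv g) = cnj s g" using g sc by (subst cnj_eq_iff) (auto simp: centralizer_def)
        then have "s = cnj s g" using sc by simp
        then show False using False \<open>cnj s g \<in> centralizer G D\<close> by simp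
      qed
      moreover have "sylow_in p (conj_set G S g) D"
        using sylow_in_conj[OF S Dg sc(2)] conj_set_self[OF Dg g] by simp
      moreover have "cnj s g \<in> S \<inter> conj_set G S g" using s sg by (auto simp: conj_set_image)
      ultimately have "S = conj_set G S g" using sylow_eq[OF S] by blast
      then have gn: "g \<in> nrm S" using sc by (simp add: nrm_def)
      have nn: "\<not> D \<subseteq> nrm S" using central[OF Sg _ k] s False by blast
      define L where "L = nrm S \<inter> D"
      have L: "subgroup L G" "L \<subset> D" using subgroups_Inter_pair[OF subgroup_nrm Dg] Sc nn by (auto simp: L_def)
      have SL: "S \<subseteq> L" using Sg subgroup_le_nrm by (auto simp: L_def)
      have nilL: "nil L" using L card_dvd[OF Sg(1) L(1) SL] pS dvd_trans by (intro nil) auto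
      define C where "C = centralizer G S \<inter> L"
      have C: "subgroup C G" using subgroups_Inter_pair[OF subgroup_centralizer L(1)] Sc by (simp add: C_def)
      have CS: "C \<subseteq> nrm S" using centralizer_le_nrm[OF Sc] by (auto simp: C_def)
      have SC: "subgroup (S <#> C) G" "S \<subseteq> S <#> C" "C \<subseteq> S <#> C" by (rule subgroup_set_mult[OF Sg(1) C CS])+
      have SCL: "S <#> C \<subseteq> L" by (rule set_mult_least[OF L(1) SL]) (auto simp: C_def)
      \<comment> \<open>In the nilpotent group \<open>L\<close> the Sylow subgroups for primes other
        than \<open>p\<close> centralise \<open>S\<close>. So \<open>L\<close> is \<open>S\<close>
        times the centralizer of \<open>S\<close> in \<open>L\<close>, and \<open>g\<close> acts on
        \<open>S\<close> as an inner automorphism.\<close>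
      have "\<exists>Q. sylow_in q Q L \<and> Q \<subseteq> S <#> C" if q: "Factorial_Ring.prime q" for q
      proof (cases "q = p")
        case True
        then show ?thesis using sylow_in_intermediate[OF S Dg L(1) SL] L SC(2) by blast
      next
        case False
        obtain Q where Q: "sylow_in q Q L" using sylow_in_exists[OF q L(1)] by blast
        then have Qg: "subgroup Q G" "Q \<subseteq> L" by (auto simp: sylow_in_def)
        obtain j where j: "card Q = q ^ j" using Q by (auto simp: sylow_in_def)
        have "L \<subseteq> nrm Q" by (rule nil_sylow_normal[OF q L(1) nilL Q])
        moreover have "S \<inter> Q = {\<one>}" using coprime_order_Int[OF p q _ Sg(1) k Qg(1) j] False by blast
        ultimately have "Q \<subseteq> centralizer G S"
          using Qg SL by (intro normal_disjoint_commute Sg(1) Qg(1)) (auto simp: L_def)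
        then show ?thesis using Q Qg SC(3) by (auto simp: C_def)
      qed
      then have "S <#> C = L" by (rule eq_of_all_sylows[OF SC(1) SCL L(1)])
      moreover have "g \<in> L" using g gn by (simp add: L_def)
      ultimately obtain s' c where g': "s' \<in> S" "c \<in> C" "g = s' \<otimes> c" unfolding set_mult_def by blast
      have cc: "c \<in> carrier G" "c \<in> centralizer G S" using g' by (auto simp: C_def centralizer_def)
      have "cnj s g = cnj (cnj s s') c" using g' cc sc by (simp add: cnj_cnj)
      also have "\<dots> = cnj s s'"
        using g' s by (intro centralizer_cnj[OF Sc cc(2)]) (simp add: cnj_def)
      finally have "s \<otimes> inv (cnj s g) = s \<otimes> inv s' \<otimes> inv s \<otimes> inv (inv s')"
        using s g' by (simp add: cnj_def group_word_simps)
      then show ?thesis using s g' commutator_in_derived[of s S "inv s'"] by simp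
    qed
  qed
  then have "S = {\<one>}" using perfect_pgroup_trivial[OF p _ k] by blast
  then show False using \<open>card S \<noteq> 1\<close> by simp
qed

section \<open>Frobenius complements\<close>

text \<open>\<open>N\<close> is a Frobenius complement in \<open>K\<close>, described without a
  kernel. The overgroup is a parameter because the counting in \<open>frob_comparable\<close> takes
  place both in \<open>G\<close> and inside \<open>N\<close>.\<close>

definition frob :: "'a set \<Rightarrow> 'a set \<Rightarrow> bool" where
  "frob N K \<longleftrightarrow> subgroup N G \<and> subgroup K G \<and> N \<subset> K \<and> N \<noteq> {\<one>} \<and>
     (\<forall>x\<in>K - N. conj_set G N x \<inter> N = {\<one>})"

lemma frob_Int: "frob N K \<Longrightarrow> x \<in> K - N \<Longrightarrow> conj_set G N x \<inter> N = {\<one>}"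
  by (simp add: frob_def)

lemma frob_mem:
  assumes "frob N K" "x \<in> K" "z \<in> N" "z \<in> conj_set G N x" "z \<noteq> \<one>"
  shows "x \<in> N"
  using assms unfolding frob_def by blast

lemma frob_nrm:
  assumes F: "frob N K" and W: "W \<subseteq> N" "z \<in> W" "z \<noteq> \<one>"
  shows "nrm W \<inter> K \<subseteq> N"
proof
  fix g assume g: "g \<in> nrm W \<inter> K"
  have "z \<in> conj_set G W g" using g W by (simp add: nrm_def)
  then have "z \<in> conj_set G N g" using conj_set_mono[OF W(1), of g] by blast
  then show "g \<in> N" using frob_mem[OF F] g W by blast
qed

lemma frob_centralizer:
  assumes F: "frob N K" and z: "z \<in> N" "z \<noteq> \<one>" and t: "t \<in> K" "t \<otimes> z = z \<otimes> t"
  shows "t \<in> N"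
proof -
  have c: "z \<in> carrier G" "t \<in> carrier G" using F z t subgroup_mem unfolding frob_def by blast+
  then have "cnj z t = z" using t by (simp add: cnj_eq_iff)
  then have "z \<in> conj_set G N t" using z by (force simp: conj_set_image)
  then show ?thesis using frob_mem[OF F] z t by blast
qed

text \<open>A subgroup of order \<open>q\<close> in \<open>N\<close> fixes the coset
  \<open>N\<close>. If \<open>q\<close> divided the index it would fix another coset, so an element
  outside \<open>N\<close> would conjugate it into \<open>N\<close>.\<close>

lemma frob_hall:
  assumes F: "frob N K" and q: "Factorial_Ring.prime (q::nat)" "q dvd card N"
  shows "\<not> q dvd card K div card N"
proof
  assume d: "q dvd card K div card N"
  have N: "subgroup N G" "subgroup K G" "N \<subseteq> K" using F by (auto simp: frob_def)
  obtain Q where Q: "subgroup Q G" "Q \<subseteq> N" "card Q = q ^ 1"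
    using subgroup_prime_power_exists[OF q(1) N(1), of 1] q(2) by auto
  obtain x where x: "x \<in> K - N" "conj_set G Q x \<subseteq> N"
    using pgroup_conj_into_other[OF q(1) Q(1,3) N Q(2) d] by blast
  have "x \<in> carrier G" using x N subgroup_mem by blast
  then have "card (conj_set G Q x) = q" using Q subgroup_subset[OF Q(1)] by simp
  moreover have "conj_set G Q x \<subseteq> {\<one>}" using x(2) frob_Int[OF F x(1)] conj_set_mono[OF Q(2), of x] by auto
  then have "card (conj_set G Q x) \<le> 1" using card_mono[of "{\<one>}"] by fastforce
  ultimately show False using prime_gt_1_nat[OF q(1)] by simp
qed

section \<open>Counting the conjugates of a Frobenius complement\<close>

definition conj_union :: "'a set \<Rightarrow> 'a set \<Rightarrow> 'a set" where
  "conj_union N K = (\<Union>x\<in>K. conj_set G N x) - {\<one>}"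

text \<open>Count pairs of \<open>x\<close> in \<open>K\<close> and a nontrivial \<open>n\<close> in
  \<open>N\<close> by the value of \<open>cnj n x\<close>. Two pairs agree only if their first
  components lie in the same coset of \<open>N\<close>, so each fibre has \<open>|N|\<close>
  elements and the union has \<open>|K:N| (|N| - 1)\<close>. The additive form avoids subtraction of
  naturals.\<close>

lemma frob_card_conj_union:
  assumes F: "frob N K"
  shows "card (conj_union N K) + card K div card N = card K"
proof -
  have N: "subgroup N G" "subgroup K G" "N \<subseteq> K" using F by (auto simp: frob_def)
  interpret N: subgroup N G by (rule N(1))
  interpret K: subgroup K G by (rule N(2))
  have fin: "finite K" "finite N" using N finite_subgroup by auto
  let ?f = "\<lambda>(x,n). cnj n x"
  let ?P = "K \<times> (N - {\<one>})"
  have im: "?f ` ?P = conj_union N K"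
  proof
    show "?f ` ?P \<subseteq> conj_union N K"
      by (auto simp: conj_union_def conj_set_image cnj_eq_one_iff)
    show "conj_union N K \<subseteq> ?f ` ?P"
    proof
      fix u assume u: "u \<in> conj_union N K"
      then obtain x n where xn: "x \<in> K" "n \<in> N" "u = cnj n x" "u \<noteq> \<one>" by (auto simp: conj_union_def conj_set_image)
      then have "n \<noteq> \<one>" by auto
      then show "u \<in> ?f ` ?P" using xn by (intro image_eqI[of _ _ "(x,n)"]) auto
    qed
  qed
  have fib: "card {z \<in> ?P. ?f z = u} = card N" if u: "u \<in> ?f ` ?P" for u
  proof -
    obtain x n where xn: "x \<in> K" "n \<in> N" "n \<noteq> \<one>" "u = cnj n x" using u by auto
    have xnc: "x \<in> carrier G" "n \<in> carrier G" using xn by auto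
    have "bij_betw (\<lambda>a. (a \<otimes> x, cnj n (inv a))) N {z \<in> ?P. ?f z = u}"
      unfolding bij_betw_def
    proof
      show "inj_on (\<lambda>a. (a \<otimes> x, cnj n (inv a))) N"
        using xnc by (intro inj_onI) (auto dest: right_cancel[THEN iffD1, rotated -1])
      show "(\<lambda>a. (a \<otimes> x, cnj n (inv a))) ` N = {z \<in> ?P. ?f z = u}"
      proof
        show "(\<lambda>a. (a \<otimes> x, cnj n (inv a))) ` N \<subseteq> {z \<in> ?P. ?f z = u}"
        proof (rule image_subsetI)
          fix a assume a: "a \<in> N"
          have ac: "a \<in> carrier G" "a \<in> K" using a N by auto
          have "cnj n (inv a) \<in> N" using a xn by (simp add: cnj_def)
          moreover have "cnj n (inv a) \<noteq> \<one>" using ac xnc xn by (simp add: cnj_eq_one_iff)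
          moreover have "cnj (cnj n (inv a)) (a \<otimes> x) = cnj n x"
            using ac xnc by (simp add: cnj_cnj)
          ultimately show "(a \<otimes> x, cnj n (inv a)) \<in> {z \<in> ?P. ?f z = u}"
            using ac xn by auto
        qed
        show "{z \<in> ?P. ?f z = u} \<subseteq> (\<lambda>a. (a \<otimes> x, cnj n (inv a))) ` N"
        proof
          fix z assume "z \<in> {z \<in> ?P. ?f z = u}"
          then obtain y m where z: "z = (y, m)" and ym: "y \<in> K" "m \<in> N" "m \<noteq> \<one>" "cnj m y = u" by auto
          have ymc: "y \<in> carrier G" "m \<in> carrier G" using ym by auto
          define a where "a = y \<otimes> inv x"
          have ac: "a \<in> carrier G" "a \<in> K" using ym xn by (auto simp: a_def)
          have "m = cnj (cnj m y) (inv y)" using ymc by simp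
          also have "\<dots> = cnj (cnj n x) (inv y)" using ym xn by simp
          also have "\<dots> = cnj n (inv a)" using xnc ymc by (simp add: cnj_cnj a_def inv_mult_group)
          finally have m: "m = cnj n (inv a)" .
          then have "m \<in> conj_set G N (inv a)" using xn by (auto simp: conj_set_image)
          then have "inv a \<in> N" using frob_mem[OF F, of "inv a" m] ym ac by auto
          then have "a \<in> N" using N.m_inv_closed[of "inv a"] ac by simp
          moreover have "y = a \<otimes> x" using xnc ymc by (simp add: a_def m_assoc)
          ultimately show "z \<in> (\<lambda>a. (a \<otimes> x, cnj n (inv a))) ` N" using m z by blast
        qed
      qed
    qed
    then show ?thesis by (simp add: bij_betw_same_card)
  qed
  have "card ?P = (\<Sum>u\<in>?f ` ?P. card {z \<in> ?P. ?f z = u})"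
    unfolding card_eq_sum using fin by (intro sum.image_gen) auto
  also have "\<dots> = card (conj_union N K) * card N" using fib im by simp
  finally have 1: "card K * (card N - 1) = card (conj_union N K) * card N"
    using fin by (simp add: card_cartesian_product)
  obtain m where m: "card K = card N * m" using card_dvd[OF N] by (auto elim: dvdE)
  have n: "card N > 0" using N by simp
  have "m * (card N - 1) = card (conj_union N K)" using 1 m n by (simp add: mult.assoc)
  moreover have "m * (card N - 1) + m = m * card N" using n by (cases "card N") auto
  ultimately show ?thesis using m n by (simp add: mult.commute)
qed

lemma frob_index_le_half:
  assumes "frob N K" shows "2 * (card K div card N) \<le> card K"
proof -
  have N: "subgroup N G" "subgroup K G" "N \<subseteq> K" using assms by (auto simp: frob_def)
  obtain m where m: "card K = card N * m" using card_dvd[OF N] by (auto elim: dvdE)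
  have "card N \<noteq> 1" using assms subgroup_nontrivial[OF N(1)] by (simp add: frob_def)
  then have "card N \<ge> 2" using card_subgroup_pos[OF N(1)] by linarith
  then show ?thesis using m by simp
qed

text \<open>The conjugates of \<open>N\<close> and of \<open>L\<close> miss only \<open>|G:N|\<close> and \<open>|G:L|\<close> elements and meet only in
  conjugates of \<open>B = N \<inter> L\<close>, which miss \<open>|G:B| \<ge> |G:N| + |G:L|\<close> elements.\<close>

lemma frob_comparable:
  assumes FN: "frob N (carrier G)" and FL: "frob L (carrier G)" and ne: "N \<inter> L \<noteq> {\<one>}"
  shows "N \<subseteq> L \<or> L \<subseteq> N"
proof (rule ccontr)
  assume nc: "\<not> ?thesis"
  define B where "B = N \<inter> L"
  have N: "subgroup N G" and L: "subgroup L G" using FN FL by (auto simp: frob_def)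
  interpret N: subgroup N G by (rule N)
  interpret L: subgroup L G by (rule L)
  have B: "subgroup B G" using N L subgroups_Inter_pair by (simp add: B_def)
  interpret B: subgroup B G by (rule B)
  have bne: "B \<noteq> {\<one>}" using ne by (simp add: B_def)
  then obtain b where b: "b \<in> B" "b \<noteq> \<one>" using B.one_closed by blast
  have fG: "finite (carrier G)" by simp
  have FB: "frob B (carrier G)"
  proof -
    have "conj_set G B x \<inter> B = {\<one>}" if x: "x \<in> carrier G - B" for x
    proof (rule ccontr)
      assume "\<not> ?thesis"
      moreover have "\<one> \<in> conj_set G B x \<inter> B" using x subgroup.one_closed[OF subgroup_conj_set[OF B, of x]] by simp
      ultimately obtain z where z: "z \<in> conj_set G B x" "z \<in> B" "z \<noteq> \<one>" by blast
      have "z \<in> conj_set G N x" "z \<in> conj_set G L x"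
        using z(1) conj_set_mono[of B N x] conj_set_mono[of B L x] by (auto simp: B_def)
      moreover have "z \<in> N" "z \<in> L" "x \<in> carrier G" using z x by (auto simp: B_def)
      ultimately have "x \<in> N" "x \<in> L" using frob_mem[OF FN _ _ _ z(3)] frob_mem[OF FL _ _ _ z(3)] by blast+
      then show False using x by (simp add: B_def)
    qed
    then show ?thesis using B bne FN by (auto simp: frob_def B_def subgroup_self)
  qed
  have proper: "\<not> N \<subseteq> conj_set G L y" if y: "y \<in> carrier G" for y
  proof
    assume a: "N \<subseteq> conj_set G L y"
    have "y \<in> L" using frob_mem[OF FL y, of b] b a by (auto simp: B_def)
    then show False using a nc conj_set_self[OF L] by auto
  qed
  \<comment> \<open>Any nontrivial intersection of \<open>N\<close> with a conjugate of
    \<open>L\<close> is a Frobenius complement in \<open>N\<close>; by \<open>proper\<close> it is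
    not all of \<open>N\<close>.\<close>
  have FBy: "frob (N \<inter> conj_set G L y) N" if y: "y \<in> carrier G" "N \<inter> conj_set G L y \<noteq> {\<one>}" for y
  proof -
    have I: "subgroup (N \<inter> conj_set G L y) G" using subgroups_Inter_pair[OF N subgroup_conj_set[OF L y(1)]] .
    have "conj_set G (N \<inter> conj_set G L y) x \<inter> (N \<inter> conj_set G L y) = {\<one>}"
      if x: "x \<in> N - (N \<inter> conj_set G L y)" for x
    proof (rule ccontr)
      assume "\<not> ?thesis"
      moreover have "\<one> \<in> conj_set G (N \<inter> conj_set G L y) x \<inter> (N \<inter> conj_set G L y)"
        using x subgroup.one_closed[OF subgroup_conj_set[OF I, of x]] subgroup.one_closed[OF I] by simp
      ultimately obtain z where z: "z \<in> conj_set G (N \<inter> conj_set G L y) x" "z \<in> conj_set G L y" "z \<noteq> \<one>" by blast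
      have xc: "x \<in> carrier G" using x by auto
      have "z \<in> conj_set G (conj_set G L y) x" using z(1) conj_set_mono[of "N \<inter> conj_set G L y" "conj_set G L y" x] by auto
      then have z2: "z \<in> conj_set G L (y \<otimes> x)" using conj_set_mult[OF L.subset y(1) xc] by simp
      have zc: "z \<in> carrier G" using z(2) conj_set_subset[OF L.subset y(1)] by blast
      have 1: "cnj z (inv y) \<in> L" using z(2) zc y by (simp add: cnj_mem_iff L.subset)
      have "cnj z (inv (y \<otimes> x)) \<in> L" using z2 zc y xc by (simp add: cnj_mem_iff L.subset)
      then have 2: "cnj z (inv y) \<in> conj_set G L (y \<otimes> x \<otimes> inv y)"
        using zc y xc by (simp add: cnj_mem_iff L.subset cnj_cnj group_word_simps)
      have 3: "cnj z (inv y) \<noteq> \<one>" using z zc y by (simp add: cnj_eq_one_iff)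
      have "y \<otimes> x \<otimes> inv y \<in> L" using frob_mem[OF FL _ 1 2 3] y xc by auto
      then have "x \<in> conj_set G L y" using y xc by (simp add: cnj_mem_iff L.subset cnj_def)
      then show False using x by simp
    qed
    then show ?thesis using N y(2) proper[OF y(1)] I
      by (auto simp: frob_def)
  qed
  have fN: "finite N" using N finite_subgroup by blast
  have FBN: "frob B N"
    using FBy[of \<one>] L.subset bne by (simp add: B_def)
  have sub1: "conj_union M N \<subseteq> N - {\<one>}" if M: "M \<subseteq> N" for M
    using M by (auto simp: conj_union_def conj_set_image cnj_def subset_iff)
  \<comment> \<open>These intersections form one class under \<open>N\<close>. The conjugates of
    each cover at least \<open>|N|/2\<close> nontrivial elements, so two disjoint families would not
    fit into the \<open>|N| - 1\<close> available.\<close>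
  have one_class: "N \<inter> conj_union L (carrier G) \<subseteq> conj_union B N"
  proof (rule ccontr)
    assume "\<not> ?thesis"
    then obtain z y where z: "z \<in> N" "z \<noteq> \<one>" "y \<in> carrier G" "z \<in> conj_set G L y" "z \<notin> conj_union B N"
      by (auto simp: conj_union_def)
    define By where "By = N \<inter> conj_set G L y"
    have F: "frob By N" using FBy[OF z(3)] z by (auto simp: By_def)
    have disj: "conj_union B N \<inter> conj_union By N = {}"
    proof (rule ccontr)
      assume "\<not> ?thesis"
      then obtain u x x' where u: "u \<noteq> \<one>" "x \<in> N" "x' \<in> N" "u \<in> conj_set G B x" "u \<in> conj_set G By x'"
        by (auto simp: conj_union_def)
      have c: "x \<in> carrier G" "x' \<in> carrier G" using u by auto
      have "u \<in> conj_set G L x" using u(4) conj_set_mono[of B L x] by (auto simp: B_def)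
      moreover have "u \<in> conj_set G L (y \<otimes> x')"
        using u(5) conj_set_mono[of By "conj_set G L y" x'] conj_set_mult[OF L.subset z(3) c(2)] by (auto simp: By_def)
      moreover have uc: "u \<in> carrier G" using u(4) conj_set_subset[OF B.subset c(1)] by blast
      ultimately have 1: "cnj u (inv x) \<in> L" and "cnj u (inv (y \<otimes> x')) \<in> L"
        using c z(3) by (auto simp: cnj_mem_iff L.subset)
      then have 2: "cnj u (inv x) \<in> conj_set G L (y \<otimes> x' \<otimes> inv x)"
        using uc c z(3) by (simp add: cnj_mem_iff L.subset cnj_cnj group_word_simps)
      have 3: "cnj u (inv x) \<noteq> \<one>" using u uc c by (simp add: cnj_eq_one_iff)
      have g: "y \<otimes> x' \<otimes> inv x \<in> L" using frob_mem[OF FL _ 1 2 3] c z(3) by auto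
      define w where "w = x \<otimes> inv x'"
      have w: "w \<in> N" "w \<in> carrier G" using u by (auto simp: w_def)
      have "y = (y \<otimes> x' \<otimes> inv x) \<otimes> w" using c z(3) by (simp add: w_def group_word_simps)
      then have "conj_set G L y = conj_set G (conj_set G L (y \<otimes> x' \<otimes> inv x)) w"
        using conj_set_mult[OF L.subset, of "y \<otimes> x' \<otimes> inv x" w] c z(3) w by simp
      then have "conj_set G L y = conj_set G L w" using conj_set_self[OF L g] by simp
      then have "By = conj_set G N w \<inter> conj_set G L w" using conj_set_self[OF N w(1)] by (simp add: By_def)
      then have "By = conj_set G B w" using conj_set_Int[OF N.subset L.subset w(2)] by (simp add: B_def)
      then have "z \<in> conj_union B N" using z w by (auto simp: conj_union_def By_def)
      then show False using z by simp
    qed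
    have "card (conj_union B N) + card (conj_union By N) = card (conj_union B N \<union> conj_union By N)"
      using disj sub1[of B] sub1[of By] fN by (intro card_Un_disjoint[symmetric]) (auto simp: B_def By_def intro: finite_subset)
    also have "\<dots> \<le> card (N - {\<one>})"
      using sub1[of B] sub1[of By] fN by (intro card_mono) (auto simp: B_def By_def)
    also have "\<dots> < card N" by (rule card_Diff1_less[OF fN N.one_closed])
    finally show False
      using frob_card_conj_union[OF FBN] frob_card_conj_union[OF F] frob_index_le_half[OF FBN] frob_index_le_half[OF F]
      by linarith
  qed
  let ?G = "carrier G"
  have int: "conj_union N ?G \<inter> conj_union L ?G \<subseteq> conj_union B ?G"
  proof
    fix u assume "u \<in> conj_union N ?G \<inter> conj_union L ?G"
    then obtain x y where u: "u \<noteq> \<one>" "x \<in> ?G" "y \<in> ?G" "u \<in> conj_set G N x" "u \<in> conj_set G L y"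
      by (auto simp: conj_union_def)
    have uc: "u \<in> ?G" using u conj_set_subset[OF N.subset] by blast
    have 1: "cnj u (inv x) \<in> N" using u uc by (simp add: cnj_mem_iff N.subset)
    have "cnj u (inv y) \<in> L" using u uc by (simp add: cnj_mem_iff L.subset)
    then have "cnj u (inv x) \<in> conj_set G L (y \<otimes> inv x)"
      using u uc by (simp add: cnj_mem_iff L.subset cnj_cnj group_word_simps)
    moreover have "cnj u (inv x) \<noteq> \<one>" using u uc by (simp add: cnj_eq_one_iff)
    moreover have "y \<otimes> inv x \<in> carrier G" using u by simp
    ultimately have "cnj u (inv x) \<in> conj_union L ?G" unfolding conj_union_def by blast
    then have "cnj u (inv x) \<in> conj_union B N" using one_class 1 by blast
    then obtain w where w: "w \<in> N" "cnj u (inv x) \<in> conj_set G B w" by (auto simp: conj_union_def)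
    then have "u \<in> conj_set G B (w \<otimes> x)"
      using u uc by (simp add: cnj_mem_iff B.subset cnj_cnj group_word_simps)
    then show "u \<in> conj_union B ?G" using u w by (auto simp: conj_union_def)
  qed
  have cu: "conj_union M ?G \<subseteq> ?G - {\<one>}" if "M \<subseteq> ?G" for M
    using that by (auto simp: conj_union_def conj_set_image subset_iff)
  have f: "finite (conj_union M ?G)" if "M \<subseteq> ?G" for M using cu[OF that] finite_sub by blast
  have "card (conj_union N ?G) + card (conj_union L ?G)
      = card (conj_union N ?G \<union> conj_union L ?G) + card (conj_union N ?G \<inter> conj_union L ?G)"
    by (rule card_Un_Int) (use f N.subset L.subset in auto)
  also have "card (conj_union N ?G \<inter> conj_union L ?G) \<le> card (conj_union B ?G)"
    by (rule card_mono[OF f[OF B.subset] int])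
  also have "card (conj_union N ?G \<union> conj_union L ?G) \<le> card (?G - {\<one>})"
    using cu[OF N.subset] cu[OF L.subset] by (intro card_mono) auto
  also have "card (?G - {\<one>}) < card ?G" by (rule card_Diff1_less[OF fG one_closed])
  finally have ineq: "card (conj_union N ?G) + card (conj_union L ?G) < card ?G + card (conj_union B ?G)" by simp
  have half: "2 * (card ?G div card M) \<le> card ?G div card B" if M: "subgroup M G" "B \<subset> M" for M
  proof -
    obtain s where s: "card M = card B * s" using card_dvd[OF B M(1)] M(2) by (auto elim: dvdE)
    obtain i where i: "card ?G = card M * i" using card_dvd[OF M(1) subgroup_self] subgroup_subset[OF M(1)] by (auto elim: dvdE)
    have "card B < card M" using M finite_subgroup by (intro psubset_card_mono) auto
    then have "s \<noteq> 1" "s \<noteq> 0" using s by auto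
    then have "s \<ge> 2" by linarith
    moreover have "card ?G div card M = i" "card ?G div card B = s * i"
      using s i card_subgroup_pos[OF M(1)] card_subgroup_pos[OF B] by auto
    ultimately show ?thesis by simp
  qed
  have "B \<subset> N" "B \<subset> L" using nc by (auto simp: B_def)
  then show False
    using half[OF N] half[OF L] ineq frob_card_conj_union[OF FN] frob_card_conj_union[OF FL] frob_card_conj_union[OF FB]
    by linarith
qed

section \<open>Subnormal subgroups\<close>

text \<open>The group is an index of the inductive predicate, not a fixed parameter; the equation
  \<open>G' = G\<close> ties it to the locale during induction.\<close>

lemma subnormal_subgroup: "subnormal H G' \<Longrightarrow> G' = G \<Longrightarrow> subgroup H G"
  by (induction rule: subnormal.induct) (auto simp: subgroup_self)

lemma subnormal_normal:
  assumes "subnormal K G" "subgroup H G" "H \<subseteq> K" "K \<subseteq> nrm H"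
  shows "subnormal H G"
  using assms subnormal_subgroup[OF assms(1)] normal_iff_nrm[OF assms(2) _ assms(3)]
  by (intro subnormal_step[OF assms(1-3)]) auto

lemma subnormal_self_normalizing:
  "subnormal L G' \<Longrightarrow> G' = G \<Longrightarrow> nrm L \<subseteq> L \<Longrightarrow> L = carrier G"
proof (induction rule: subnormal.induct)
  case (subnormal_step K G' H)
  have K: "subgroup K G" using subnormal_subgroup subnormal_step by blast
  then have "K \<subseteq> nrm H" using normal_iff_nrm[of H K] subnormal_step by auto
  then have "K = H" using subnormal_step by auto
  then show ?case using subnormal_step by auto
qed simp

text \<open>The normalizer of a nontrivial subgroup of \<open>N\<close> stays in \<open>N\<close>,
  so a chain of normal inclusions starting inside \<open>N\<close> never leaves it and cannot reach
  \<open>G\<close>.\<close>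

lemma frob_not_subnormal:
  assumes F: "frob N (carrier G)"
  shows "subnormal H G' \<Longrightarrow> G' = G \<Longrightarrow> H \<subseteq> N \<Longrightarrow> H = {\<one>}"
proof (induction rule: subnormal.induct)
  case (subnormal_top G')
  then show ?case using F by (auto simp: frob_def)
next
  case (subnormal_step K G' H)
  show ?case
  proof (rule ccontr)
    assume ne: "H \<noteq> {\<one>}"
    have K: "subgroup K G" using subnormal_subgroup subnormal_step by blast
    have H: "subgroup H G" using subnormal_step by auto
    have KH: "K \<subseteq> nrm H" using normal_iff_nrm[of H K] subnormal_step K by auto
    obtain z where "z \<in> H" "z \<noteq> \<one>" using ne subgroup.one_closed[OF H] by blast
    then have "nrm H \<subseteq> N" using frob_nrm[OF F subnormal_step.prems(2)] nrm_subset by blast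
    then have "K = {\<one>}" using KH subnormal_step by auto
    then show False using ne subnormal_step.hyps(3) subgroup.one_closed[OF H] by blast
  qed
qed

end

section \<open>Fixed-point-free action\<close>

lemma (in comm_monoid) finprod_swap_atMost:
  fixes m n :: nat
  assumes "\<And>i j. f i j \<in> carrier G"
  shows "(\<Otimes>i\<in>{..m}. \<Otimes>j\<in>{..n}. f i j) = (\<Otimes>j\<in>{..n}. \<Otimes>i\<in>{..m}. f i j)"
proof (induction m)
  case (Suc m)
  have "(\<Otimes>i\<in>{..Suc m}. \<Otimes>j\<in>{..n}. f i j) = (\<Otimes>j\<in>{..n}. f (Suc m) j) \<otimes> (\<Otimes>j\<in>{..n}. \<Otimes>i\<in>{..m}. f i j)"
    using assms by (subst finprod_Suc) (auto simp: Suc)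
  also have "\<dots> = (\<Otimes>j\<in>{..n}. f (Suc m) j \<otimes> (\<Otimes>i\<in>{..m}. f i j))"
    using assms by (subst finprod_multf) auto
  also have "\<dots> = (\<Otimes>j\<in>{..n}. \<Otimes>i\<in>{..Suc m}. f i j)"
    using assms by (intro finprod_cong') auto
  finally show ?case .
qed (use assms in \<open>simp add: finprod_0\<close>)

context fin_group
begin

text \<open>For \<open>t \<in> T\<close> the products of the conjugates of \<open>t\<close> over \<open>\<langle>u v\<^sup>j\<rangle>\<close> and over \<open>\<langle>v\<^sup>i\<rangle>\<close> are fixed
  points, hence trivial; multiplying up the former over all \<open>j\<close> leaves \<open>t ^ q\<close>.\<close>

lemma fixed_point_free_pow_eq_one:
  assumes T: "subgroup T G" and comm: "\<And>s t. s \<in> T \<Longrightarrow> t \<in> T \<Longrightarrow> s \<otimes> t = t \<otimes> s"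
    and q: "q \<ge> 2" and uv: "u \<in> nrm T" "v \<in> nrm T" "u \<otimes> v = v \<otimes> u" "u [^] q = \<one>" "v [^] (q::nat) = \<one>"
    and fpf1: "\<And>j t. t \<in> T \<Longrightarrow> cnj t (u \<otimes> v [^] (j::nat)) = t \<Longrightarrow> t = \<one>"
    and fpf2: "\<And>i t. 0 < i \<Longrightarrow> i < q \<Longrightarrow> t \<in> T \<Longrightarrow> cnj t (v [^] (i::nat)) = t \<Longrightarrow> t = \<one>"
    and t: "t \<in> T"
  shows "t [^] q = \<one>"
proof -
  interpret T: subgroup T G by fact
  define A where "A = G\<lparr>carrier := T\<rparr>"
  have "group A" unfolding A_def by (rule subgroup_imp_group[OF T])
  then interpret A: comm_group A
    by (rule group.group_comm_groupI) (use comm in \<open>simp add: A_def\<close>)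
  have A_simps [simp]: "carrier A = T" "x \<otimes>\<^bsub>A\<^esub> y = x \<otimes> y" "\<one>\<^bsub>A\<^esub> = \<one>" for x y
    by (simp_all add: A_def)
  have nT: "subgroup (nrm T) G" by (simp add: T.subset)
  have uvc: "u \<in> carrier G" "v \<in> carrier G" using uv nrm_subset by blast+
  \<comment> \<open>The exponents 0 to \<open>q - 1\<close> become \<open>{..Suc m}\<close>, from
    which a factor can be split off at either end.\<close>
  define m where "m = q - 2"
  have m: "q = Suc (Suc m)" using q by (simp add: m_def)
  have cT: "cnj s w \<in> T" if "s \<in> T" "w \<in> nrm T" for s w using nrm_cnj that by blast
  have powT: "w [^] (i::nat) \<in> nrm T" if "w \<in> nrm T" for w i
    by (rule subgroup_nat_pow_closed[OF nT that])
  have cnj_prod: "cnj (\<Otimes>\<^bsub>A\<^esub>i\<in>{..n}. f i) w = (\<Otimes>\<^bsub>A\<^esub>i\<in>{..n}. cnj (f i) w)"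
    if f: "\<And>i. f i \<in> T" and w: "w \<in> nrm T" for f w and n :: nat
  proof (induction n)
    case 0
    show ?case using f cT[OF f w] by (simp add: A.finprod_0)
  next
    case (Suc n)
    have wc: "w \<in> carrier G" using w nrm_subset by blast
    have P: "(\<Otimes>\<^bsub>A\<^esub>i\<in>{..n}. f i) \<in> T" using A.finprod_closed[of f "{..n}"] f by auto
    have "cnj (\<Otimes>\<^bsub>A\<^esub>i\<in>{..Suc n}. f i) w = cnj (f (Suc n) \<otimes> (\<Otimes>\<^bsub>A\<^esub>i\<in>{..n}. f i)) w"
      using f by (subst A.finprod_Suc) auto
    also have "\<dots> = cnj (f (Suc n)) w \<otimes> (\<Otimes>\<^bsub>A\<^esub>i\<in>{..n}. cnj (f i) w)"
      using wc P f by (simp add: cnj_mult Suc)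
    also have "\<dots> = (\<Otimes>\<^bsub>A\<^esub>i\<in>{..Suc n}. cnj (f i) w)"
      using cT[OF f w] by (subst A.finprod_Suc) auto
    finally show ?case .
  qed
  \<comment> \<open>Since \<open>w [^] q = \<one>\<close>, conjugation by \<open>w\<close> permutes
    the factors cyclically and fixes their product.\<close>
  have norm: "(\<Otimes>\<^bsub>A\<^esub>i\<in>{..Suc m}. cnj s (w [^] i)) = \<one>"
    if s: "s \<in> T" and w: "w \<in> nrm T" "w [^] q = \<one>" and fpf: "\<And>t. t \<in> T \<Longrightarrow> cnj t w = t \<Longrightarrow> t = \<one>" for s w
  proof (rule fpf)
    have wc: "w \<in> carrier G" using w nrm_subset by blast
    define f where "f = (\<lambda>i::nat. cnj s (w [^] i))"
    have fT: "f i \<in> T" for i unfolding f_def using cT powT s w by blast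
    have f_Suc: "cnj (f i) w = f (Suc i)" for i using s wc by (simp add: f_def cnj_cnj)
    have P: "(\<Otimes>\<^bsub>A\<^esub>i\<in>{..Suc m}. f i) \<in> T" using A.finprod_closed[of f "{..Suc m}"] fT by auto
    have f0: "f (Suc (Suc m)) = f 0" using s w m by (simp add: f_def)
    have "cnj (\<Otimes>\<^bsub>A\<^esub>i\<in>{..Suc m}. f i) w = (\<Otimes>\<^bsub>A\<^esub>i\<in>{..Suc m}. f (Suc i))"
      using cnj_prod[of f w "Suc m", OF fT w(1)] unfolding f_Suc .
    also have "\<dots> = f (Suc (Suc m)) \<otimes> (\<Otimes>\<^bsub>A\<^esub>i\<in>{..m}. f (Suc i))"
      using fT by (subst A.finprod_Suc) auto
    also have "\<dots> = (\<Otimes>\<^bsub>A\<^esub>i\<in>{..m}. f (Suc i)) \<otimes> f 0"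
      unfolding f0 using fT A.finprod_closed[of "\<lambda>i. f (Suc i)" "{..m}"] by (intro comm) auto
    also have "\<dots> = (\<Otimes>\<^bsub>A\<^esub>i\<in>{..Suc m}. f i)"
      using A.finprod_Suc2[of f m] fT by auto
    finally show "cnj (\<Otimes>\<^bsub>A\<^esub>i\<in>{..Suc m}. cnj s (w [^] i)) w = (\<Otimes>\<^bsub>A\<^esub>i\<in>{..Suc m}. cnj s (w [^] i))"
      by (simp add: f_def)
    show "(\<Otimes>\<^bsub>A\<^esub>i\<in>{..Suc m}. cnj s (w [^] i)) \<in> T" using P by (simp add: f_def)
  qed
  define F where "F = (\<lambda>j i. cnj t ((u \<otimes> v [^] (j::nat)) [^] (i::nat)))"
  have uvj: "u \<otimes> v [^] (j::nat) \<in> nrm T" for j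
    using subgroup.m_closed[OF nT uv(1) powT[OF uv(2)]] .
  have FT: "F j i \<in> T" for j i unfolding F_def using cT[OF t powT[OF uvj]] .
  have uvj_comm: "u \<otimes> v [^] (j::nat) = v [^] j \<otimes> u" for j
    using group_commutes_pow[of v u j] uv uvc by simp
  have pw: "(u \<otimes> v [^] (j::nat)) [^] (i::nat) = u [^] i \<otimes> (v [^] i) [^] j" for i j
    using pow_mult_distrib[OF uvj_comm, of j i] uvc by (simp add: nat_pow_pow mult.commute)
  have pvq: "(v [^] (j::nat)) [^] q = \<one>" for j
    using uvc uv by (metis mult.commute nat_pow_one nat_pow_pow)
  have rows: "(\<Otimes>\<^bsub>A\<^esub>i\<in>{..Suc m}. F j i) = \<one>" for j
    unfolding F_def
  proof (rule norm[OF t uvj])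
    show "(u \<otimes> v [^] j) [^] q = \<one>"
      using pow_mult_distrib[OF uvj_comm, of j q] uvc uv pvq[of j] by simp
  qed (rule fpf1)
  \<comment> \<open>For a fixed nonzero exponent of \<open>u\<close>, running over \<open>j\<close>
    gives the same kind of product for a nontrivial power of \<open>v\<close>. Only the column of
    exponent 0 survives, and it consists of \<open>q\<close> copies of \<open>t\<close>.\<close>
  have cols: "(\<Otimes>\<^bsub>A\<^esub>j\<in>{..Suc m}. F j (Suc i)) = \<one>" if i: "i \<le> m" for i
  proof -
    have tu: "cnj t (u [^] Suc i) \<in> T" using cT[OF t powT[OF uv(1)]] .
    have "(\<Otimes>\<^bsub>A\<^esub>j\<in>{..Suc m}. cnj (cnj t (u [^] Suc i)) ((v [^] Suc i) [^] j)) = \<one>"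
    proof (rule norm[OF tu powT[OF uv(2)] pvq])
      show "s = \<one>" if "s \<in> T" "cnj s (v [^] Suc i) = s" for s
        using fpf2[of "Suc i" s] that i m by simp
    qed
    moreover have "cnj (cnj t (u [^] Suc i)) ((v [^] Suc i) [^] j) = F j (Suc i)" for j
      unfolding F_def pw using t uvc by (intro cnj_cnj) auto
    ultimately show ?thesis by simp
  qed
  have "\<one> = (\<Otimes>\<^bsub>A\<^esub>j\<in>{..Suc m}. \<Otimes>\<^bsub>A\<^esub>i\<in>{..Suc m}. F j i)"
    unfolding rows using A.finprod_one[of "{..Suc m}"] unfolding A_simps by (rule sym)
  also have "\<dots> = (\<Otimes>\<^bsub>A\<^esub>i\<in>{..Suc m}. \<Otimes>\<^bsub>A\<^esub>j\<in>{..Suc m}. F j i)"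
    by (rule A.finprod_swap_atMost) (use FT in simp)
  also have "\<dots> = (\<Otimes>\<^bsub>A\<^esub>i\<in>{..m}. \<Otimes>\<^bsub>A\<^esub>j\<in>{..Suc m}. F j (Suc i)) \<otimes> (\<Otimes>\<^bsub>A\<^esub>j\<in>{..Suc m}. F j 0)"
    using A.finprod_Suc2[of "\<lambda>i. \<Otimes>\<^bsub>A\<^esub>j\<in>{..Suc m}. F j i" m] A.finprod_closed[of "\<lambda>j. F j _" "{..Suc m}"] FT
    by (simp add: Pi_def)
  also have "(\<Otimes>\<^bsub>A\<^esub>i\<in>{..m}. \<Otimes>\<^bsub>A\<^esub>j\<in>{..Suc m}. F j (Suc i)) = \<one>"
    using A.finprod_one_eqI[of "{..m}"] cols by simp
  also have "(\<Otimes>\<^bsub>A\<^esub>j\<in>{..Suc m}. F j 0) = (\<Otimes>\<^bsub>A\<^esub>j\<in>{..Suc m}. t)"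
    using t by (simp add: F_def)
  also have "\<dots> = t [^]\<^bsub>A\<^esub> card {..Suc m}" using A.finprod_const[of t "{..Suc m}"] t by simp
  also have "\<dots> = t [^] q" unfolding A_def nat_pow_consistent[of t _ T, symmetric] using m by simp
  finally show ?thesis using t by simp
qed

text \<open>An element of \<open>Z(T)\<close> fixed by a nontrivial element of \<open>N\<close> lies
  in \<open>N\<close>, hence is trivial by coprimality. If \<open>u\<close> were not in the group
  generated by \<open>v\<close>, averaging would give every element of \<open>Z(T)\<close> order
  dividing \<open>q\<close>; but these orders are powers of \<open>r\<close>, and \<open>q\<close>
  divides \<open>|N|\<close> while \<open>r\<close> does not.\<close>

lemma frob_no_rank_two:
  assumes F: "frob N (carrier G)" and r: "Factorial_Ring.prime (r::nat)" "\<not> r dvd card N"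
    and T: "subgroup T G" "card T = r ^ k" "T \<noteq> {\<one>}" "N \<subseteq> nrm T"
    and q: "Factorial_Ring.prime (q::nat)"
    and uv: "u \<in> N" "v \<in> N" "u \<otimes> v = v \<otimes> u" "u [^] q = \<one>" "v [^] q = \<one>" "v \<noteq> \<one>"
  shows "\<exists>j::nat. u \<otimes> v [^] j = \<one>"
proof (rule ccontr)
  assume nj: "\<not> ?thesis"
  have N: "subgroup N G" using F by (simp add: frob_def)
  interpret N: subgroup N G by (rule N)
  interpret T: subgroup T G by (rule T(1))
  define Z where "Z = T \<inter> centralizer G T"
  have Z: "subgroup Z G" unfolding Z_def using subgroups_Inter_pair[OF T(1) subgroup_centralizer[OF T.subset]] .
  have "Z \<noteq> {\<one>}" unfolding Z_def by (rule pgroup_center_nontrivial[OF r(1) T(1-3)])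
  then obtain t where t: "t \<in> Z" "t \<noteq> \<one>" using subgroup.one_closed[OF Z] by blast
  have NZ: "N \<subseteq> nrm Z"
    using nrm_Int[OF T.subset centralizer_subset, of T] centralizer_nrm[OF T.subset] T(4) unfolding Z_def by blast
  have vc: "v \<in> carrier G" using uv by simp
  have "ord v dvd q" using uv vc by (simp add: pow_eq_id)
  then have ov: "ord v = q" using q uv vc ord_eq_1[OF vc] prime_nat_iff by blast
  have TN: "x = \<one>" if x: "x \<in> T" "x \<in> N" for x
  proof -
    have I: "subgroup (T \<inter> N) G" using subgroups_Inter_pair[OF T(1) N] .
    have "card (T \<inter> N) dvd r ^ k" using card_dvd[OF I T(1)] T(2) by simp
    then obtain i where i: "card (T \<inter> N) = r ^ i" using divides_primepow_nat[OF r(1)] by blast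
    have "i = 0"
    proof (rule ccontr)
      assume "i \<noteq> 0"
      then have "r dvd card (T \<inter> N)" using i by simp
      then show False using card_dvd[OF I N] r(2) dvd_trans by blast
    qed
    then have "T \<inter> N = {\<one>}" using i subgroup_nontrivial[OF I] by auto
    then show ?thesis using x by blast
  qed
  have fpf: "s = \<one>" if s: "s \<in> Z" and w: "w \<in> N" "w \<noteq> \<one>" and e: "cnj s w = s" for s w
  proof -
    have sT: "s \<in> T" "s \<in> carrier G" using s by (auto simp: Z_def)
    have "s \<otimes> w = w \<otimes> s" using e sT w by (simp add: cnj_eq_iff)
    then have "s \<in> N" using frob_centralizer[OF F w sT(2)] by blast
    then show ?thesis using TN sT by blast
  qed
  have Npow: "w [^] (n::nat) \<in> N" if "w \<in> N" for w n by (rule subgroup_nat_pow_closed[OF N that])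
  have "t [^] q = \<one>"
  proof (rule fixed_point_free_pow_eq_one[OF Z])
    show "s \<otimes> t = t \<otimes> s" if "s \<in> Z" "t \<in> Z" for s t
      using that unfolding Z_def centralizer_def by blast
    show "q \<ge> 2" using q by (rule prime_ge_2_nat)
    show "u \<in> nrm Z" "v \<in> nrm Z" using uv NZ by auto
    show "s = \<one>" if "s \<in> Z" "cnj s (u \<otimes> v [^] j) = s" for j :: nat and s
      using fpf[OF that(1) _ _ that(2)] nj N.m_closed[OF uv(1) Npow[OF uv(2)]] by blast
    show "s = \<one>" if i: "0 < i" "i < q" and s: "s \<in> Z" "cnj s (v [^] i) = s" for i :: nat and s
    proof -
      have "v [^] i \<noteq> \<one>" using i ov vc by (auto simp: pow_eq_id dest: dvd_imp_le)
      then show ?thesis using fpf s uv Npow by blast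
    qed
  qed (use uv t in auto)
  then have 1: "ord t dvd q" using t subgroup_mem[OF Z] by (simp add: pow_eq_id)
  have "t \<in> T" using t by (simp add: Z_def)
  then have "generate G {t} \<subseteq> T" by (intro generate_subgroup_incl T(1)) simp
  then have "card (generate G {t}) dvd card T" using T(1) t subgroup_mem[OF Z]
    by (intro card_dvd generate_is_subgroup) auto
  then have 2: "ord t dvd r ^ k" using T(2) generate_pow_card[of t] t subgroup_mem[OF Z] by simp
  have "generate G {v} \<subseteq> N" using uv by (intro generate_subgroup_incl N) simp
  then have "card (generate G {v}) dvd card N" using N vc by (intro card_dvd generate_is_subgroup) auto
  then have "q dvd card N" using ov generate_pow_card[OF vc] by simp
  then have "q \<noteq> r" using r by blast
  then have "coprime q (r ^ k)" using q r(1) primes_coprime by auto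
  then have "ord t = 1" using 1 2 coprime_common_divisor_nat by blast
  then show False using t subgroup_mem[OF Z] ord_eq_1[of t] by simp
qed

text \<open>Excludes a subgroup C_q x C_q: of two commuting elements killed by \<open>q\<close>, the
  first lies in the cyclic group generated by the second, if that one is nontrivial.\<close>

definition rank_one :: "nat \<Rightarrow> 'a set \<Rightarrow> bool" where
  "rank_one q N \<longleftrightarrow> (\<forall>u\<in>N. \<forall>v\<in>N. u \<otimes> v = v \<otimes> u \<longrightarrow> u [^] q = \<one> \<longrightarrow> v [^] q = \<one> \<longrightarrow> v \<noteq> \<one> \<longrightarrow>
     (\<exists>j::nat. u \<otimes> v [^] j = \<one>))"

text \<open>Otherwise some power \<open>z\<close> of \<open>y\<close> is outside the cyclic group of
  \<open>x\<close> while \<open>z [^] q = x [^] j\<close> is inside. The larger order of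
  \<open>x\<close> forces \<open>q\<close> to divide \<open>j\<close>, so dividing \<open>z\<close>
  by a suitable power of \<open>x\<close> gives an element \<open>u\<close> killed by
  \<open>q\<close>. Rank one puts \<open>u\<close> among the powers of \<open>x\<close>, and then
  \<open>z\<close> too.\<close>

lemma rank_one_cyclic_aux:
  assumes N: "subgroup N G" and q: "Factorial_Ring.prime (q::nat)" and ro: "rank_one q N"
    and xy: "x \<in> N" "y \<in> N" "x \<otimes> y = y \<otimes> x" and ox: "ord x = q ^ e" and oy: "ord y = q ^ d" and de: "d \<le> e"
  shows "y \<in> generate G {x}"
proof (rule ccontr)
  assume ny: "y \<notin> generate G {x}"
  interpret N: subgroup N G by (rule N)
  have c: "x \<in> carrier G" "y \<in> carrier G" using xy by auto
  let ?X = "generate G {x}"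
  have X: "subgroup ?X G" using c by (intro generate_is_subgroup) simp
  interpret X: subgroup ?X G by (rule X)
  have xX: "x \<in> ?X" by (simp add: generate.incl)
  have X_pow: "?X = {x [^] k | k::nat. True}" using generate_pow_on_finite_carrier[OF fin c(1)] by simp
  define P where "P k \<longleftrightarrow> y [^] (q ^ k) \<in> ?X" for k
  have "y [^] (q ^ d) = \<one>" using oy c by (simp add: pow_eq_id)
  then have "P d" unfolding P_def using X.one_closed by simp
  then obtain k where k: "P k" "\<And>l. l < k \<Longrightarrow> \<not> P l" using exists_least_iff[of P] by blast
  have "\<not> P 0" unfolding P_def using ny c by simp
  then obtain l where l: "k = Suc l" using k by (cases k) auto
  define z where "z = y [^] (q ^ l)"
  have z: "z \<notin> ?X" "z \<in> carrier G" "z \<in> N" using k(2)[of l] l c xy subgroup_nat_pow_closed[OF N]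
    by (auto simp: z_def P_def)
  have "z [^] q = y [^] (q ^ k)" using c l by (simp add: z_def nat_pow_pow mult.commute)
  then have "z [^] q \<in> ?X" using k(1) by (simp add: P_def)
  then obtain j :: nat where j: "z [^] q = x [^] j" using X_pow by auto
  have "e \<noteq> 0"
  proof
    assume "e = 0"
    then have "ord y = 1" using de oy by simp
    then have "y = \<one>" using ord_eq_1[OF c(2)] by simp
    then show False using ny X.one_closed by simp
  qed
  then obtain e' where e': "e = Suc e'" by (cases e) auto
  have "ord y dvd q ^ l * q ^ e" using oy de by (simp add: le_imp_power_dvd dvd_mult)
  then have "z [^] (q ^ e) = \<one>" using c by (simp add: z_def nat_pow_pow pow_eq_id)
  moreover have "z [^] (q ^ e) = (z [^] q) [^] (q ^ e')" using z by (simp add: nat_pow_pow e')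
  ultimately have "x [^] (j * q ^ e') = \<one>" using c by (simp add: j nat_pow_pow)
  then have "q * q ^ e' dvd j * q ^ e'" using ox e' c by (simp add: pow_eq_id)
  then have "q dvd j" using q prime_gt_0_nat[OF q] by simp
  then obtain i where i: "j = i * q" unfolding dvd_def by (metis mult.commute)
  define w where "w = inv (x [^] i)"
  have w: "w \<in> carrier G" "w \<in> ?X" "w \<in> N"
    using c xX xy subgroup_nat_pow_closed[OF X] subgroup_nat_pow_closed[OF N] by (auto simp: w_def)
  define v where "v = x [^] (q ^ e')"
  have v: "v \<in> carrier G" "v \<in> N" "v \<in> ?X"
    using c xX xy subgroup_nat_pow_closed[OF X] subgroup_nat_pow_closed[OF N] by (auto simp: v_def)
  have cent: "s \<otimes> y [^] (n::nat) = y [^] n \<otimes> s" if s: "s \<in> ?X" for s n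
  proof -
    obtain a :: nat where a: "s = x [^] a" using s X_pow by auto
    have "x [^] a \<otimes> y = y \<otimes> x [^] a" using group_commutes_pow[OF xy(3) c, of a] .
    then show ?thesis using group_commutes_pow[of y "x [^] a" n] c a by simp
  qed
  have Xcomm: "s \<otimes> s' = s' \<otimes> s" if s: "s \<in> ?X" "s' \<in> ?X" for s s'
  proof -
    obtain a b :: nat where "s = x [^] a" "s' = x [^] b" using s X_pow by blast
    then show ?thesis using c by (simp add: nat_pow_mult add.commute)
  qed
  define u where "u = z \<otimes> w"
  have wz: "w \<otimes> z = z \<otimes> w" using cent[OF w(2)] by (simp add: z_def)
  have u: "u \<in> N" using z w by (simp add: u_def)
  have "u [^] q = z [^] q \<otimes> w [^] q" unfolding u_def using wz z w by (intro pow_mult_distrib) auto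
  also have "w [^] q = inv (x [^] j)" using c by (simp add: w_def nat_pow_inv nat_pow_pow i)
  finally have uq: "u [^] q = \<one>" using c by (simp add: j)
  have vq: "v [^] q = \<one>" using c ox e' by (simp add: v_def nat_pow_pow pow_eq_id mult.commute)
  have "v \<noteq> \<one>"
  proof
    assume "v = \<one>"
    then have "q * q ^ e' dvd q ^ e'" using ox e' c by (simp add: v_def pow_eq_id)
    then show False using prime_gt_1_nat[OF q] by (auto dest: dvd_imp_le)
  qed
  have "u \<otimes> v = z \<otimes> (w \<otimes> v)" using z w v by (simp add: u_def m_assoc)
  also have "w \<otimes> v = v \<otimes> w" using Xcomm w v by blast
  also have "z \<otimes> (v \<otimes> w) = (z \<otimes> v) \<otimes> w" using z w v by (simp add: m_assoc)
  also have "z \<otimes> v = v \<otimes> z" using cent[OF v(3)] by (simp add: z_def)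
  finally have "u \<otimes> v = v \<otimes> u" using z w v by (simp add: u_def m_assoc)
  then obtain n :: nat where n: "u \<otimes> v [^] n = \<one>"
    using ro u v uq vq \<open>v \<noteq> \<one>\<close> unfolding rank_one_def by blast
  have "w \<otimes> v [^] n \<in> ?X" using w v subgroup_nat_pow_closed[OF X] by auto
  then have "inv (w \<otimes> v [^] n) \<in> ?X" by blast
  moreover have "z \<otimes> (w \<otimes> v [^] n) = \<one>" using n z w v by (simp add: u_def m_assoc)
  then have "z = inv (w \<otimes> v [^] n)" using z w v by (metis inv_equality m_closed nat_pow_closed)
  ultimately show False using z by simp
qed

lemma rank_one_cyclic:
  assumes N: "subgroup N G" and q: "Factorial_Ring.prime (q::nat)" and ro: "rank_one q N"
    and xy: "x \<in> N" "y \<in> N" "x \<otimes> y = y \<otimes> x" and ox: "x [^] (q ^ a) = \<one>" and oy: "y [^] (q ^ b) = \<one>"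
  shows "y \<in> generate G {x} \<or> x \<in> generate G {y}"
proof -
  have c: "x \<in> carrier G" "y \<in> carrier G" using xy subgroup_mem[OF N] by auto
  obtain e d where ed: "ord x = q ^ e" "ord y = q ^ d"
    using ox oy c divides_primepow_nat[OF q] by (auto simp: pow_eq_id)
  show ?thesis
    using rank_one_cyclic_aux[OF N q ro xy ed] rank_one_cyclic_aux[OF N q ro xy(2,1) xy(3)[symmetric] ed(2,1)]
    by (cases "d \<le> e") auto
qed

text \<open>A conjugate of a \<open>q\<close>-element \<open>h \<in> H\<close> under \<open>N\<close> is a product of commuting \<open>q\<close>-elements
  \<open>h\<^sub>2 \<in> H\<close> and \<open>a \<in> A\<close>; if \<open>a \<notin> H\<close>, then everything happens in the cyclic group \<open>\<langle>a\<rangle>\<close>, which has only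
  one subgroup of each order.\<close>

lemma rank_one_normalizes_factor:
  assumes N: "subgroup N G" and ro: "\<And>q. Factorial_Ring.prime q \<Longrightarrow> rank_one q N"
    and H: "subgroup H G" "H \<subseteq> N" and A: "subgroup A G" "A \<subseteq> N" "A \<subseteq> centralizer G H"
    and norm: "N \<subseteq> nrm (H <#> A)"
  shows "N \<subseteq> nrm H"
proof
  fix g assume g: "g \<in> N"
  interpret N: subgroup N G by (rule N)
  interpret H: subgroup H G by (rule H(1))
  interpret A: subgroup A G by (rule A(1))
  have gc: "g \<in> carrier G" using g by simp
  have comm: "a \<otimes> h = h \<otimes> a" if "a \<in> A" "h \<in> H" for a h using that A(3) by (auto simp: centralizer_def)
  have HHA: "H \<subseteq> H <#> A" using subgroup_set_mult[OF H(1) A(1)] A(3) centralizer_le_nrm[OF H.subset] by blast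
  \<comment> \<open>To get \<open>B = H\<close> it is enough that \<open>B\<close> contains a Sylow
    q-subgroup of \<open>H\<close> for each \<open>q\<close>, so only elements of prime power order
    have to be moved by \<open>g\<close>.\<close>
  define B where "B = H \<inter> conj_set G H (inv g)"
  have B: "subgroup B G" unfolding B_def using subgroups_Inter_pair[OF H(1) subgroup_conj_set[OF H(1)]] gc by simp
  have gen_le: "generate G {x} \<subseteq> W" if "subgroup W G" "x \<in> W" for x W
    using that by (intro generate_subgroup_incl) auto
  have key: "cnj h g \<in> H" if q: "Factorial_Ring.prime (q::nat)" and h: "h \<in> H" "h [^] (q ^ m) = \<one>" for q h m
  proof -
    define h' where "h' = cnj h g"
    have hc: "h \<in> carrier G" "h' \<in> carrier G" using h gc by (auto simp: h'_def)
    have h'N: "h' \<in> N" using h H(2) g by (auto simp: h'_def cnj_def)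
    have h'q: "h' [^] (q ^ m) = \<one>" using cnj_pow[of h g "q ^ m"] h gc by (simp add: h'_def)
    have "h' \<in> H <#> A" unfolding h'_def using nrm_cnj[of g "H <#> A" h] g norm h HHA by blast
    then obtain h1 a where ha: "h1 \<in> H" "a \<in> A" "h' = h1 \<otimes> a" unfolding set_mult_def by blast
    have n0: "card (carrier G) \<noteq> 0" using one_closed by auto
    \<comment> \<open>\<open>c\<close> is the part of \<open>|G|\<close> prime to \<open>q\<close>,
      and \<open>k\<close> inverts it modulo \<open>q ^ m\<close>. Raising to the power
      \<open>c * k\<close> fixes the q-element \<open>h'\<close> and turns both of its factors into
      q-elements.\<close>
    obtain c where c: "card (carrier G) = q ^ multiplicity q (card (carrier G)) * c" "\<not> q dvd c"
      using multiplicity_decompose'[OF n0, of q] not_prime_unit[of q] q by metis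
    define s where "s = multiplicity q (card (carrier G))"
    have "coprime c (q ^ m)" using prime_imp_coprime[OF q c(2)] by (simp add: coprime_commute)
    moreover have "c \<noteq> 0" using c(2) by (metis dvd_0_right)
    ultimately obtain k y where k: "c * k = q ^ m * y + 1"
      using bezout_nat[of c "q ^ m"] by auto
    have "h' [^] (c * k) = (h' [^] (q ^ m)) [^] y \<otimes> h'"
      using hc unfolding k by (simp add: nat_pow_pow)
    then have "h' [^] (c * k) = h'" using hc h'q by simp
    define h2 where "h2 = h1 [^] (c * k)"
    define a2 where "a2 = a [^] (c * k)"
    have h2: "h2 \<in> H" "h2 \<in> N" "h2 \<in> carrier G" and a2: "a2 \<in> A" "a2 \<in> N" "a2 \<in> carrier G"
      using ha subgroup_nat_pow_closed[OF H(1)] subgroup_nat_pow_closed[OF A(1)] H(2) A(2) by (auto simp: h2_def a2_def)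
    have "h1 \<otimes> a = a \<otimes> h1" by (rule comm[OF ha(2,1), symmetric])
    then have "h' [^] (c * k) = h2 \<otimes> a2" unfolding h2_def a2_def ha(3) using ha by (intro pow_mult_distrib) auto
    then have h'2: "h' = h2 \<otimes> a2" using \<open>h' [^] (c * k) = h'\<close> by simp
    have qs: "(x [^] (c * k)) [^] (q ^ s) = \<one>" if x: "x \<in> carrier G" for x
    proof -
      have "(x [^] (c * k)) [^] (q ^ s) = x [^] (card (carrier G) * k)"
      proof -
        have e: "c * k * q ^ s = card (carrier G) * k" using c(1) unfolding s_def[symmetric] by simp
        show ?thesis unfolding e[symmetric] by (rule nat_pow_pow[OF x])
      qed
      also have "\<dots> = (x [^] card (carrier G)) [^] k" using x by (simp add: nat_pow_pow)
      finally show ?thesis using pow_order_eq_1[OF x] by (simp add: order_def)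
    qed
    have h2q: "h2 [^] (q ^ s) = \<one>" and a2q: "a2 [^] (q ^ s) = \<one>" using qs ha by (auto simp: h2_def a2_def)
    have "h' \<in> H"
    proof (cases "a2 \<in> H")
      case True
      then show ?thesis using h'2 h2 by simp
    next
      case False
      \<comment> \<open>Of the two alternatives of \<open>rank_one_cyclic\<close>, the other one
        would put \<open>a2\<close> into \<open>H\<close>. The same reasoning applies to
        \<open>h\<close> below.\<close>
      have "h2 \<in> generate G {a2}"
        using rank_one_cyclic[OF N q ro[OF q] h2(2) a2(2) _ h2q a2q] comm[OF a2(1) h2(1)] False gen_le[OF H(1) h2(1)] by auto
      moreover have a2gen: "subgroup (generate G {a2}) G" "a2 \<in> generate G {a2}"
        using a2 by (auto intro: generate_is_subgroup generate.incl)
      ultimately have h'gen: "h' \<in> generate G {a2}" using h'2 subgroup.m_closed[OF a2gen(1)] by simp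
      have hN: "h \<in> N" using h H(2) by blast
      have hgen: "h \<in> generate G {a2}"
        using rank_one_cyclic[OF N q ro[OF q] hN a2(2) _ h(2) a2q] comm[OF a2(1) h(1)] False gen_le[OF H(1) h(1)] by auto
      have hh': "h \<otimes> h' = h' \<otimes> h"
      proof -
        obtain i j :: nat where "h = a2 [^] i" "h' = a2 [^] j"
          using hgen h'gen generate_pow_on_finite_carrier[OF fin a2(3)] by blast
        then show ?thesis using a2 by (simp add: nat_pow_mult add.commute)
      qed
      have ordeq: "ord h' = ord h"
        unfolding ord_unique[OF hc(2)] using hc gc
        by (simp add: h'_def cnj_pow[symmetric] cnj_eq_one_iff pow_eq_id)
      have gsub: "subgroup (generate G {h}) G" "subgroup (generate G {h'}) G"
        using hc by (auto intro: generate_is_subgroup)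
      have "h' \<in> generate G {h}"
        using rank_one_cyclic[OF N q ro[OF q] hN h'N hh' h(2) h'q]
      proof
        assume "h \<in> generate G {h'}"
        then have "generate G {h} \<subseteq> generate G {h'}" using gen_le gsub by blast
        moreover have "card (generate G {h}) = card (generate G {h'})"
          using ordeq generate_pow_card[OF hc(1)] generate_pow_card[OF hc(2)] by simp
        ultimately have "generate G {h} = generate G {h'}" using finite_subgroup[OF gsub(2)] by (intro card_subset_eq)
        then show ?thesis by (simp add: generate.incl)
      qed
      then show ?thesis using gen_le[OF H(1) h(1)] by blast
    qed
    then show ?thesis by (simp add: h'_def)
  qed
  have "\<exists>Q. sylow_in q Q H \<and> Q \<subseteq> B" if q: "Factorial_Ring.prime (q::nat)" for q
  proof -
    obtain Q where Q: "sylow_in q Q H" using sylow_in_exists[OF q H(1)] by blast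
    then have Qg: "subgroup Q G" "Q \<subseteq> H" by (auto simp: sylow_in_def)
    obtain m where m: "card Q = q ^ m" using Q by (auto simp: sylow_in_def)
    have "h \<in> B" if h: "h \<in> Q" for h
    proof -
      have hc: "h \<in> carrier G" "h \<in> H" using h Qg by auto
      have "card (generate G {h}) dvd card Q"
        using gen_le[OF Qg(1) h] hc Qg by (intro card_dvd generate_is_subgroup) auto
      then have "h [^] (q ^ m) = \<one>" using hc m generate_pow_card[OF hc(1)] by (simp add: pow_eq_id)
      then have "cnj h g \<in> H" using key[OF q hc(2)] by blast
      then show ?thesis using hc gc by (simp add: B_def cnj_mem_iff H.subset)
    qed
    then show ?thesis using Q by blast
  qed
  then have "B = H" using eq_of_all_sylows[OF B _ H(1)] by (simp add: B_def)
  then have "H \<subseteq> conj_set G H (inv g)" by (auto simp: B_def)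
  then have "conj_set G H g \<subseteq> H" using conj_set_subset_iff[OF H.subset H.subset gc] by simp
  then show "g \<in> nrm H" using nrmI[OF H.subset gc] by blast
qed

section \<open>TI-subgroups\<close>

lemma TI_nrm:
  assumes "TI_subgroup L G" "subgroup L G" "g \<in> carrier G" "z \<in> L" "z \<in> conj_set G L g" "z \<noteq> \<one>"
  shows "g \<in> nrm L"
proof -
  have "conj_set G L g \<inter> L = L" using assms unfolding TI_subgroup_def by blast
  then show ?thesis using nrmI'[OF subgroup_subset[OF assms(2)] assms(3)] by blast
qed

text \<open>An element normalising \<open>B\<close> keeps \<open>z\<close> in both \<open>L\<close>
  and its conjugate, so these are equal.\<close>

lemma TI_nrm_sub:
  assumes "TI_subgroup L G" "subgroup L G" "B \<subseteq> L" "z \<in> B" "z \<noteq> \<one>"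
  shows "nrm B \<subseteq> nrm L"
proof
  fix g assume g: "g \<in> nrm B"
  then have "z \<in> conj_set G B g" using assms by (simp add: nrm_def)
  then have "z \<in> conj_set G L g" using conj_set_mono[OF assms(3), of g] by blast
  moreover have "g \<in> carrier G" using g nrm_subset by blast
  ultimately show "g \<in> nrm L" using TI_nrm[OF assms(1,2)] assms(3-5) by blast
qed

lemma TI_self_normalizing_frob:
  assumes "TI_subgroup L G" "subgroup L G" "nrm L \<subseteq> L" "L \<noteq> carrier G" "L \<noteq> {\<one>}"
  shows "frob L (carrier G)"
proof -
  have "conj_set G L x \<inter> L = {\<one>}" if x: "x \<in> carrier G - L" for x
  proof (rule ccontr)
    assume n: "\<not> ?thesis"
    then have "conj_set G L x \<inter> L = L" using assms(1) x unfolding TI_subgroup_def by blast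
    then have "L \<subseteq> conj_set G L x" by blast
    then have "x \<in> nrm L" using nrmI'[OF subgroup_subset[OF assms(2)]] x by blast
    then show False using x assms(3) by blast
  qed
  then show ?thesis using assms subgroup_subset[OF assms(2)] by (auto simp: frob_def subgroup_self)
qed

lemma not_nil_nontrivial: "\<not> nil H \<Longrightarrow> H \<noteq> {\<one>}"
  using nil_trivial by auto

lemma obtain_nontrivial:
  assumes "subgroup H G" "H \<noteq> {\<one>}"
  obtains z where "z \<in> H" "z \<noteq> \<one>"
  using assms subgroup.one_closed by blast

text \<open>Maximality is taken among commuting subsets: an element centralizing \<open>H\<close>
  and \<open>A\<close> can be added to \<open>A\<close>. The resulting fixed-point equation shows at
  once that \<open>A\<close> is a subgroup and that \<open>HA\<close> is self-centralizing.\<close>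

lemma maximal_commuting_in_centralizer:
  assumes H: "H \<subseteq> carrier G"
  shows "\<exists>A. A = centralizer G (H \<union> A) \<and> A \<subseteq> centralizer G H \<and> (\<forall>x\<in>A. \<forall>y\<in>A. x \<otimes> y = y \<otimes> x)"
proof -
  let ?P = "\<lambda>A. A \<subseteq> centralizer G H \<and> (\<forall>x\<in>A. \<forall>y\<in>A. x \<otimes> y = y \<otimes> x)"
  have fC: "finite (centralizer G H)" by simp
  then have bd: "\<forall>A. ?P A \<longrightarrow> card A < Suc (card (centralizer G H))" by (auto simp: less_Suc_eq_le intro: card_mono)
  have "\<exists>A. ?P A \<and> (\<forall>B. ?P B \<longrightarrow> card B \<le> card A)"
    by (rule ex_has_greatest_nat[OF _ bd, of "{}"]) simp
  then obtain A where A: "?P A" "\<And>B. ?P B \<Longrightarrow> card B \<le> card A" by metis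
  have fA: "finite A" using A(1) fC finite_subset by blast
  have "x \<in> A" if x: "x \<in> centralizer G (H \<union> A)" for x
  proof (rule ccontr)
    assume nx: "x \<notin> A"
    have "?P (insert x A)" using A(1) x by (auto simp: centralizer_def)
    then have "card (insert x A) \<le> card A" by (rule A(2))
    then show False using fA nx by simp
  qed
  moreover have "A \<subseteq> centralizer G (H \<union> A)" using A(1) unfolding centralizer_def by blast
  ultimately show ?thesis using A(1) by blast
qed

end

section \<open>Consequences of the hypothesis on self-centralizing subgroups\<close>

locale ti_or_subnormal = fin_group +
  fixes p :: nat
  assumes p: "Factorial_Ring.prime p"
    and ti: "subgroup L G \<Longrightarrow> self_centralizing L G \<Longrightarrow> \<not> nilpotent_group (G\<lparr>carrier := L\<rparr>) \<Longrightarrow>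
      p dvd card L \<Longrightarrow> TI_subgroup L G \<or> subnormal L G"
begin

text \<open>The subgroups that the hypothesis covers with a TI or subnormal conclusion; by
  \<open>big_mono\<close> the class is closed under overgroups.\<close>

definition big :: "'a set \<Rightarrow> bool" where
  "big L \<longleftrightarrow> subgroup L G \<and> self_centralizing L G \<and> \<not> nil L \<and> p dvd card L"

lemma big_mono:
  assumes "big L" "subgroup Z G" "L \<subseteq> Z" shows "big Z"
proof -
  have L: "subgroup L G" "centralizer G L \<subseteq> L" "\<not> nil L" "p dvd card L"
    using assms(1) by (auto simp: big_def self_centralizing_def)
  have "centralizer G Z \<subseteq> Z" using centralizer_anti[OF assms(3)] L(2) assms(3) by blast
  moreover have "p dvd card Z" using card_dvd[OF L(1) assms(2,3)] L(4) dvd_trans by blast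
  ultimately show ?thesis using nil_mono[OF L(1) assms(2,3)] L(3) assms(2) by (auto simp: big_def self_centralizing_def)
qed

lemma big_TI: "big L \<Longrightarrow> \<not> subnormal L G \<Longrightarrow> TI_subgroup L G"
  using ti by (auto simp: big_def)

lemma big_set_mult_centralizer:
  assumes M: "subgroup M G" "\<not> nil M" "p dvd card M"
  shows "big (M <#> centralizer G M)" "M \<subseteq> M <#> centralizer G M" "centralizer G M \<subseteq> M <#> centralizer G M"
proof -
  have Mc: "M \<subseteq> carrier G" by (rule subgroup_subset[OF M(1)])
  let ?L = "M <#> centralizer G M"
  have L: "subgroup ?L G" "M \<subseteq> ?L" "centralizer G M \<subseteq> ?L"
    by (rule subgroup_set_mult[OF M(1) subgroup_centralizer[OF Mc] centralizer_le_nrm[OF Mc]])+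
  have "centralizer G ?L \<subseteq> ?L" using centralizer_anti[OF L(2)] L(3) by blast
  moreover have "p dvd card ?L" using card_dvd[OF M(1) L(1,2)] M(3) dvd_trans by blast
  ultimately show "big ?L" using L(1) nil_mono[OF M(1) L(1,2)] M(2) by (auto simp: big_def self_centralizing_def)
  show "M \<subseteq> ?L" "centralizer G M \<subseteq> ?L" by (rule L)+
qed

lemma normalizer_frob:
  assumes L: "big L" "\<not> subnormal L G"
  shows "frob (nrm L) (carrier G)"
proof -
  have Lg: "subgroup L G" and nL: "\<not> nil L" and sc: "centralizer G L \<subseteq> L" using L by (auto simp: big_def self_centralizing_def)
  have Lc: "L \<subseteq> carrier G" by (rule subgroup_subset[OF Lg])
  define N where "N = nrm L"
  have N: "subgroup N G" "L \<subseteq> N" using Lc subgroup_le_nrm[OF Lg] by (auto simp: N_def)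
  have bN: "big N" by (rule big_mono[OF L(1) N])
  have nN: "\<not> subnormal N G" using subnormal_normal[OF _ Lg N(2)] L(2) by (auto simp: N_def)
  have TIL: "TI_subgroup L G" and TIN: "TI_subgroup N G" using big_TI L bN nN by auto
  \<comment> \<open>If \<open>x\<close> normalised \<open>N\<close> but not \<open>L\<close>, then
    \<open>L\<close> and its conjugate by \<open>x\<close> would be normal in \<open>N\<close> and
    meet trivially, hence commute. Since \<open>L\<close> is self-centralizing, the conjugate would
    lie in \<open>L\<close> and be trivial.\<close>
  have "nrm N \<subseteq> N"
  proof (rule ccontr)
    assume "\<not> ?thesis"
    then obtain x where x: "x \<in> nrm N" "x \<notin> nrm L" by (auto simp: N_def)
    have xc: "x \<in> carrier G" using x nrm_subset by blast
    have Nx: "conj_set G N x = N" using x by (simp add: nrm_def)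
    let ?B = "conj_set G L x"
    have B: "subgroup ?B G" using Lg xc by blast
    have BL: "L \<inter> ?B = {\<one>}"
    proof (rule ccontr)
      assume "\<not> ?thesis"
      then have "?B \<inter> L = L" using TIL xc unfolding TI_subgroup_def by blast
      then show False using nrmI'[OF Lc xc] x(2) by blast
    qed
    have "nrm ?B = N" using nrm_conj_set[OF Lc xc] Nx by (simp add: N_def)
    moreover have "?B \<subseteq> N" using conj_set_mono[OF N(2), of x] Nx by simp
    ultimately have "?B \<subseteq> centralizer G L"
      using N(2) BL by (intro normal_disjoint_commute Lg B) (auto simp: N_def)
    then have "?B = {\<one>}" using sc BL by blast
    then have "L = {\<one>}" using conj_set_trivial_iff[OF Lc xc] by simp
    then show False using not_nil_nontrivial[OF nL] by simp
  qed
  moreover have "N \<noteq> carrier G" using nN subnormal_top[of G] by auto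
  moreover have "N \<noteq> {\<one>}" using bN not_nil_nontrivial by (auto simp: big_def)
  ultimately have "frob N (carrier G)" using TI_self_normalizing_frob[OF TIN N(1)] by blast
  then show ?thesis by (simp add: N_def)
qed

end

section \<open>A non-subnormal subgroup with nontrivial commuting part \<open>A\<close>\<close>

locale ti_config = ti_or_subnormal +
  fixes H A
  assumes H: "subgroup H G" "\<not> nilpotent_group (G\<lparr>carrier := H\<rparr>)" "p dvd card H" "\<not> subnormal H G"
    and A: "A = centralizer G (H \<union> A)" "A \<subseteq> centralizer G H" "\<And>x y. x \<in> A \<Longrightarrow> y \<in> A \<Longrightarrow> x \<otimes> y = y \<otimes> x"
    and A_ne: "A \<noteq> {\<one>}"
begin

definition K where "K = H <#> A"
definition N where "N = nrm K"

lemma Hc: "H \<subseteq> carrier G" by (rule subgroup_subset[OF H(1)])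

lemma Ac: "A \<subseteq> carrier G" using A(2) centralizer_subset by blast

lemma A_subgroup: "subgroup A G"
  by (subst A(1)) (use Hc Ac in simp)

lemma K_subgroup: "subgroup K G" and H_le_K: "H \<subseteq> K" and A_le_K: "A \<subseteq> K"
  using subgroup_set_mult[OF H(1) A_subgroup] A(2) centralizer_le_nrm[OF Hc] unfolding K_def by blast+

lemma Kc: "K \<subseteq> carrier G" by (rule subgroup_subset[OF K_subgroup])

lemma A_central: "A \<subseteq> centralizer G K"
proof -
  have "H \<subseteq> centralizer G A" using centralizer_sym[OF Hc A(2)] .
  moreover have "A \<subseteq> centralizer G A" using A(3) Ac unfolding centralizer_def by blast
  ultimately have "K \<subseteq> centralizer G A" unfolding K_def by (intro set_mult_least) (use Ac in simp_all)
  then show ?thesis using centralizer_sym[OF Ac] by blast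
qed

lemma K_le_nrm: "H \<subseteq> Z \<Longrightarrow> Z \<subseteq> K \<Longrightarrow> subgroup Z G \<Longrightarrow> K \<subseteq> nrm Z"
proof -
  assume Z: "H \<subseteq> Z" "Z \<subseteq> K" "subgroup Z G"
  have "A \<subseteq> nrm Z" using A_central centralizer_anti[OF Z(2)] centralizer_le_nrm[OF subgroup_subset[OF Z(3)]] by blast
  moreover have "H \<subseteq> nrm Z" using subgroup_le_nrm[OF Z(3)] Z(1) by blast
  ultimately show ?thesis unfolding K_def using subgroup_subset[OF Z(3)] by (intro set_mult_least) simp_all
qed

lemma K_big: "big K"
proof -
  have "centralizer G K \<subseteq> A" by (subst A(1)) (intro centralizer_anti, use H_le_K A_le_K in blast)
  then have "centralizer G K \<subseteq> K" using A_le_K by blast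
  then show ?thesis
    using K_subgroup nil_mono[OF H(1) K_subgroup H_le_K] H card_dvd[OF H(1) K_subgroup H_le_K] dvd_trans
    by (auto simp: big_def self_centralizing_def)
qed

lemma N_frob: "frob N (carrier G)"
  unfolding N_def
proof (rule normalizer_frob[OF K_big])
  show "\<not> subnormal K G" using subnormal_normal[OF _ H(1) H_le_K K_le_nrm[OF subset_refl H_le_K H(1)]] H(4) by blast
qed

lemma N_subgroup: "subgroup N G" using N_frob by (simp add: frob_def)

lemma K_le_N: "K \<subseteq> N" unfolding N_def by (rule subgroup_le_nrm[OF K_subgroup])

text \<open>Nontrivial subgroups of a Frobenius complement are not subnormal in \<open>G\<close>, so
  inside \<open>N\<close> the hypothesis always yields TI.\<close>

lemma big_le_N_TI: "big L \<Longrightarrow> L \<subseteq> N \<Longrightarrow> TI_subgroup L G"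
  using big_TI frob_not_subnormal[OF N_frob _ refl] not_nil_nontrivial[of L] by (auto simp: big_def)

lemma p_dvd_N: "p dvd card N"
  using K_big card_dvd[OF K_subgroup N_subgroup K_le_N] dvd_trans by (auto simp: big_def)

lemma perfect_le_H:
  assumes D: "perfect D" "D \<subseteq> N"
  shows "D \<subseteq> H"
proof -
  obtain z where z: "z \<in> K" "z \<noteq> \<one>" using obtain_nontrivial[OF K_subgroup] K_big not_nil_nontrivial[of K] by (auto simp: big_def)
  have "D \<subseteq> K"
  proof (rule perfect_le_of_dedekind_quotient[OF D N_subgroup K_subgroup K_le_N])
    fix Z assume Z: "subgroup Z G" "K \<subseteq> Z" "Z \<subseteq> N"
    \<comment> \<open>\<open>Z\<close> contains \<open>K\<close>, so being TI it is normalised by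
      everything that normalises \<open>K\<close>.\<close>
    have "TI_subgroup Z G" by (rule big_le_N_TI[OF big_mono[OF K_big Z(1,2)] Z(3)])
    then show "N \<subseteq> nrm Z" using TI_nrm_sub[OF _ Z(1,2) z] by (simp add: N_def)
  qed
  then show ?thesis
    by (rule perfect_le_of_dedekind_quotient[OF D(1) _ K_subgroup H(1) H_le_K]) (rule K_le_nrm)
qed

text \<open>With \<open>M\<close> maximal in \<open>D\<close> and \<open>L\<close> the product of
  \<open>M\<close> and its centralizer, \<open>D\<close> normalises \<open>L\<close>, and
  \<open>L\<close> normalises \<open>M\<close>. The intersection of \<open>L\<close> and
  \<open>D\<close> is \<open>M\<close> or \<open>D\<close>, and either way \<open>M\<close> would be
  normal in \<open>D\<close>.\<close>

lemma no_perfect: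
  assumes D: "perfect D" "D \<subseteq> N" "p dvd card D"
  shows False
proof -
  have DH: "D \<subseteq> H" by (rule perfect_le_H[OF D(1,2)])
  have Dg: "subgroup D G" using D(1) by (simp add: perfect_def)
  obtain Z where Z: "subgroup Z G" "Z \<subset> D" "p dvd card Z" "\<not> nil Z"
    using perfect_has_nonnilpotent_subgroup[OF p D(1,3)] by blast
  obtain M where M: "subgroup M G" "Z \<subseteq> M" "M \<subset> D"
    and max: "\<And>Y. subgroup Y G \<Longrightarrow> M \<subseteq> Y \<Longrightarrow> Y \<subseteq> D \<Longrightarrow> Y = M \<or> Y = D"
    using exists_maximal_subgroup[OF Z(1,2) Dg] by blast
  have nM: "\<not> nil M" using nil_mono[OF Z(1) M(1,2)] Z(4) by blast
  have pM: "p dvd card M" using card_dvd[OF Z(1) M(1,2)] Z(3) dvd_trans by blast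
  define L where "L = M <#> centralizer G M"
  have L: "big L" "M \<subseteq> L" "centralizer G M \<subseteq> L" unfolding L_def by (rule big_set_mult_centralizer[OF M(1) nM pM])+
  have Lg: "subgroup L G" using L(1) by (simp add: big_def)
  obtain z where z: "z \<in> M" "z \<noteq> \<one>" using obtain_nontrivial[OF M(1) not_nil_nontrivial[OF nM]] by blast
  have "centralizer G M \<subseteq> N"
  proof
    fix c assume c: "c \<in> centralizer G M"
    then show "c \<in> N" using frob_centralizer[OF N_frob _ z(2), of c] z(1) M(3) D(2) by (auto simp: centralizer_def)
  qed
  then have "L \<subseteq> N" unfolding L_def using M(3) D(2) by (intro set_mult_least N_subgroup) auto
  then have TI: "TI_subgroup L G" by (rule big_le_N_TI[OF L(1)])
  have AL: "A \<subseteq> L" using A(2) centralizer_anti[of M H] M(3) DH L(3) by blast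
  obtain a where a: "a \<in> A" "a \<noteq> \<one>" using obtain_nontrivial[OF A_subgroup A_ne] by blast
  have "D \<subseteq> nrm A" using DH centralizer_sym[OF Hc A(2)] centralizer_le_nrm[OF Ac] by blast
  then have DL: "D \<subseteq> nrm L" using TI_nrm_sub[OF TI Lg AL a] by blast
  have Lnrm: "L \<subseteq> nrm M" unfolding L_def
    using subgroup_le_nrm[OF M(1)] centralizer_le_nrm[OF subgroup_subset[OF M(1)]] subgroup_subset[OF M(1)]
    by (intro set_mult_least) simp_all
  have "L \<inter> D = M \<or> L \<inter> D = D" using L(2) M(3) by (intro max subgroups_Inter_pair Lg Dg) auto
  then have "D \<subseteq> nrm M"
  proof
    assume e: "L \<inter> D = M"
    have "D \<subseteq> nrm L \<inter> nrm D" using DL subgroup_le_nrm[OF Dg] by blast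
    then show ?thesis using nrm_Int[OF subgroup_subset[OF Lg] subgroup_subset[OF Dg]] e by auto
  next
    assume "L \<inter> D = D"
    then show ?thesis using Lnrm by blast
  qed
  then show False using perfect_maximal_not_normal[OF D(1) M(1,3) max] by blast
qed

lemma p_dvd_sylow_normalizer:
  assumes r: "Factorial_Ring.prime (r::nat)" "r dvd card (carrier G) div card N" and T: "sylow_in r T (carrier G)"
  shows "p dvd card (nrm T)"
proof (rule ccontr)
  assume np: "\<not> p dvd card (nrm T)"
  let ?G = "carrier G"
  have Gg: "subgroup ?G G" by (rule subgroup_self)
  have rN: "\<not> r dvd card N" using frob_hall[OF N_frob r(1)] r(2) by blast
  have Tg: "subgroup T G" using T by (simp add: sylow_in_def)
  obtain tk where tk: "card T = r ^ tk" using T by (auto simp: sylow_in_def)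
  have Nc: "N \<subseteq> ?G" by (rule subgroup_subset[OF N_subgroup])
  \<comment> \<open>\<open>J\<close> is a smallest normal subgroup of index prime to
    \<open>p\<close>. It contains the Sylow p-subgroup \<open>S\<close>, and minimality is what will
    make it perfect.\<close>
  let ?P = "\<lambda>J. subgroup J G \<and> ?G \<subseteq> nrm J \<and> \<not> p dvd card ?G div card J"
  have "card ?G div card ?G = 1"
    by (rule div_self[OF less_imp_neq[OF card_subgroup_pos[OF Gg], symmetric]])
  then have "?P ?G" using subgroup_le_nrm[OF Gg] Gg prime_gt_1_nat[OF p] by simp
  then have "\<exists>J. ?P J \<and> (\<forall>J'. ?P J' \<longrightarrow> card J \<le> card J')" by (rule ex_has_least_nat)
  then obtain J where J: "subgroup J G" "?G \<subseteq> nrm J" "\<not> p dvd card ?G div card J"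
    and min: "\<And>J'. ?P J' \<Longrightarrow> card J \<le> card J'" by metis
  have Jc: "J \<subseteq> ?G" by (rule subgroup_subset[OF J(1)])
  obtain S where SN: "sylow_in p S N" using sylow_in_exists[OF p N_subgroup] by blast
  then have S: "subgroup S G" "S \<subseteq> N" by (auto simp: sylow_in_def)
  obtain sk where sk: "card S = p ^ sk" using SN by (auto simp: sylow_in_def)
  have "card S \<noteq> 1" by (rule sylow_nontrivial[OF SN p_dvd_N])
  then have pS: "p dvd card S" using sk by (cases sk) auto
  have "\<not> p dvd card ?G div card S"
    using index_mult[OF S(1) N_subgroup Gg S(2) Nc] frob_hall[OF N_frob p p_dvd_N] SN p
    by (auto simp: sylow_in_def prime_dvd_mult_iff)
  then have SG: "sylow_in p S ?G" using S sk subgroup_subset[OF S(1)] by (auto simp: sylow_in_def)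
  have SJ: "S \<subseteq> J" by (rule p_group_le_normal[OF p S(1) sk J])
  have syl: "sylow_in p S J" by (rule sylow_in_intermediate[OF SG Gg J(1) SJ Jc])
  obtain s where s: "s \<in> S" "s \<noteq> \<one>" using obtain_nontrivial[OF S(1)] \<open>card S \<noteq> 1\<close> subgroup_nontrivial[OF S(1)] by blast
  have nS: "nrm S \<subseteq> N" using frob_nrm[OF N_frob S(2) s] nrm_subset by blast
  have NJ_nrm: "N \<subseteq> nrm J" using J(2) Nc by blast
  \<comment> \<open>Frattini for \<open>S\<close>, whose normalizer lies in \<open>N\<close>.
    Consequently \<open>|G:J|\<close> divides \<open>|N|\<close>, which is prime to
    \<open>r\<close>, and so \<open>T <= J\<close>.\<close>
  have GJN: "?G = J <#> N"
  proof
    show "J <#> N \<subseteq> ?G" by (rule set_mult_least[OF Gg Jc Nc])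
    show "?G \<subseteq> J <#> N"
    proof
      fix g assume g: "g \<in> ?G"
      have "g \<in> nrm J" using g J(2) by blast
      then obtain n j where nj: "n \<in> nrm S" "j \<in> J" "g = n \<otimes> j" using sylow_frattini[OF p J(1) syl] by blast
      have n: "n \<in> N" using nj(1) nS by blast
      have JN: "subgroup (J <#> N) G" "J \<subseteq> J <#> N" "N \<subseteq> J <#> N" by (rule subgroup_set_mult[OF J(1) N_subgroup NJ_nrm])+
      show "g \<in> J <#> N" unfolding nj(3) using subgroup.m_closed[OF JN(1)] JN n nj(2) by blast
    qed
  qed
  define D where "D = J \<inter> N"
  have D: "subgroup D G" unfolding D_def using subgroups_Inter_pair[OF J(1) N_subgroup] .
  have cN: "card N = (card ?G div card J) * card D"
    unfolding D_def by (rule index_set_mult[OF J(1) N_subgroup Gg GJN Jc])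
  then have "card ?G div card J dvd card N" by (metis dvd_triv_left)
  then have "\<not> r dvd card ?G div card J" using rN dvd_trans by blast
  then have TJ: "T \<subseteq> J" using p_group_le_normal[OF r(1) Tg tk J(1,2)] by blast
  have Tc: "T \<subseteq> ?G" by (rule subgroup_subset[OF Tg])
  define J' where "J' = derived G J"
  have J': "subgroup J' G" "J' \<subseteq> J"
    unfolding J'_def using derived_is_subgroup[OF Jc] derived_incl[OF subset_refl J(1)] by auto
  have J'n: "?G \<subseteq> nrm J'" using derived_nrm[OF J(1)] J(2) by (auto simp: J'_def)
  define M where "M = nrm T \<inter> J"
  have M: "subgroup M G" unfolding M_def using subgroups_Inter_pair[OF subgroup_nrm[OF Tc] J(1)] .
  \<comment> \<open>The product of \<open>J'\<close> and \<open>T\<close> is normal in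
    \<open>J\<close>, as it contains the derived subgroup. Frattini for its Sylow subgroup
    \<open>T\<close> makes \<open>|J:J'|\<close> divide \<open>|nrm T|\<close>, so it is prime to
    \<open>p\<close> and minimality gives \<open>J' = J\<close>.\<close>
  have JJM: "J = J' <#> M"
  proof
    show "J' <#> M \<subseteq> J" using J'(2) by (intro set_mult_least J(1)) (auto simp: M_def)
    have Tn: "T \<subseteq> nrm J'" using J'n Tc by blast
    let ?Y = "J' <#> T"
    have Y: "subgroup ?Y G" "J' \<subseteq> ?Y" "T \<subseteq> ?Y" by (rule subgroup_set_mult[OF J'(1) Tg Tn])+
    have YJ: "?Y \<subseteq> J" by (rule set_mult_least[OF J(1) J'(2) TJ])
    have sylT: "sylow_in r T ?Y" by (rule sylow_in_intermediate[OF T Gg Y(1,3) subgroup_subset[OF Y(1)]])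
    show "J \<subseteq> J' <#> M"
    proof
      fix j assume j: "j \<in> J"
      have jc: "j \<in> ?G" using j Jc by blast
      have "j \<in> nrm ?Y"
      proof (rule nrmI[OF subgroup_subset[OF Y(1)] jc], rule subsetI)
        fix w assume "w \<in> conj_set G ?Y j"
        then obtain x where x: "x \<in> ?Y" "w = cnj x j" by (auto simp: conj_set_image)
        have xJ: "x \<in> J" "x \<in> ?G" using x YJ Jc by auto
        have "inv x \<otimes> inv j \<otimes> inv (inv x) \<otimes> inv (inv j) \<in> J'"
          unfolding J'_def using xJ j subgroup.m_inv_closed[OF J(1)] by (intro commutator_in_derived) auto
        then have "x \<otimes> (inv x \<otimes> inv j \<otimes> inv (inv x) \<otimes> inv (inv j)) \<in> ?Y"
          using x Y subgroup.m_closed[OF Y(1)] by blast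
        moreover have "x \<otimes> (inv x \<otimes> inv j \<otimes> inv (inv x) \<otimes> inv (inv j)) = w"
          using x xJ jc by (simp add: cnj_def group_word_simps)
        ultimately show "w \<in> ?Y" by simp
      qed
      then obtain n y where ny: "n \<in> nrm T" "y \<in> ?Y" "j = n \<otimes> y" using sylow_frattini[OF r(1) Y(1) sylT] by blast
      obtain d t where dt: "d \<in> J'" "t \<in> T" "y = d \<otimes> t" using ny(2) unfolding set_mult_def by blast
      have c: "n \<in> ?G" "d \<in> ?G" "t \<in> ?G" "y \<in> ?G" "y \<in> J"
        using ny nrm_subset dt subgroup_mem[OF J'(1)] Tc YJ Jc by blast+
      have "n = j \<otimes> inv y" using c ny(3) by (simp add: m_assoc)
      then have nJ: "n \<in> J" using j c(5) subgroup.m_closed[OF J(1)] subgroup.m_inv_closed[OF J(1)] by simp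
      have "inv n \<in> nrm J'" using c(1) J'n by blast
      then have "cnj d (inv n) \<in> J'" using nrm_cnj dt(1) by blast
      moreover have "n \<otimes> t \<in> M"
      proof -
        have "t \<in> nrm T" using dt(2) subgroup_le_nrm[OF Tg] by blast
        then have "n \<otimes> t \<in> nrm T" using ny(1) subgroup.m_closed[OF subgroup_nrm[OF Tc]] by blast
        moreover have "n \<otimes> t \<in> J" using nJ dt(2) TJ subgroup.m_closed[OF J(1)] by blast
        ultimately show ?thesis by (simp add: M_def)
      qed
      moreover have "j = cnj d (inv n) \<otimes> (n \<otimes> t)" using c ny(3) dt(3) by (simp add: cnj_def group_word_simps)
      ultimately show "j \<in> J' <#> M" unfolding set_mult_def by blast
    qed
  qed
  have "card J div card J' dvd card M" using index_set_mult[OF J'(1) M J(1) JJM J'(2)] by (metis dvd_triv_left)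
  moreover have "card M dvd card (nrm T)" using M Tc by (intro card_dvd) (auto simp: M_def)
  ultimately have "\<not> p dvd card J div card J'" using np dvd_trans by blast
  then have "\<not> p dvd card ?G div card J'"
    using index_mult[OF J'(1) J(1) Gg J'(2) Jc] J(3) p by (simp add: prime_dvd_mult_iff)
  then have "card J \<le> card J'" using J'(1) J'n by (intro min) simp
  then have "J' = J" using J'(2) finite_subgroup[OF J(1)] by (intro card_seteq) auto
  then have perfJ: "perfect J" using J(1) by (simp add: perfect_def J'_def)
  \<comment> \<open>\<open>D\<close> has the same index in \<open>J\<close> as \<open>N\<close> has
    in \<open>G\<close>; this is how the Hall property passes from \<open>N\<close> to
    \<open>D\<close>.\<close>
  have idx: "card J div card D = card ?G div card N"
  proof -
    obtain a where a: "card ?G = card J * a" using card_dvd[OF J(1) Gg Jc] by (auto elim: dvdE)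
    obtain b where b: "card J = card D * b" using card_dvd[OF D J(1)] by (auto elim: dvdE simp: D_def)
    have pos: "card J > 0" "card D > 0" "card ?G > 0" using card_subgroup_pos[OF J(1)] card_subgroup_pos[OF D] card_subgroup_pos[OF Gg] by auto
    have "card N = a * card D" using cN a pos by simp
    then have "card ?G = card N * b" using a b by (simp add: mult_ac)
    moreover have "card N > 0" using card_subgroup_pos[OF N_subgroup] .
    ultimately show ?thesis using b pos by simp
  qed
  have DN: "card D dvd card N" using card_dvd[OF D N_subgroup] by (simp add: D_def)
  have "perfect D"
  proof (rule perfect_hall_subgroup[OF perfJ D])
    show "D \<subseteq> J" by (simp add: D_def)
    show "coprime (card D) (card J div card D)"
    proof (rule ccontr)
      assume "\<not> ?thesis"
      then have "gcd (card D) (card J div card D) \<noteq> 1" by (simp add: coprime_iff_gcd_eq_1)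
      then obtain q where q: "Factorial_Ring.prime q" "q dvd gcd (card D) (card J div card D)" using prime_factor_nat by blast
      then have "q dvd card N" "q dvd card ?G div card N" using DN idx dvd_trans by auto
      then show False using frob_hall[OF N_frob q(1)] by blast
    qed
    fix x g assume x: "x \<in> D" and g: "g \<in> J" and xg: "cnj x g \<in> D"
    have c: "x \<in> ?G" "g \<in> ?G" using x g Jc by (auto simp: D_def)
    show "x \<otimes> inv (cnj x g) \<in> derived G D"
    proof (cases "x = \<one>")
      case True
      then show ?thesis using c subgroup.one_closed[OF derived_is_subgroup[OF subgroup_subset[OF D]]] by simp
    next
      case False
      have "cnj x g \<noteq> \<one>" using False c by (simp add: cnj_eq_one_iff)
      moreover have "cnj x g \<in> N" "cnj x g \<in> conj_set G N g" using xg x by (auto simp: D_def conj_set_image)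
      \<comment> \<open>Only elements of \<open>N\<close> conjugate a nontrivial element of
        \<open>N\<close> into \<open>N\<close>; so fusion of elements of \<open>D\<close> in
        \<open>J\<close> happens inside \<open>D\<close>.\<close>
      ultimately have "g \<in> N" using frob_mem[OF N_frob c(2)] by blast
      then have gD: "inv g \<in> D" using g subgroup.m_inv_closed[OF D] by (simp add: D_def)
      have "x \<otimes> inv (cnj x g) = x \<otimes> inv g \<otimes> inv x \<otimes> inv (inv g)" using c by (simp add: cnj_def group_word_simps)
      then show ?thesis using commutator_in_derived[OF x gD] by simp
    qed
  qed
  moreover have "p dvd card D"
    using pS card_dvd[OF S(1) D] SJ S(2) dvd_trans by (auto simp: D_def)
  ultimately show False using no_perfect[of D] by (auto simp: D_def)
qed

lemma N_normalizes_sylow: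
  assumes r: "Factorial_Ring.prime (r::nat)" "r dvd card (carrier G) div card N"
  shows "\<exists>T. sylow_in r T (carrier G) \<and> N \<subseteq> nrm T"
proof -
  let ?G = "carrier G"
  have Gg: "subgroup ?G G" by (rule subgroup_self)
  have Nc: "N \<subseteq> ?G" by (rule subgroup_subset[OF N_subgroup])
  have rN: "\<not> r dvd card N" using frob_hall[OF N_frob r(1)] r(2) by blast
  obtain T0 where T0: "sylow_in r T0 ?G" using sylow_in_exists[OF r(1) Gg] by blast
  have T0c: "T0 \<subseteq> ?G" using T0 by (simp add: sylow_in_def)
  have "p ^ 1 dvd card (nrm T0)" using p_dvd_sylow_normalizer[OF r T0] by simp
  then obtain P where P: "subgroup P G" "P \<subseteq> nrm T0" "card P = p ^ 1"
    using subgroup_prime_power_exists[OF p subgroup_nrm[OF T0c]] by blast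
  \<comment> \<open>Conjugation by \<open>x\<close> arranges that the normalizer of the Sylow
    subgroup shares a subgroup of order \<open>p\<close> with \<open>N\<close>, as
    \<open>frob_comparable\<close> requires.\<close>
  obtain x where x: "x \<in> ?G" "conj_set G P x \<subseteq> N"
    using pgroup_conj_into[OF p P(1,3) N_subgroup Gg Nc subgroup_subset[OF P(1)] frob_hall[OF N_frob p p_dvd_N]] by blast
  define T where "T = conj_set G T0 x"
  have T: "sylow_in r T ?G" unfolding T_def using sylow_in_conj[OF T0 Gg x(1)] conj_set_self[OF Gg x(1)] by simp
  then have Tg: "subgroup T G" by (simp add: sylow_in_def)
  have Tc: "T \<subseteq> ?G" by (rule subgroup_subset[OF Tg])
  define L where "L = nrm T"
  have Lg: "subgroup L G" unfolding L_def using Tc by simp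
  have TL: "T \<subseteq> L" unfolding L_def by (rule subgroup_le_nrm[OF Tg])
  let ?P = "conj_set G P x"
  have PL: "?P \<subseteq> L" unfolding L_def T_def nrm_conj_set[OF T0c x(1)] by (rule conj_set_mono[OF P(2)])
  have Pg: "subgroup ?P G" using P(1) x(1) by blast
  have cP: "card ?P = p" using P x subgroup_subset[OF P(1)] by simp
  have "?P \<noteq> {\<one>}" using subgroup_nontrivial[OF Pg] cP p by auto
  then obtain z where z: "z \<in> ?P" "z \<noteq> \<one>" using obtain_nontrivial[OF Pg] by blast
  have LN: "\<not> L \<subseteq> N"
  proof
    assume "L \<subseteq> N"
    then have d: "card T dvd card N" using TL by (intro card_dvd Tg N_subgroup) blast
    have "r dvd card ?G" using r(2) card_dvd[OF N_subgroup Gg Nc] by (metis dvd_mult_div_cancel dvd_mult)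
    then have "card T \<noteq> 1" by (rule sylow_nontrivial[OF T])
    moreover obtain k where "card T = r ^ k" using T by (auto simp: sylow_in_def)
    ultimately have "r dvd card T" by (cases k) auto
    then show False using d rN dvd_trans by blast
  qed
  \<comment> \<open>A nilpotent \<open>L\<close> would have to enlarge its proper subgroup formed by
    the intersection with \<open>N\<close>; but that one contains \<open>z\<close>, so its
    normalizer stays in \<open>N\<close>.\<close>
  have "\<not> nil L"
  proof
    assume nl: "nil L"
    have I: "subgroup (L \<inter> N) G" using subgroups_Inter_pair[OF Lg N_subgroup] .
    have "L \<inter> N \<subset> L" using LN by blast
    then obtain y where y: "y \<in> L - (L \<inter> N)" "y \<in> nrm (L \<inter> N)" using nil_normalizer_grows[OF Lg nl I] by blast
    have "z \<in> L \<inter> N" using z PL x by blast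
    then have "nrm (L \<inter> N) \<inter> ?G \<subseteq> N" using frob_nrm[OF N_frob _ _ z(2)] by blast
    moreover have "y \<in> nrm (L \<inter> N) \<inter> ?G" using y(2) subsetD[OF nrm_subset y(2)] by simp
    ultimately have "y \<in> N" by (rule subsetD)
    then show False using y(1) by simp
  qed
  moreover have "centralizer G L \<subseteq> L"
    using centralizer_anti[OF TL] centralizer_le_nrm[OF Tc] by (auto simp: L_def)
  moreover have "p dvd card L" using card_dvd[OF Pg Lg PL] cP by simp
  ultimately have big: "big L" using Lg by (simp add: big_def self_centralizing_def)
  have LL: "nrm L \<subseteq> L"
  proof
    fix g assume g: "g \<in> nrm L"
    have "nrm T \<inter> ?G = L" unfolding L_def using nrm_subset by (rule Int_absorb2)
    then show "g \<in> L"
      using nrm_nrm_sylow[OF r(1) Gg T _ subsetD[OF nrm_subset g]] g by (simp add: L_def)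
  qed
  have "N \<subseteq> L"
  proof (cases "L = ?G")
    case True
    then show ?thesis using Nc by simp
  next
    case False
    then have "\<not> subnormal L G" using subnormal_self_normalizing[OF _ refl LL] by blast
    then have "TI_subgroup L G" by (rule big_TI[OF big])
    then have "frob L ?G"
      using TI_self_normalizing_frob[OF _ Lg LL False] big not_nil_nontrivial by (auto simp: big_def)
    moreover have "N \<inter> L \<noteq> {\<one>}" using z PL x by blast
    ultimately show ?thesis using frob_comparable[OF N_frob] LN by blast
  qed
  then show ?thesis using T by (auto simp: L_def)
qed

lemma H_TI: "TI_subgroup H G"
proof -
  let ?G = "carrier G"
  have Nc: "N \<subset> ?G" using N_frob by (simp add: frob_def)
  obtain m where m: "card ?G = card N * m" using card_dvd[OF N_subgroup subgroup_self] Nc by (auto elim: dvdE)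
  have "card N < card ?G" using Nc by (intro psubset_card_mono) auto
  then have "m \<noteq> 1" using m by auto
  then obtain r where r: "Factorial_Ring.prime r" "r dvd m" using prime_factor_nat by blast
  have r': "r dvd card ?G div card N" using r m card_subgroup_pos[OF N_subgroup] by simp
  have rN: "\<not> r dvd card N" using frob_hall[OF N_frob r(1)] r' by blast
  obtain T where T: "sylow_in r T ?G" "N \<subseteq> nrm T" using N_normalizes_sylow[OF r(1) r'] by blast
  then have Tg: "subgroup T G" by (simp add: sylow_in_def)
  obtain k where k: "card T = r ^ k" using T by (auto simp: sylow_in_def)
  have "r dvd card ?G" using r m by simp
  then have "card T \<noteq> 1" by (rule sylow_nontrivial[OF T(1)])
  then have "T \<noteq> {\<one>}" using subgroup_nontrivial[OF Tg] by blast
  then have "rank_one q N" if "Factorial_Ring.prime q" for q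
    unfolding rank_one_def using frob_no_rank_two[OF N_frob r(1) rN Tg k _ T(2) that] by blast
  then have NH: "N \<subseteq> nrm H"
    using rank_one_normalizes_factor[OF N_subgroup _ H(1) _ A_subgroup _ A(2)] H_le_K A_le_K K_le_N
    unfolding N_def K_def by blast
  have "conj_set G H g \<inter> H = {\<one>} \<or> conj_set G H g \<inter> H = H" if g: "g \<in> ?G" for g
  proof (cases "g \<in> N")
    case True
    then show ?thesis using NH nrm_conj by blast
  next
    case False
    have "conj_set G H g \<inter> H \<subseteq> {\<one>}"
      using frob_Int[OF N_frob, of g] g False conj_set_mono[of H N g] H_le_K K_le_N by blast
    moreover have "\<one> \<in> conj_set G H g \<inter> H"
      using subgroup.one_closed[OF H(1)] subgroup.one_closed[OF subgroup_conj_set[OF H(1) g]] by blast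
    ultimately show ?thesis by blast
  qed
  then show ?thesis by (simp add: TI_subgroup_def)
qed

end

context ti_or_subnormal
begin

lemma TI_or_subnormal:
  assumes H: "subgroup H G" "\<not> nilpotent_group (G\<lparr>carrier := H\<rparr>)" "p dvd card H"
  shows "TI_subgroup H G \<or> subnormal H G"
proof (rule ccontr)
  assume n: "\<not> ?thesis"
  have Hc: "H \<subseteq> carrier G" by (rule subgroup_subset[OF H(1)])
  obtain A where A: "A = centralizer G (H \<union> A)" "A \<subseteq> centralizer G H" "\<forall>x\<in>A. \<forall>y\<in>A. x \<otimes> y = y \<otimes> x"
    using maximal_commuting_in_centralizer[OF Hc] by blast
  \<comment> \<open>For trivial \<open>A\<close> the fixed-point equation says that \<open>H\<close>
    has trivial centralizer, so the hypothesis applies to \<open>H\<close> directly.\<close>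
  have "A \<noteq> {\<one>}"
  proof
    assume a: "A = {\<one>}"
    have "centralizer G H \<subseteq> centralizer G (H \<union> A)" using Hc unfolding a by (auto simp: centralizer_def)
    moreover have "centralizer G (H \<union> A) \<subseteq> A" using A(1) by (rule equalityD2)
    ultimately have "centralizer G H \<subseteq> H" using a subgroup.one_closed[OF H(1)] by auto
    then show False using ti[OF H(1) _ H(2,3)] n by (simp add: self_centralizing_def)
  qed
  then interpret ti_config G p H A
    using H n A by (intro ti_config.intro ti_config_axioms.intro ti_or_subnormal_axioms) blast+
  show False using H_TI n by blast
qed

end

theorem theorem1p6:
  fixes G :: "('a, 'b) monoid_scheme" and p :: nat
  assumes "group G" and "finite (carrier G)"
      and "Factorial_Ring.prime p" and "p dvd order G"
  shows "(\<forall>H. subgroup H G \<and> self_centralizing H G \<and> \<not> nilpotent_group (G\<lparr>carrier := H\<rparr>)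
              \<longrightarrow> TI_subgroup H G \<or> subnormal H G \<or> \<not> p dvd card H)
     \<longleftrightarrow> (\<forall>H. subgroup H G \<and> \<not> nilpotent_group (G\<lparr>carrier := H\<rparr>)
              \<longrightarrow> TI_subgroup H G \<or> subnormal H G \<or> \<not> p dvd card H)"
    (is "?sc \<longleftrightarrow> ?all")
proof
  assume sc: ?sc
  interpret ti_or_subnormal G p
    using assms sc
    by (intro ti_or_subnormal.intro fin_group.intro fin_group_axioms.intro ti_or_subnormal_axioms.intro) auto
  show ?all using TI_or_subnormal by blast
qed blast

end
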